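(* For every integer $k\ge 1$, $$f_k(\tau)-H_k(\tau)\in S_{2k+1}(8,\chi_{-4}),$$ where $$f_k(\tau)=\frac{\eta(4\tau)^{8k-2}\,\eta(8\tau)^4}{\eta(2\tau)^{4k}}$$ and $$H_k(\tau)=\begin{cases}\dfrac{1}{2^{2k}E_{2k}}\left(2^{2k}\,\mathscr{E}_{2k+1,\chi_{-4},1}(2\tau)-\mathscr{E}_{2k+1,\chi_{-4},\chi_2}(2\tau)\right), & k\equiv 0\pmod 2,\\[2mm] -\dfrac{1}{E_{2k}}\,\mathscr{E}_{2k+1,\chi_{-4},1}(2\tau), & k\equiv 1\pmod 2.\end{cases}$$
   Context: Here $\tau$ lies in the upper half-plane $\mathbb{H}$, $q=e^{2\pi i\tau}$ (and $q^{n/R}=e^{2\pi i n\tau/R}$), and $\eta(\tau)=q^{1/24}\prod_{n\ge1}(1-q^n)$ is the Dedekind eta function. $\chi_{-4}=\left(\frac{-4}{\cdot}\right)$ is the nontrivial Dirichlet character mod $4$; $1$ is the trivial character of modulus $1$; $\chi_2$ is the principal Dirichlet character of modulus $2$ (conductor $1$). $M_k(N,\chi)$ and $S_k(N,\chi)$ denote the complex vector spaces of modular forms, respectively cusp forms, of weight $k$ on $\Gamma_0(N)$ with Nebentypus $\chi$. The Euler numbers $E_n$ are defined by $\frac{2}{e^{z}+e^{-z}}=\sum_{n\ge0}E_n\frac{z^n}{n!}$. Normalized Eisenstein series: let $\chi$ be a non-principal Dirichlet character and $\psi$ a Dirichlet character of modulus $R$ and conductor $r_\psi$, with associated primitive character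 $\psi^0$, such that $\chi(-1)\psi(-1)=(-1)^k$. Put $\ell=R/r_\psi$. Then $$\mathscr{E}_{k,\chi,\psi}(\tau)=\sum_{n\ge1}a(n)q^{n/R},\qquad a(n)=\sum_{d\mid n}\chi(n/d)\,d^{k-1}\sum_{c\mid(\ell,d)}c\,\mu(\ell/c)\,\psi^0(\ell/c)\,\overline{\psi^0}(d/c),$$ where $\mu$ is the Möbius function (the constant term is zero because $\chi$ is non-principal). The notation $\mathscr{E}_{k,\chi,\psi}(2\tau)$ means this function evaluated at $2\tau$. *)

theory Defs
  imports
    "HOL-Complex_Analysis.Complex_Analysis"
    "HOL-Computational_Algebra.Computational_Algebra"
begin

definition upper_half_plane :: "complex set"  ("\<H>") where
  "\<H> = {\<tau>. Im \<tau> > 0}"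

text \<open>The filter of neighbourhoods of the cusp at infinity: \<open>Im \<tau> \<rightarrow> \<infinity>\<close>,
  uniformly in \<open>Re \<tau>\<close>.\<close>

definition at_i_infinity :: "complex filter" where
  "at_i_infinity = filtercomap Im at_top"


subsection \<open>Dirichlet characters\<close>

text \<open>Characters are functions on all integers, vanishing off the units modulo \<open>R\<close>.\<close>

definition dirichlet_char :: "nat \<Rightarrow> (int \<Rightarrow> complex) \<Rightarrow> bool" where
  "dirichlet_char R \<psi> \<longleftrightarrow>
     R > 0 \<and>
     (\<forall>a b. \<psi> (a * b) = \<psi> a * \<psi> b) \<and>
     (\<forall>a. \<psi> (a + int R) = \<psi> a) \<and>
     (\<forall>a. \<psi> a \<noteq> 0 \<longleftrightarrow> coprime a (int R))"

definition principal_char :: "nat \<Rightarrow> int \<Rightarrow> complex" where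
  "principal_char R a = (if coprime a (int R) then 1 else 0)"

definition induced_by :: "nat \<Rightarrow> (int \<Rightarrow> complex) \<Rightarrow> nat \<Rightarrow> (int \<Rightarrow> complex) \<Rightarrow> bool" where
  "induced_by R \<psi> r \<phi> \<longleftrightarrow>
     r dvd R \<and> dirichlet_char r \<phi> \<and> (\<forall>a. coprime a (int R) \<longrightarrow> \<psi> a = \<phi> a)"

definition conductor :: "nat \<Rightarrow> (int \<Rightarrow> complex) \<Rightarrow> nat" where
  "conductor R \<psi> = (LEAST r. \<exists>\<phi>. induced_by R \<psi> r \<phi>)"

definition primitive_char :: "nat \<Rightarrow> (int \<Rightarrow> complex) \<Rightarrow> int \<Rightarrow> complex" where
  "primitive_char R \<psi> = (THE \<phi>. induced_by R \<psi> (conductor R \<psi>) \<phi>)"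

definition chi_m4 :: "int \<Rightarrow> complex" where
  "chi_m4 a = (if a mod 4 = 1 then 1 else if a mod 4 = 3 then -1 else 0)"


subsection \<open>Modular forms and cusp forms with Nebentypus\<close>

definition slash :: "nat \<Rightarrow> int \<Rightarrow> int \<Rightarrow> int \<Rightarrow> int \<Rightarrow> (complex \<Rightarrow> complex) \<Rightarrow> complex \<Rightarrow> complex" where
  "slash k a b c d f \<tau> =
     f ((of_int a * \<tau> + of_int b) / (of_int c * \<tau> + of_int d)) / (of_int c * \<tau> + of_int d) ^ k"

text \<open>Forms are total functions on \<open>\<complex>\<close>, of which only the values on the upper half-plane
  matter. Holomorphy (vanishing) at the cusps is required of
  \<open>f|\<^sub>k\<gamma>\<close> at infinity for every \<open>\<gamma>\<close> in \<open>SL\<^sub>2(\<int>)\<close>, in the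
  form of boundedness (convergence to 0) as \<open>Im \<tau> \<rightarrow> \<infinity>\<close>.\<close>

definition modular_forms :: "nat \<Rightarrow> nat \<Rightarrow> (int \<Rightarrow> complex) \<Rightarrow> (complex \<Rightarrow> complex) set" where
  "modular_forms k N chi =
     {f. f holomorphic_on \<H> \<and>
         (\<forall>a b c d :: int. a * d - b * c = 1 \<longrightarrow> int N dvd c \<longrightarrow>
            (\<forall>\<tau>\<in>\<H>. slash k a b c d f \<tau> = chi d * f \<tau>)) \<and>
         (\<forall>a b c d :: int. a * d - b * c = 1 \<longrightarrow>
            Bfun (slash k a b c d f) at_i_infinity)}"

definition cusp_forms :: "nat \<Rightarrow> nat \<Rightarrow> (int \<Rightarrow> complex) \<Rightarrow> (complex \<Rightarrow> complex) set" where
  "cusp_forms k N chi =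
     {f \<in> modular_forms k N chi.
        \<forall>a b c d :: int. a * d - b * c = 1 \<longrightarrow>
          (slash k a b c d f \<longlongrightarrow> 0) at_i_infinity}"


subsection \<open>The eta function, Euler numbers and Eisenstein series\<close>

definition dedekind_eta :: "complex \<Rightarrow> complex" where
  "dedekind_eta \<tau> = exp (2 * of_real pi * \<i> * \<tau> / 24) *
          (\<Prod>n. 1 - exp (2 * of_real pi * \<i> * of_nat (Suc n) * \<tau>))"

definition euler_number :: "nat \<Rightarrow> complex" where
  "euler_number n = fact n * fps_nth (2 / (fps_exp 1 + fps_exp (-1))) n"

definition moebius :: "nat \<Rightarrow> int" where
  "moebius n = (if squarefree n then (-1) ^ card (prime_factors n) else 0)"

definition eisenstein_coeff ::
  "nat \<Rightarrow> (int \<Rightarrow> complex) \<Rightarrow> nat \<Rightarrow> (int \<Rightarrow> complex) \<Rightarrow> nat \<Rightarrow> complex" where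
  "eisenstein_coeff k chi R \<psi> n =
     (let l = R div conductor R \<psi>; \<psi>0 = primitive_char R \<psi> in
      \<Sum>d | d dvd n. chi (int (n div d)) * of_nat d ^ (k - 1) *
        (\<Sum>c | c dvd gcd l d.
           of_nat c * of_int (moebius (l div c)) * \<psi>0 (int (l div c)) * cnj (\<psi>0 (int (d div c)))))"

text \<open>The normalized Eisenstein series of weight \<open>k \<ge> 1\<close> for \<open>chi\<close> non-principal and \<open>\<psi>\<close>
  of modulus \<open>R\<close>, with \<open>chi(-1)\<psi>(-1) = (-1)\<^sup>k\<close>.
  The modulus is an argument because it is not determined by the function \<open>\<psi>\<close>.\<close>

definition eisenstein ::
  "nat \<Rightarrow> (int \<Rightarrow> complex) \<Rightarrow> nat \<Rightarrow> (int \<Rightarrow> complex) \<Rightarrow> complex \<Rightarrow> complex" where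
  "eisenstein k chi R \<psi> \<tau> =
     (\<Sum>n. eisenstein_coeff k chi R \<psi> (Suc n) *
           exp (2 * of_real pi * \<i> * of_nat (Suc n) * \<tau> / of_nat R))"


subsection \<open>The eta quotient and its Eisenstein part\<close>

definition eta_quotient :: "nat \<Rightarrow> complex \<Rightarrow> complex" where
  "eta_quotient k \<tau> =
     dedekind_eta (4 * \<tau>) ^ (8 * k - 2) * dedekind_eta (8 * \<tau>) ^ 4 /
     dedekind_eta (2 * \<tau>) ^ (4 * k)"

definition eisenstein_part :: "nat \<Rightarrow> complex \<Rightarrow> complex" where
  "eisenstein_part k \<tau> =
     (if even k then
        1 / (2 ^ (2 * k) * euler_number (2 * k)) *
          (2 ^ (2 * k) * eisenstein (2 * k + 1) chi_m4 1 (principal_char 1) (2 * \<tau>)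
           - eisenstein (2 * k + 1) chi_m4 2 (principal_char 2) (2 * \<tau>))
      else
        - (1 / euler_number (2 * k)) *
          eisenstein (2 * k + 1) chi_m4 1 (principal_char 1) (2 * \<tau>))"

end

theory Submission
  imports Defs
begin

text \<open>
  Both sides have the form \<open>G(2\<tau>)\<close>. For the eta quotient,
  \<open>G(\<tau>) = \<eta>(2\<tau>)\<^sup>8\<^sup>k\<^sup>-\<^sup>2 \<eta>(4\<tau>)\<^sup>4 / \<eta>(\<tau>)\<^sup>4\<^sup>k\<close>; for the Eisenstein part, \<open>G\<close> is a multiple of the absolutely
  convergent lattice sum of \<open>\<chi>\<^sub>-\<^sub>4(m) \<epsilon>\<^sup>n (m\<tau> + n)\<^sup>-\<^sup>2\<^sup>k\<^sup>-\<^sup>1\<close> with \<open>\<epsilon> = (-1)\<^sup>k\<^sup>+\<^sup>1\<close>, by the Lipschitz formula. Both are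
  multiplied by \<open>\<epsilon>\<close> under \<open>\<tau> \<mapsto> \<tau> + 1\<close> and are invariant under \<open>(1 0; 4 1)\<close>, and these two
  matrices together with \<open>-1\<close> generate \<open>\<Gamma>\<^sub>0(4)\<close>, so only the cusps \<open>\<infinity>\<close>, \<open>0\<close> and \<open>1/2\<close>
  have to be examined. Both functions vanish at \<open>\<infinity>\<close> and \<open>1/2\<close>. At \<open>0\<close> the eta quotient has the
  value read off from \<open>\<eta>(-1/\<tau>)\<^sup>2 = -i\<tau> \<eta>(\<tau>)\<^sup>2\<close>, the lattice sum has the value of an
  \<open>L\<close>-series of \<open>\<chi>\<^sub>-\<^sub>4\<close>, which is an Euler number because the even part of
  \<open>\<pi> cot \<pi>(1/4 + x)\<close> is \<open>\<pi> sec 2\<pi>x\<close>, and the two agree.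

  The eta inversion follows from that of \<open>\<eta>'/\<eta>\<close>, a multiple of the weight 2 Eisenstein series.
  Subtracting the telescoping term \<open>1/(z\<^sup>2 - 1/4)\<close> from \<open>1/z\<^sup>2\<close> at \<open>z = m\<tau> + n\<close> makes the
  double series absolutely convergent; summing it in the two orders gives the two sides.
\<close>

subsection \<open>Sums over the integers and the cotangent\<close>

text \<open>Passing from \<open>D\<close> to \<open>D (2 * \<tau>)\<close> conjugates by diag(2, 1):
  a matrix (a b; c d) with \<open>8 dvd c\<close> becomes (a 2b; c/2 d). Its upper right entry is
  even, so the character \<open>\<epsilon> ^ b\<close> of \<open>\<Gamma>\<^sub>0(4)\<close>
  disappears and only \<open>chi_m4 d\<close> is left. The same \<open>\<epsilon>\<close> explains
  the two cases of the Eisenstein part: for odd \<open>k\<close> the lattice sum carries no sign in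
  \<open>n\<close>; for even \<open>k\<close> the sign \<open>(- 1) ^ n\<close> brings in
  half-integral powers of \<open>qexp z\<close>, hence the modulus 2. All exponents of the eta
  quotient are even, so inversion of the square of eta suffices and no branch of a square root of
  \<tau> has to be chosen. The cusp 1/2 needs in addition eta at \<tau> + 1/2, which a product
  identity supplies. Limits at a cusp are uniform in Re \<tau>, so the estimates of lattice sums
  must not depend on the real part; this is why the majorants below allow a shift in each
  row.\<close>

lemma has_sum_int_LIMSEQ:
  fixes f :: "int \<Rightarrow> 'a::topological_comm_monoid_add"
  assumes "(f has_sum S) UNIV"
  shows "(\<lambda>N. \<Sum>n\<in>{- int N..int N}. f n) \<longlonglongrightarrow> S"
proof -
  have "filterlim (\<lambda>N. {- int N..int N}) (finite_subsets_at_top UNIV) sequentially"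
    unfolding filterlim_finite_subsets_at_top
  proof (intro allI impI)
    fix X :: "int set" assume "finite X \<and> X \<subseteq> UNIV"
    then obtain b where b: "\<And>x. x \<in> X \<Longrightarrow> \<bar>x\<bar> \<le> b"
      by (metis finite_imageI finite_nat_set_iff_bounded_le bdd_above_finite bdd_above_def imageI)
    show "\<forall>\<^sub>F y in sequentially. finite {- int y..int y} \<and> X \<subseteq> {- int y..int y} \<and> {- int y..int y} \<subseteq> UNIV"
      using eventually_ge_at_top[of "nat b"]
    proof eventually_elim
      case (elim y)
      thus ?case using b by force
    qed
  qed
  with assms show ?thesis
    unfolding has_sum_def by (rule filterlim_compose)
qed

lemma has_sum_int_split:
  fixes f :: "int \<Rightarrow> 'a::topological_comm_monoid_add"
  assumes "((\<lambda>n. f (int n)) has_sum A) UNIV" "((\<lambda>n. f (- int n - 1)) has_sum B) UNIV"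
  shows "(f has_sum (A + B)) UNIV"
proof -
  have "(f has_sum A) {0..}"
    using assms(1) by (subst has_sum_reindex_bij_witness[of _ int nat UNIV "\<lambda>n. f (int n)" f A A]) auto
  moreover have "(f has_sum B) {..<0}"
    using assms(2)
    by (subst has_sum_reindex_bij_witness[of _ "\<lambda>n. - int n - 1" "\<lambda>n. nat (- n - 1)" UNIV "\<lambda>n. f (- int n - 1)" f B B]) auto
  ultimately have "(f has_sum (A + B)) ({0..} \<union> {..<0})"
    by (rule has_sum_Un_disjoint) auto
  moreover have "{0..} \<union> {..<0} = (UNIV :: int set)" by auto
  ultimately show ?thesis by simp
qed

lemma summable_norm_inverse_shift_power:
  fixes z :: complex
  assumes "w \<ge> 2"
  shows "summable (\<lambda>n. norm (1 / (z + of_nat n) ^ w))"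
proof (rule summable_comparison_test_ev)
  have "summable (\<lambda>n. inverse (real n ^ w))"
    using inverse_power_summable[of w] assms by simp
  thus "summable (\<lambda>n. 2 ^ w * inverse (real n ^ w))" by (rule summable_mult)
  show "\<forall>\<^sub>F n in sequentially. norm (norm (1 / (z + of_nat n) ^ w)) \<le> 2 ^ w * inverse (real n ^ w)"
    using eventually_gt_at_top[of "nat \<lceil>2 * norm z\<rceil>"]
  proof eventually_elim
    case (elim n)
    hence n: "real n > 2 * norm z" by linarith
    have "real n \<le> norm (z + of_nat n) + norm z"
      using norm_triangle_ineq4[of "z + of_nat n" z] by simp
    hence *: "norm (z + of_nat n) \<ge> real n / 2" using n by simp
    have n0: "real n > 0" using n by (smt (verit) norm_ge_zero)
    hence "inverse (norm (z + of_nat n) ^ w) \<le> inverse ((real n / 2) ^ w)"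
      using * by (intro le_imp_inverse_le power_mono) auto
    thus ?case by (simp add: norm_divide norm_power field_simps)
  qed
qed

text \<open>Logarithmic derivative of the reflection formula for the entire function
  \<open>rGamma\<close>. Off the integers neither factor of the product vanishes, so one may divide
  by it.\<close>

lemma Digamma_reflection_complex:
  fixes z :: complex
  assumes "z \<notin> \<int>"
  shows "Digamma (1 - z) - Digamma z = of_real pi * cot (of_real pi * z)"
proof -
  have z: "z \<notin> \<int>\<^sub>\<le>\<^sub>0" "1 - z \<notin> \<int>\<^sub>\<le>\<^sub>0"
    using assms nonpos_Ints_subset_Ints Ints_diff[of 1 "1 - z"] by auto
  have "((\<lambda>z. rGamma z * rGamma (1 - z)) has_field_derivative
          rGamma z * rGamma (1 - z) * (Digamma (1 - z) - Digamma z)) (at z)"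
    using z by (auto intro!: derivative_eq_intros simp: algebra_simps)
  moreover have "((\<lambda>z. sin (of_real pi * z) / of_real pi) has_field_derivative cos (of_real pi * z)) (at z)"
    by (auto intro!: derivative_eq_intros)
  moreover have "(\<lambda>z. rGamma z * rGamma (1 - z)) = (\<lambda>z. sin (of_real pi * z) / complex_of_real pi)"
    by (rule ext) (rule rGamma_reflection_complex)
  ultimately have "rGamma z * rGamma (1 - z) * (Digamma (1 - z) - Digamma z) = cos (of_real pi * z)"
    by (metis DERIV_unique)
  moreover have "rGamma z * rGamma (1 - z) = sin (of_real pi * z) / of_real pi"
    by (rule rGamma_reflection_complex)
  moreover have "rGamma z * rGamma (1 - z) \<noteq> 0"
    using z by (auto simp: rGamma_eq_zero_iff)
  moreover from calculation have "sin (of_real pi * z) \<noteq> 0" by auto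
  ultimately show ?thesis
    by (simp add: cot_def field_simps)
qed

text \<open>The value of \<open>\<Sum>\<^sub>n\<^sub>\<in>\<^sub>\<int> (z + n)\<^sup>-\<^sup>w\<close>; for \<open>w = 1\<close> it is the conditionally
  convergent \<open>\<pi> cot \<pi> z\<close>.\<close>

definition int_shift_sum :: "nat \<Rightarrow> complex \<Rightarrow> complex" where
  "int_shift_sum w z =
     ((-1) ^ w * Polygamma (w - 1) z + Polygamma (w - 1) (1 - z)) / fact (w - 1)"

lemma int_shift_sum_1:
  "z \<notin> \<int> \<Longrightarrow> int_shift_sum 1 z = of_real pi * cot (of_real pi * z)"
  using Digamma_reflection_complex[of z] by (simp add: int_shift_sum_def)

text \<open>Integers \<open>z\<close> are included: the term with denominator 0 is 0 by convention,
  and the series that defines \<open>Polygamma\<close> drops it in the same way. The row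
  \<open>m = 0\<close> of \<open>eisenstein_G2\<close> relies on the case
  \<open>z = 0\<close>.\<close>

lemma has_sum_int_shift_sum:
  assumes "w \<ge> 2"
  shows "((\<lambda>n::int. 1 / (z + of_int n) ^ w) has_sum int_shift_sum w z) UNIV"
proof -
  have w: "w - 1 \<noteq> 0" "Suc (w - 1) = w" using assms by auto
  have P: "(\<lambda>n. 1 / (u + of_nat n) ^ w) sums ((-1) ^ w * Polygamma (w - 1) u / fact (w - 1))" for u :: complex
  proof -
    have "(\<lambda>n. 1 / (u + of_nat n) ^ w) sums (\<Sum>n. 1 / (u + of_nat n) ^ w)"
      by (rule summable_sums[OF summable_norm_cancel[OF summable_norm_inverse_shift_power[OF assms]]])
    moreover have "(-1) ^ w * Polygamma (w - 1) u / fact (w - 1) = (\<Sum>n. 1 / (u + of_nat n) ^ w)"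
      using w by (simp add: Polygamma_def inverse_eq_divide)
    ultimately show ?thesis by simp
  qed
  have Q: "((\<lambda>n. 1 / (u + of_nat n) ^ w) has_sum ((-1) ^ w * Polygamma (w - 1) u / fact (w - 1))) UNIV" for u :: complex
    by (rule norm_summable_imp_has_sum[OF summable_norm_inverse_shift_power[OF assms] P])
  have "((\<lambda>n. (-1) ^ w * (1 / ((1 - z) + of_nat n) ^ w)) has_sum
          ((-1) ^ w * ((-1) ^ w * Polygamma (w - 1) (1 - z) / fact (w - 1)))) UNIV"
    by (intro has_sum_cmult_right Q)
  moreover have "(-1) ^ w * (1 / ((1 - z) + of_nat n) ^ w) = 1 / (z + of_int (- int n - 1)) ^ w" for n
  proof -
    have "z + of_int (- int n - 1) = (-1) * ((1 - z) + of_nat n)" by simp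
    hence "(z + of_int (- int n - 1)) ^ w = (-1) ^ w * ((1 - z) + of_nat n) ^ w"
      by (metis power_mult_distrib)
    thus ?thesis by (cases "even w") (simp_all add: minus_one_power_iff)
  qed
  ultimately have "((\<lambda>n. 1 / (z + of_int (- int n - 1)) ^ w) has_sum
          (Polygamma (w - 1) (1 - z) / fact (w - 1))) UNIV"
    by simp
  from has_sum_int_split[where f = "\<lambda>n. 1 / (z + of_int n) ^ w", OF _ this] Q[of z]
  show ?thesis by (simp add: int_shift_sum_def add_divide_distrib)
qed

lemma has_field_derivative_int_shift_sum:
  assumes "w \<ge> 1" "z \<notin> \<int>"
  shows "(int_shift_sum w has_field_derivative (- of_nat w * int_shift_sum (Suc w) z)) (at z)"
proof -
  have z: "z \<notin> \<int>\<^sub>\<le>\<^sub>0" "1 - z \<notin> \<int>\<^sub>\<le>\<^sub>0"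
    using assms nonpos_Ints_subset_Ints Ints_diff[of 1 "1 - z"] by auto
  obtain v where v: "w = Suc v" using assms by (cases w) auto
  have "(int_shift_sum w has_field_derivative
      ((-1) ^ w * Polygamma (Suc v) z - Polygamma (Suc v) (1 - z)) / fact v) (at z)"
    unfolding int_shift_sum_def[abs_def] v using z
    by (auto intro!: derivative_eq_intros)
  also have "((-1) ^ w * Polygamma (Suc v) z - Polygamma (Suc v) (1 - z)) / fact v =
     - of_nat w * int_shift_sum (Suc w) z"
    using of_nat_neq_0[of v, where ?'a = complex]
    by (simp add: int_shift_sum_def v divide_simps algebra_simps del: of_nat_Suc)
  finally show ?thesis .
qed

text \<open>Iterates the derivative rule. It will turn the value of the series at 1/4 into a Taylor
  coefficient of the cotangent.\<close>

lemma int_shift_sum_eq_higher_deriv: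
  assumes "z \<notin> \<int>"
  shows "int_shift_sum (Suc n) z = (-1) ^ n * (deriv ^^ n) (int_shift_sum 1) z / fact n"
  using assms
proof (induction n arbitrary: z)
  case (Suc n)
  have "open (- \<int> :: complex set)" by (simp add: open_Compl)
  hence "\<forall>\<^sub>F u in nhds z. u \<in> - \<int>"
    using Suc.prems by (intro eventually_nhds_in_open) auto
  hence "\<forall>\<^sub>F u in nhds z. (deriv ^^ n) (int_shift_sum 1) u = (-1) ^ n * fact n * int_shift_sum (Suc n) u"
    by eventually_elim (simp add: Suc.IH del: One_nat_def)
  hence "deriv ((deriv ^^ n) (int_shift_sum 1)) z = deriv (\<lambda>u. (-1) ^ n * fact n * int_shift_sum (Suc n) u) z"
    by (intro deriv_cong_ev refl)
  also have "\<dots> = (-1) ^ n * fact n * (- of_nat (Suc n) * int_shift_sum (Suc (Suc n)) z)"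
    using Suc.prems by (intro DERIV_imp_deriv DERIV_cmult has_field_derivative_int_shift_sum) auto
  finally show ?case by (simp add: field_simps del: of_nat_Suc)
qed auto

subsection \<open>The Lipschitz summation formula\<close>

lemma summable_power_times_geometric:
  fixes x :: real
  assumes "norm x < 1"
  shows "summable (\<lambda>n. of_nat n ^ k * x ^ n)"
  using assms
proof (induction k arbitrary: x)
  case 0
  thus ?case by (simp add: summable_geometric)
next
  case (Suc k)
  have "summable (\<lambda>n. diffs (\<lambda>n. of_nat n ^ k) n * x ^ n)"
    using Suc by (intro termdiff_converges[of x 1]) auto
  hence "summable (\<lambda>n. diffs (\<lambda>n. of_nat n ^ k) n * x ^ n * x)" by (rule summable_mult2)
  hence "summable (\<lambda>n. of_nat (Suc n) ^ Suc k * x ^ Suc n)"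
    by (simp add: diffs_def mult_ac)
  thus ?case by (subst (asm) summable_Suc_iff[of "\<lambda>n. of_nat n ^ Suc k * x ^ n"])
qed

definition qexp :: "complex \<Rightarrow> complex" where
  "qexp z = exp (2 * of_real pi * \<i> * z)"

lemma qexp_add: "qexp (y + z) = qexp y * qexp z"
  by (simp add: qexp_def exp_add[symmetric] algebra_simps)

lemma qexp_of_nat_mult: "qexp (of_nat n * z) = qexp z ^ n"
  by (simp add: qexp_def exp_of_nat_mult[symmetric] algebra_simps)

lemma qexp_nonzero [simp]: "qexp z \<noteq> 0"
  by (simp add: qexp_def)

lemma norm_qexp: "norm (qexp z) = exp (- 2 * pi * Im z)"
  by (simp add: qexp_def norm_exp_eq_Re)

lemma norm_qexp_less_1: "Im z > 0 \<Longrightarrow> norm (qexp z) < 1"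
  by (simp add: norm_qexp)

lemma has_field_derivative_qexp [derivative_intros]:
  assumes "(f has_field_derivative f') (at z within A)"
  shows "((\<lambda>z. qexp (f z)) has_field_derivative (2 * of_real pi * \<i> * f' * qexp (f z))) (at z within A)"
  unfolding qexp_def using assms by (auto intro!: derivative_eq_intros)

text \<open>The polylogarithm of order \<open>1 - w\<close> at \<open>qexp z\<close>.\<close>

definition power_qexp_sum :: "nat \<Rightarrow> complex \<Rightarrow> complex" where
  "power_qexp_sum w z = (\<Sum>n. of_nat (Suc n) ^ (w - 1) * qexp (of_nat (Suc n) * z))"

lemma summable_norm_power_qexp:
  assumes "Im z > 0"
  shows "summable (\<lambda>n. norm (of_nat (Suc n) ^ k * qexp (of_nat (Suc n) * z)))"
proof -
  have "summable (\<lambda>n. of_nat (Suc n) ^ k * norm (qexp z) ^ Suc n)"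
    by (subst summable_Suc_iff[of "\<lambda>n. of_nat n ^ k * norm (qexp z) ^ n"])
       (use norm_qexp_less_1[OF assms] in \<open>intro summable_power_times_geometric, auto\<close>)
  thus ?thesis
    by (simp add: norm_mult norm_power qexp_of_nat_mult del: of_nat_Suc power_Suc)
qed

lemma Im_ge_half_in_ball: "y \<in> ball x (Im x / 2) \<Longrightarrow> Im y \<ge> Im x / 2"
  using abs_Im_le_cmod[of "x - y"] by (simp add: dist_norm abs_if field_simps split: if_splits)

lemma has_field_derivative_power_qexp_sum:
  assumes "w \<ge> 1" "Im z > 0"
  shows "(power_qexp_sum w has_field_derivative 2 * of_real pi * \<i> * power_qexp_sum (Suc w) z) (at z)"
proof -
  define S where "S = {z. Im z > 0}"
  have opS: "open S" unfolding S_def by (rule open_halfspace_Im_gt)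
  define f where "f = (\<lambda>n z. of_nat (Suc n) ^ (w - 1) * qexp (of_nat (Suc n) * z))"
  define f' where "f' = (\<lambda>n z. 2 * of_real pi * \<i> * (of_nat (Suc n) ^ w * qexp (of_nat (Suc n) * z)))"
  have "\<exists>g g'. \<forall>x\<in>S. (\<lambda>n. f n x) sums g x \<and> (\<lambda>n. f' n x) sums g' x \<and> (g has_field_derivative g' x) (at x)"
  proof (rule series_and_derivative_comparison_local[OF opS])
    fix n x assume "x \<in> S"
    have "of_nat (Suc n) ^ w = of_nat (Suc n) * (of_nat (Suc n) ^ (w - 1) :: complex)"
      using assms by (metis Suc_diff_1 less_le_trans less_numeral_extra(1) power_Suc)
    thus "(f n has_field_derivative f' n x) (at x)"
      unfolding f_def f'_def by (auto intro!: derivative_eq_intros simp del: of_nat_Suc)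
  next
    fix x assume x: "x \<in> S"
    \<comment> \<open>On the ball of this radius the height stays at least \<open>d\<close>, so the
      terms at the point \<open>\<i> * d\<close> dominate uniformly.\<close>
    define d where "d = Im x / 2"
    have d: "d > 0" using x by (simp add: d_def S_def)
    define h where "h = (\<lambda>n. norm (of_nat (Suc n) ^ (w - 1) * qexp (of_nat (Suc n) * (\<i> * of_real d))))"
    have "norm (f n y) \<le> h n" if "y \<in> ball x d" for n y
    proof -
      have "Im y \<ge> d" using that unfolding d_def by (rule Im_ge_half_in_ball)
      hence "real (Suc n) * d \<le> real (Suc n) * Im y" by (intro mult_left_mono) auto
      hence "exp (- 2 * pi * (real (Suc n) * Im y)) \<le> exp (- 2 * pi * (real (Suc n) * d))"
        by simp
      thus ?thesis
        unfolding f_def h_def norm_mult norm_power norm_qexp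
        by (intro mult_left_mono) (simp_all del: of_nat_Suc)
    qed
    moreover have "summable h"
      unfolding h_def using d by (intro summable_norm_power_qexp) simp
    ultimately show "\<exists>d h. 0 < d \<and> summable h \<and> (\<forall>\<^sub>F n in sequentially. \<forall>y\<in>ball x d \<inter> S. norm (f n y) \<le> h n)"
      using d by (intro exI[of _ d] exI[of _ h]) auto
  qed
  then obtain g g' where g: "\<And>x. x \<in> S \<Longrightarrow> (\<lambda>n. f n x) sums g x"
    "\<And>x. x \<in> S \<Longrightarrow> (\<lambda>n. f' n x) sums g' x"
    "\<And>x. x \<in> S \<Longrightarrow> (g has_field_derivative g' x) (at x)" by blast
  have z: "z \<in> S" using assms by (simp add: S_def)
  have "(power_qexp_sum w has_field_derivative g' z) (at z)"
  proof (rule has_field_derivative_transform_within_open[OF g(3)[OF z] opS z])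
    fix x assume "x \<in> S"
    thus "g x = power_qexp_sum w x"
      using g(1)[of x] by (simp add: power_qexp_sum_def f_def sums_iff)
  qed
  moreover have "(\<lambda>n. f' n z) sums (2 * of_real pi * \<i> * power_qexp_sum (Suc w) z)"
    unfolding f'_def power_qexp_sum_def diff_Suc_1
    by (intro sums_mult summable_sums summable_norm_cancel[OF summable_norm_power_qexp] assms)
  hence "g' z = 2 * of_real pi * \<i> * power_qexp_sum (Suc w) z"
    using g(2)[OF z] sums_unique2 by blast
  ultimately show ?thesis by simp
qed

lemma power_qexp_sum_1:
  assumes "Im z > 0"
  shows "power_qexp_sum 1 z = qexp z / (1 - qexp z)"
proof -
  have "(\<lambda>n. qexp z * qexp z ^ n) sums (qexp z * (1 / (1 - qexp z)))"
    by (intro sums_mult geometric_sums norm_qexp_less_1 assms)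
  thus ?thesis
    by (simp add: power_qexp_sum_def qexp_of_nat_mult sums_iff del: of_nat_Suc)
qed

text \<open>By Euler's formulas the cotangent is \<open>\<i>\<close> times a rational function of
  the square of \<open>u = exp (\<i> * pi * z)\<close>, and that square is
  \<open>qexp z\<close>.\<close>

lemma int_shift_sum_1_upper:
  assumes "Im z > 0"
  shows "int_shift_sum 1 z = - of_real pi * \<i> - 2 * of_real pi * \<i> * power_qexp_sum 1 z"
proof -
  have z: "z \<notin> \<int>" using assms by (auto elim!: Ints_cases)
  have q: "qexp z \<noteq> 1" using norm_qexp_less_1[OF assms] by auto
  define u where "u = exp (\<i> * of_real pi * z)"
  have u0: "u \<noteq> 0" by (simp add: u_def)
  have qu: "qexp z = u ^ 2"
    by (simp add: qexp_def u_def exp_double[symmetric] mult_ac)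
  have u2: "u ^ 2 \<noteq> 1" using q qu by simp
  hence u3: "u - 1 / u \<noteq> 0" "1 - u\<^sup>2 \<noteq> 0" "u\<^sup>2 - 1 \<noteq> 0" using u0 by (auto simp: field_simps power2_eq_square)
  have "cos (of_real pi * z) = (u + 1 / u) / 2" "sin (of_real pi * z) = - (\<i> / 2) * (u - 1 / u)"
    by (simp_all add: cos_exp_eq sin_exp_eq u_def exp_minus field_simps)
  hence "cot (of_real pi * z) = ((u + 1 / u) / 2) / (- (\<i> / 2) * (u - 1 / u))" by (simp only: cot_def)
  also have "\<dots> = \<i> * ((u + 1 / u) / (u - 1 / u))"
    using u3 by (simp add: divide_simps del: diff_divide_distrib)
  also have "(u + 1 / u) / (u - 1 / u) = (u ^ 2 + 1) / (u ^ 2 - 1)"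
    using u0 u3 by (simp add: divide_simps power2_eq_square)
  also have "\<i> * \<dots> = - \<i> - 2 * \<i> * (u ^ 2 / (1 - u ^ 2))"
    using u3 by (simp add: divide_simps) (simp add: algebra_simps)
  finally have cot: "cot (of_real pi * z) = - \<i> - 2 * \<i> * (u ^ 2 / (1 - u ^ 2))" .
  show ?thesis
    unfolding int_shift_sum_1[OF z] power_qexp_sum_1[OF assms] qu cot by (simp add: algebra_simps)
qed

text \<open>Repeated differentiation of the cotangent expansion. Its constant term disappears with
  the first derivative, which is why the induction starts at \<open>w = 2\<close>. Each further
  derivative multiplies the left side by \<open>- w\<close> and the right side by
  \<open>2 * pi * \<i>\<close>.\<close>

theorem lipschitz_summation:
  assumes "w \<ge> 2" "Im z > 0"
  shows "int_shift_sum w z = (- 2 * of_real pi * \<i>) ^ w / fact (w - 1) * power_qexp_sum w z"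
  using assms
proof (induction w arbitrary: z rule: dec_induct)
  have H: "open {z. Im z > 0}" by (rule open_halfspace_Im_gt)
  {
    case base
    have "((\<lambda>z. - of_real pi * \<i> - 2 * of_real pi * \<i> * power_qexp_sum 1 z) has_field_derivative
            (- of_nat 1 * int_shift_sum (Suc 1) z)) (at z)"
    proof (rule has_field_derivative_transform_within_open[OF has_field_derivative_int_shift_sum H])
      show "z \<notin> \<int>" using base by (auto elim!: Ints_cases)
    qed (use base int_shift_sum_1_upper in auto)
    moreover have "((\<lambda>z. - of_real pi * \<i> - 2 * of_real pi * \<i> * power_qexp_sum 1 z) has_field_derivative
            (0 - 2 * of_real pi * \<i> * (2 * of_real pi * \<i> * power_qexp_sum (Suc 1) z))) (at z)"
      using base by (intro DERIV_diff DERIV_const DERIV_cmult has_field_derivative_power_qexp_sum) auto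
    ultimately have "- of_nat 1 * int_shift_sum (Suc 1) z = 0 - 2 * of_real pi * \<i> * (2 * of_real pi * \<i> * power_qexp_sum (Suc 1) z)"
      using DERIV_unique by blast
    thus ?case by (simp add: power2_eq_square numeral_2_eq_2)
  next
    case (step w)
    define K where "K = (- 2 * of_real pi * \<i>) ^ w / fact (w - 1)"
    have "((\<lambda>z. K * power_qexp_sum w z) has_field_derivative
            (- of_nat w * int_shift_sum (Suc w) z)) (at z)"
    proof (rule has_field_derivative_transform_within_open[OF has_field_derivative_int_shift_sum H])
      show "z \<notin> \<int>" using step by (auto elim!: Ints_cases)
    qed (use step in \<open>auto simp: K_def\<close>)
    moreover have "((\<lambda>z. K * power_qexp_sum w z) has_field_derivative
            (K * (2 * of_real pi * \<i> * power_qexp_sum (Suc w) z))) (at z)"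
      using step by (intro DERIV_cmult has_field_derivative_power_qexp_sum) auto
    ultimately have *: "- of_nat w * int_shift_sum (Suc w) z = K * (2 * of_real pi * \<i> * power_qexp_sum (Suc w) z)"
      using DERIV_unique by blast
    obtain v where v: "w = Suc v" using step by (cases w) auto
    have "int_shift_sum (Suc w) z = - (1 / of_nat w) * (- of_nat w * int_shift_sum (Suc w) z)"
      by (simp add: v del: of_nat_Suc)
    also have "\<dots> = - (1 / of_nat w) * (K * (2 * of_real pi * \<i> * power_qexp_sum (Suc w) z))"
      by (simp only: *)
    finally show ?case by (simp add: K_def v del: of_nat_Suc)
  }
qed

lemma int_shift_sum_1_minus: "int_shift_sum 1 (- z) = - int_shift_sum 1 z" if "z \<notin> \<int>"
  using that int_shift_sum_1[of z] int_shift_sum_1[of "- z"]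
  by (simp add: cot_def minus_in_Ints_iff)

text \<open>Either series alone converges only conditionally, but the difference of two terms is
  \<open>(v - u) / ((u + n) * (v + n))\<close>, which is absolutely summable.\<close>

lemma has_sum_int_shift_sum_1_diff:
  assumes "u \<notin> \<int>" "v \<notin> \<int>"
  shows "((\<lambda>n::int. 1 / (u + of_int n) - 1 / (v + of_int n)) has_sum (int_shift_sum 1 u - int_shift_sum 1 v)) UNIV"
proof -
  have D: "((\<lambda>n. 1 / (u + of_nat n) - 1 / (v + of_nat n)) has_sum (Digamma v - Digamma u)) UNIV"
    if u: "u \<notin> \<int>" and v: "v \<notin> \<int>" for u v :: complex
  proof (rule norm_summable_imp_has_sum)
    have nz: "u \<noteq> 0" "v \<noteq> 0" using u v by auto
    have nzu: "u + of_nat n \<noteq> 0" for n using u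
      by (metis Ints_minus Ints_of_nat add_eq_0_iff minus_minus)
    have nzv: "v + of_nat n \<noteq> 0" for n using v
      by (metis Ints_minus Ints_of_nat add_eq_0_iff minus_minus)
    have "(\<lambda>n. (inverse (of_nat (Suc n)) - inverse (v + of_nat n)) - (inverse (of_nat (Suc n)) - inverse (u + of_nat n)))
           sums ((\<Sum>n. inverse (of_nat (Suc n)) - inverse (v + of_nat n)) - (\<Sum>n. inverse (of_nat (Suc n)) - inverse (u + of_nat n)))"
      by (intro sums_diff summable_sums summable_Digamma nz)
    thus "(\<lambda>n. 1 / (u + of_nat n) - 1 / (v + of_nat n)) sums (Digamma v - Digamma u)"
      by (simp add: Digamma_def inverse_eq_divide)
    show "summable (\<lambda>n. norm (1 / (u + of_nat n) - 1 / (v + of_nat n)))"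
    proof (rule summable_comparison_test)
      show "\<exists>N. \<forall>n\<ge>N. norm (norm (1 / (u + of_nat n) - 1 / (v + of_nat n))) \<le>
               norm (v - u) * (norm (1 / (u + of_nat n)^2) + norm (1 / (v + of_nat n)^2))"
      proof (intro exI[of _ 0] allI impI)
        fix n :: nat
        define a b where "a = norm (1 / (u + of_nat n))" and "b = norm (1 / (v + of_nat n))"
        have "1 / (u + of_nat n) - 1 / (v + of_nat n) = (v - u) * ((1 / (u + of_nat n)) * (1 / (v + of_nat n)))"
          using nzu[of n] nzv[of n] by (simp add: field_simps)
        hence "norm (norm (1 / (u + of_nat n) - 1 / (v + of_nat n))) = norm (v - u) * (a * b)"
          by (simp add: norm_mult norm_divide a_def b_def)
        also have "a * b \<le> a ^ 2 + b ^ 2"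
        proof -
          have "0 \<le> a * b" by (simp add: a_def b_def)
          moreover have "2 * (a * b) \<le> a ^ 2 + b ^ 2" using sum_squares_bound[of a b] by (simp add: mult.assoc)
          ultimately show ?thesis by linarith
        qed
        finally show "norm (norm (1 / (u + of_nat n) - 1 / (v + of_nat n))) \<le>
               norm (v - u) * (norm (1 / (u + of_nat n)^2) + norm (1 / (v + of_nat n)^2))"
          by (simp add: a_def b_def norm_divide norm_power power_divide mult_left_mono)
      qed
      show "summable (\<lambda>n. norm (v - u) * (norm (1 / (u + of_nat n)^2) + norm (1 / (v + of_nat n)^2)))"
        by (intro summable_mult summable_add summable_norm_inverse_shift_power) auto
    qed
  qed
  have 1: "1 - u \<notin> \<int>" "1 - v \<notin> \<int>"
    using assms Ints_diff[of 1 "1 - u"] Ints_diff[of 1 "1 - v"] by auto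
  have "1 / (u + of_int (- int n - 1)) - 1 / (v + of_int (- int n - 1)) = 1 / (1 - v + of_nat n) - 1 / (1 - u + of_nat n)" for n
  proof -
    have "u + of_int (- int n - 1) = - (1 - u + of_nat n)" "v + of_int (- int n - 1) = - (1 - v + of_nat n)"
      by simp_all
    thus ?thesis by (simp only: divide_minus_right) simp
  qed
  hence "((\<lambda>n. 1 / (u + of_int (- int n - 1)) - 1 / (v + of_int (- int n - 1))) has_sum (Digamma (1 - u) - Digamma (1 - v))) UNIV"
    using D[OF 1(2) 1(1)] by simp
  hence "((\<lambda>n::int. 1 / (u + of_int n) - 1 / (v + of_int n)) has_sum
          ((Digamma v - Digamma u) + (Digamma (1 - u) - Digamma (1 - v)))) UNIV"
    using D[OF assms] by (intro has_sum_int_split) simp_all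
  moreover have "(Digamma v - Digamma u) + (Digamma (1 - u) - Digamma (1 - v)) = int_shift_sum 1 u - int_shift_sum 1 v"
    by (simp add: int_shift_sum_def)
  ultimately show ?thesis by simp
qed

subsection \<open>The quasimodular Eisenstein series of weight 2\<close>

lemma has_sum_minus:
  fixes f g :: "'a \<Rightarrow> 'b::topological_ab_group_add"
  assumes "(f has_sum a) A" "(g has_sum b) A"
  shows "((\<lambda>x. f x - g x) has_sum (a - b)) A"
  using has_sum_add[of f A a "\<lambda>x. - g x" "- b"] assms by (simp add: has_sum_uminus)

lemma int_shift_sum_1_plus_1:
  assumes "z \<notin> \<int>"
  shows "int_shift_sum 1 (z + 1) = int_shift_sum 1 z"
proof -
  have "z + 1 \<notin> \<int>" using assms Ints_diff[of "z + 1" 1] by auto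
  moreover have "cot (of_real pi * (z + 1)) = cot (of_real pi * z)"
    by (simp add: cot_def ring_distribs sin_add cos_add flip: sin_of_real cos_of_real)
  ultimately show ?thesis using assms by (simp add: int_shift_sum_1 del: One_nat_def)
qed

text \<open>The limit is the constant term of the expansion in \<open>qexp\<close>. It is the source
  of the non-modular term in \<open>eisenstein_G2_inversion\<close>.\<close>

lemma tendsto_int_shift_sum_1:
  assumes "filterlim (\<lambda>x. Im (f x)) at_top F"
  shows "((\<lambda>x. int_shift_sum 1 (f x)) \<longlongrightarrow> - of_real pi * \<i>) F"
proof -
  have "filterlim (\<lambda>x. - 2 * pi * Im (f x)) at_bot F"
    using filterlim_tendsto_neg_mult_at_bot[OF tendsto_const _ assms, of "- 2 * pi"] by simp
  hence "((\<lambda>x. norm (qexp (f x))) \<longlongrightarrow> 0) F"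
    unfolding norm_qexp by (rule filterlim_compose[OF exp_at_bot])
  hence q: "((\<lambda>x. qexp (f x)) \<longlongrightarrow> 0) F" by (rule tendsto_norm_zero_cancel)
  hence "((\<lambda>x. - of_real pi * \<i> - 2 * of_real pi * \<i> * (qexp (f x) / (1 - qexp (f x)))) \<longlongrightarrow>
          - of_real pi * \<i> - 2 * of_real pi * \<i> * (0 / (1 - 0))) F"
    by (intro tendsto_intros) auto
  moreover have "\<forall>\<^sub>F x in F. Im (f x) > 0"
    using assms by (auto simp: filterlim_at_top_dense)
  hence "\<forall>\<^sub>F x in F. - of_real pi * \<i> - 2 * of_real pi * \<i> * (qexp (f x) / (1 - qexp (f x))) = int_shift_sum 1 (f x)"
    by eventually_elim (simp add: int_shift_sum_1_upper[unfolded One_nat_def] power_qexp_sum_1[unfolded One_nat_def])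
  ultimately show ?thesis
    by (simp add: tendsto_cong)
qed

section \<open>Summable majorants for double series over a lattice\<close>

definition int_weight :: "int \<Rightarrow> real" where
  "int_weight n = (1 + \<bar>of_int n\<bar>) powr (- 3 / 2)"

lemma int_weight_nonneg [simp]: "int_weight n \<ge> 0"
  by (simp add: int_weight_def)

lemma summable_int_weight: "int_weight summable_on UNIV"
proof -
  have s: "summable (\<lambda>n. real n powr (- 3 / 2))"
    by (simp add: summable_real_powr_iff)
  have s1: "summable (\<lambda>n. real (Suc n) powr (- 3 / 2))" using s by (subst summable_Suc_iff)
  have s2: "summable (\<lambda>n. real (Suc (Suc n)) powr (- 3 / 2))" using s1 by (subst summable_Suc_iff)
  have "(\<lambda>n. int_weight (int n)) summable_on UNIV"
    by (rule norm_summable_imp_summable_on) (use s1 in \<open>simp add: int_weight_def\<close>)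
  then obtain A where A: "((\<lambda>n. int_weight (int n)) has_sum A) UNIV" by (auto simp: summable_on_def)
  have "(\<lambda>n. int_weight (- int n - 1)) = (\<lambda>n. real (Suc (Suc n)) powr (- 3 / 2))"
    by (simp add: int_weight_def fun_eq_iff abs_if add_ac)
  hence "(\<lambda>n. int_weight (- int n - 1)) summable_on UNIV"
    by (intro norm_summable_imp_summable_on) (use s2 in simp)
  then obtain B where B: "((\<lambda>n. int_weight (- int n - 1)) has_sum B) UNIV" by (auto simp: summable_on_def)
  from has_sum_int_split[OF A B] show ?thesis by (rule has_sum_imp_summable)
qed

lemma has_sum_int_weight_shift:
  "((\<lambda>n. int_weight (n + j)) has_sum infsum int_weight UNIV) UNIV"
proof -
  have "(int_weight has_sum infsum int_weight UNIV) UNIV"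
    using summable_int_weight by (rule has_sum_infsum)
  thus ?thesis
    by (subst has_sum_reindex_bij_witness[of _ "\<lambda>n. n - j" "\<lambda>n. n + j" UNIV int_weight]) auto
qed

text \<open>The shift \<open>j\<close> may vary with the row, because translating a row does not
  change its sum. It will absorb the real part of \<open>m * \<tau>\<close> at the cusps.\<close>

lemma has_sum_int_weight_product:
  "((\<lambda>(m, n). int_weight m * int_weight (n + j m)) has_sum (infsum int_weight UNIV)\<^sup>2) (UNIV \<times> UNIV)"
proof (rule has_sum_SigmaI)
  show "((\<lambda>n. case (m, n) of (m, n) \<Rightarrow> int_weight m * int_weight (n + j m)) has_sum
           int_weight m * infsum int_weight UNIV) UNIV" for m
    using has_sum_cmult_right[OF has_sum_int_weight_shift[of "j m"]] by simp
  show *: "((\<lambda>m. int_weight m * infsum int_weight UNIV) has_sum (infsum int_weight UNIV)\<^sup>2) UNIV"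
    using has_sum_cmult_left[OF has_sum_infsum[OF summable_int_weight]] by (simp add: power2_eq_square)
  show "(\<lambda>(m, n). int_weight m * int_weight (n + j m)) summable_on UNIV \<times> UNIV"
    using * by (intro summable_on_SigmaI[where g = "\<lambda>m. int_weight m * infsum int_weight UNIV"])
       (auto intro!: has_sum_cmult_right has_sum_int_weight_shift has_sum_imp_summable)
qed

lemma summable_int_weight_product: "(\<lambda>(m, n). int_weight m * int_weight n) summable_on UNIV"
  using has_sum_imp_summable[OF has_sum_int_weight_product[of "\<lambda>_. 0"]] by simp

lemma powr_three_halves_le:
  fixes M :: real
  assumes "M > 0" "0 < p" "p \<le> c * M ^ 2" "c \<ge> 0"
  shows "1 / M ^ 3 \<le> c powr (3 / 2) * p powr (- 3 / 2)"
proof -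
  have "p powr (3 / 2) \<le> (c * M ^ 2) powr (3 / 2)"
    using assms by (intro powr_mono2) auto
  also have "\<dots> = c powr (3 / 2) * (M powr 2) powr (3 / 2)"
    using assms by (subst powr_mult) auto
  also have "(M powr 2) powr (3 / 2) = M ^ 3"
    using assms by (subst powr_powr) simp
  finally show ?thesis
    using assms by (simp add: powr_minus divide_simps mult_ac)
qed

text \<open>The exponent 3/2 exceeds 1, so each weight is summable, and a product of two weights
  still dominates the inverse cube of the maximum; 3 is the least weight \<open>2 * k + 1\<close>
  that occurs. The factor 8 is 4 to the power 3/2.\<close>

lemma inverse_cube_le_int_weight:
  fixes M :: real
  assumes "M \<ge> 1" "\<bar>of_int m\<bar> \<le> M" "\<bar>of_int n\<bar> \<le> M"
  shows "1 / M ^ 3 \<le> 8 * (int_weight m * int_weight n)"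
proof -
  have "(1 + \<bar>of_int m\<bar>) * (1 + \<bar>of_int n\<bar>) \<le> (2 * M) * (2 * M)"
    using assms by (intro mult_mono) auto
  hence "1 / M ^ 3 \<le> 4 powr (3 / 2) * ((1 + \<bar>of_int m\<bar>) * (1 + \<bar>of_int n\<bar>)) powr (- 3 / 2)"
    using assms by (intro powr_three_halves_le) (auto simp: power2_eq_square intro!: mult_pos_pos)
  also have "4 powr (3 / 2 :: real) = (2 powr 2) powr (3 / 2)" by simp
  also have "\<dots> = 8" by (subst powr_powr) simp
  finally show ?thesis by (simp add: int_weight_def powr_mult)
qed

text \<open>A constant in the comparison of \<open>norm (a * \<tau> + b)\<close> with the maximum
  norm of (a, b): \<open>1 / Im \<tau>\<close> takes care of \<open>a\<close>, and
  \<open>1 + norm \<tau> / Im \<tau>\<close> of \<open>b\<close>.\<close>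

definition lattice_const :: "complex \<Rightarrow> real" where
  "lattice_const \<tau> = 1 + 1 / Im \<tau> + norm \<tau> / Im \<tau>"

lemma lattice_const_ge_1: "Im \<tau> > 0 \<Longrightarrow> lattice_const \<tau> \<ge> 1"
  by (simp add: lattice_const_def)

lemma lattice_bound:
  fixes a b :: real
  assumes "Im \<tau> > 0"
  shows "\<bar>a\<bar> \<le> lattice_const \<tau> * norm (of_real a * \<tau> + of_real b)"
    and "\<bar>b\<bar> \<le> lattice_const \<tau> * norm (of_real a * \<tau> + of_real b)"
proof -
  define z where "z = of_real a * \<tau> + of_real b"
  have "\<bar>a * Im \<tau>\<bar> \<le> norm z"
    using abs_Im_le_cmod[of z] by (simp add: z_def)
  hence a: "\<bar>a\<bar> \<le> (1 / Im \<tau>) * norm z"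
    using assms by (simp add: abs_mult field_simps)
  also have "\<dots> \<le> lattice_const \<tau> * norm z"
    using assms by (intro mult_right_mono) (auto simp: lattice_const_def)
  finally show "\<bar>a\<bar> \<le> lattice_const \<tau> * norm (of_real a * \<tau> + of_real b)" by (simp add: z_def)
  have "\<bar>b\<bar> = norm (z - of_real a * \<tau>)" by (simp add: z_def)
  also have "\<dots> \<le> norm z + \<bar>a\<bar> * norm \<tau>" using norm_triangle_ineq4[of z "of_real a * \<tau>"] by (simp add: norm_mult)
  also have "\<dots> \<le> norm z + (1 / Im \<tau>) * norm z * norm \<tau>" using a by (intro add_left_mono mult_right_mono) auto
  also have "\<dots> = (1 + norm \<tau> / Im \<tau>) * norm z" by (simp add: algebra_simps)
  also have "\<dots> \<le> lattice_const \<tau> * norm z"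
    using assms by (intro mult_right_mono) (auto simp: lattice_const_def)
  finally show "\<bar>b\<bar> \<le> lattice_const \<tau> * norm (of_real a * \<tau> + of_real b)" by (simp add: z_def)
qed

lemma lattice_point_nonzero:
  fixes a b :: real
  assumes "Im \<tau> > 0" "a \<noteq> 0 \<or> b \<noteq> 0"
  shows "of_real a * \<tau> + of_real b \<noteq> 0"
  using lattice_bound[OF assms(1), where a = a and b = b] assms(2) by auto

lemma int_neq_half: "real_of_int n - 1 / 2 \<noteq> 0" "real_of_int n + 1 / 2 \<noteq> 0"
proof -
  have "real_of_int (2 * n) \<noteq> real_of_int 1" "real_of_int (2 * n) \<noteq> real_of_int (- 1)"
    unfolding of_int_eq_iff by presburger+
  thus "real_of_int n - 1 / 2 \<noteq> 0" "real_of_int n + 1 / 2 \<noteq> 0" by auto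
qed

text \<open>The shift by 1/2 keeps the subtracted term finite at every lattice point. At the origin
  \<open>1 / 0\<close> is 0 and the whole term is 4. The correction is kept as a difference because
  in this form it telescopes in \<open>n\<close>.\<close>

definition E2_term :: "complex \<Rightarrow> int \<Rightarrow> int \<Rightarrow> complex" where
  "E2_term \<tau> m n = 1 / (of_int m * \<tau> + of_int n) ^ 2 -
     (1 / (of_int m * \<tau> + of_int n - 1 / 2) - 1 / (of_int m * \<tau> + of_int n + 1 / 2))"

lemma lattice_half_nonzero:
  assumes "Im \<tau> > 0"
  shows "of_int m * \<tau> + of_int n - 1 / 2 \<noteq> 0" "of_int m * \<tau> + of_int n + 1 / 2 \<noteq> 0"
proof -
  show "of_int m * \<tau> + of_int n - 1 / 2 \<noteq> 0" "of_int m * \<tau> + of_int n + 1 / 2 \<noteq> 0"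
    using int_neq_half[of n] lattice_point_nonzero[OF assms, of "of_int m" "of_int n - 1 / 2"]
      lattice_point_nonzero[OF assms, of "of_int m" "of_int n + 1 / 2"] by (auto simp: algebra_simps)
qed

text \<open>The difference equals \<open>- 1 / (4 * z\<^sup>2 * (z\<^sup>2 - 1 / 4))\<close> and so
  has order -4, where \<open>1 / z\<^sup>2\<close> alone would not be summable over the
  lattice.\<close>

lemma E2_term_bound:
  assumes \<tau>: "Im \<tau> > 0"
  shows "norm (E2_term \<tau> m n) \<le> 8 * lattice_const \<tau> ^ 4 * (int_weight m * int_weight n)"
proof (cases "m = 0 \<and> n = 0")
  case True
  have "1 \<le> lattice_const \<tau> ^ 4" using lattice_const_ge_1[OF \<tau>] by (rule one_le_power)
  with True show ?thesis by (simp add: E2_term_def int_weight_def)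
next
  case False
  define K where "K = lattice_const \<tau>"
  have K: "K \<ge> 1" using lattice_const_ge_1[OF \<tau>] by (simp add: K_def)
  define M where "M = max \<bar>real_of_int m\<bar> \<bar>real_of_int n\<bar>"
  have M: "M \<ge> 1" using False by (auto simp: M_def)
  define z where "z = of_int m * \<tau> + of_int n"
  have b0: "M / K \<le> norm z"
    using lattice_bound[OF \<tau>, where a = "of_int m" and b = "of_int n"] K by (auto simp: z_def M_def K_def divide_le_eq mult.commute)
  \<comment> \<open>Twice \<open>z + s\<close> is the lattice point with coordinates
    \<open>2 * m\<close> and \<open>2 * n + t\<close>, \<open>t\<close> being 1 or -1, and
    \<open>2 * n + t\<close> is at least as large as \<open>n\<close> in absolute value.\<close>
  have bnd: "M / (2 * K) \<le> norm (z + s)" if "s = - 1 / 2 \<or> s = 1 / 2" for s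
  proof -
    define t :: int where "t = (if s = 1 / 2 then 1 else - 1)"
    have s: "s = of_int t / 2" using that by (auto simp: t_def)
    have t: "t = 1 \<or> t = - 1" by (auto simp: t_def)
    have "\<bar>2 * n + t\<bar> \<ge> \<bar>n\<bar>" using t by linarith
    hence "\<bar>real_of_int n\<bar> \<le> \<bar>of_int (2 * n + t)\<bar>" by linarith
    hence "M \<le> K * norm (of_int (2 * m) * \<tau> + of_int (2 * n + t))"
      using lattice_bound[OF \<tau>, where a = "of_int (2 * m)" and b = "of_int (2 * n + t)"] by (auto simp: M_def K_def)
    also have "of_int (2 * m) * \<tau> + of_int (2 * n + t) = 2 * (z + s)"
      by (simp add: z_def s algebra_simps)
    also have "norm \<dots> = 2 * norm (z + s)" by (simp only: norm_mult norm_numeral)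
    finally show ?thesis using K by (simp add: field_simps)
  qed
  have nz: "z \<noteq> 0" "z - 1 / 2 \<noteq> 0" "z + 1 / 2 \<noteq> 0"
    using b0 M K bnd[of "1 / 2"] bnd[of "- 1 / 2"] by (auto simp: field_simps)
  have "E2_term \<tau> m n = 1 / z ^ 2 - (1 / (z - 1 / 2) - 1 / (z + 1 / 2))"
    by (simp add: E2_term_def z_def)
  also have "1 / (z - 1 / 2) - 1 / (z + 1 / 2) = 1 / ((z - 1 / 2) * (z + 1 / 2))"
    using nz by (simp add: divide_simps)
  also have "1 / z ^ 2 - \<dots> = - (1 / 4) * (1 / (z ^ 2 * ((z - 1 / 2) * (z + 1 / 2))))"
    using nz by (simp add: divide_simps) (simp add: algebra_simps power2_eq_square)
  finally have "norm (E2_term \<tau> m n) = (1 / 4) * (1 / (norm z ^ 2 * (norm (z - 1 / 2) * norm (z + 1 / 2))))"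
    by (simp add: norm_mult norm_divide norm_power)
  also have "\<dots> \<le> (1 / 4) * (1 / ((M / K) ^ 2 * ((M / (2 * K)) * (M / (2 * K)))))"
  proof -
    have mono: "1 / (A ^ 2 * (B * C)) \<le> 1 / (a ^ 2 * (b * b))"
      if "a \<le> A" "b \<le> B" "b \<le> C" "0 < a" "0 < b" for a b A B C :: real
      using that by (intro divide_left_mono mult_mono power_mono mult_pos_pos) auto
    show ?thesis
      using b0 bnd[of "1 / 2"] bnd[of "- 1 / 2"] M K by (intro mult_left_mono mono) auto
  qed
  also have "\<dots> = K ^ 4 * (1 / M ^ 4)"
    using K M by (simp add: power2_eq_square power4_eq_xxxx)
  also have "\<dots> \<le> K ^ 4 * (1 / M ^ 3)"
    using M K by (intro mult_left_mono divide_left_mono power_increasing) auto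
  also have "\<dots> \<le> K ^ 4 * (8 * (int_weight m * int_weight n))"
    using M K by (intro mult_left_mono inverse_cube_le_int_weight) (auto simp: M_def)
  finally show ?thesis by (simp add: K_def)
qed

lemma E2_term_summable:
  assumes "Im \<tau> > 0"
  shows "(\<lambda>(m, n). E2_term \<tau> m n) summable_on UNIV \<times> UNIV"
proof -
  have "(\<lambda>x. norm (case x of (m, n) \<Rightarrow> E2_term \<tau> m n)) summable_on UNIV"
  proof (rule Infinite_Sum.abs_summable_on_comparison_test')
    show "(\<lambda>x. 8 * lattice_const \<tau> ^ 4 * (case x of (m, n) \<Rightarrow> int_weight m * int_weight n)) summable_on UNIV"
      by (intro summable_on_cmult_right summable_int_weight_product)
  qed (use E2_term_bound[OF assms] in auto)
  thus ?thesis by (simp add: abs_summable_summable)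
qed

lemma non_real_notin_Ints: "Im z \<noteq> 0 \<Longrightarrow> z \<notin> \<int>"
  by (auto elim!: Ints_cases)

text \<open>Along a row the correction sums to a difference of cotangents at two points that differ
  by the period 1, which is 0.\<close>

lemma has_sum_E2_term_row:
  assumes \<tau>: "Im \<tau> > 0"
  shows "((\<lambda>n. E2_term \<tau> m n) has_sum int_shift_sum 2 (of_int m * \<tau>)) UNIV"
proof -
  define u where "u = of_int m * \<tau> - 1 / 2"
  have u: "u \<notin> \<int>"
  proof
    assume "u \<in> \<int>"
    then obtain k where "u = of_int k" by (auto elim: Ints_cases)
    hence "of_int m * \<tau> + of_int (- k) - 1 / 2 = 0" by (simp add: u_def algebra_simps)
    thus False using lattice_half_nonzero[OF \<tau>] by blast
  qed
  have u1: "u + 1 \<notin> \<int>" using u Ints_diff[of "u + 1" 1] by auto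
  have "((\<lambda>n::int. 1 / (u + of_int n) - 1 / ((u + 1) + of_int n)) has_sum 0) UNIV"
    using has_sum_int_shift_sum_1_diff[OF u u1] int_shift_sum_1_plus_1[OF u] by simp
  from has_sum_minus[OF has_sum_int_shift_sum[of 2 "of_int m * \<tau>"] this]
  show ?thesis unfolding E2_term_def u_def by (simp add: algebra_simps)
qed

text \<open>Along a column the summation variable multiplies \<tau>, so \<tau> is factored out. The
  correction then gives cotangents at two points that differ by \<open>1 / \<tau>\<close>, which is
  not a period, and survives.\<close>

lemma has_sum_E2_term_column:
  assumes \<tau>: "Im \<tau> > 0"
  shows "((\<lambda>m. E2_term \<tau> m n) has_sum (int_shift_sum 2 (of_int n / \<tau>) / \<tau> ^ 2 -
           (int_shift_sum 1 ((of_int n - 1 / 2) / \<tau>) - int_shift_sum 1 ((of_int n + 1 / 2) / \<tau>)) / \<tau>)) UNIV"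
proof -
  have \<tau>0: "\<tau> \<noteq> 0" using \<tau> by auto
  note nz = int_neq_half[of n]
  have Im: "Im (of_real a / \<tau>) \<noteq> 0" if "a \<noteq> 0" for a
    using \<tau> that \<tau>0 by (auto simp: Im_divide complex_neq_0)
  have nI: "(of_int n - 1 / 2) / \<tau> \<notin> \<int>" "(of_int n + 1 / 2) / \<tau> \<notin> \<int>"
    using Im[OF nz(1)] Im[OF nz(2)] by (auto intro!: non_real_notin_Ints)
  have eq: "1 / (of_int m * \<tau> + a) = 1 / (a / \<tau> + of_int m) / \<tau>" for m a
  proof -
    have "of_int m * \<tau> + a = (a / \<tau> + of_int m) * \<tau>" using \<tau>0 by (simp add: field_simps)
    thus ?thesis by simp
  qed
  have "((\<lambda>m. (1 / (of_int n / \<tau> + of_int m) ^ 2) / \<tau> ^ 2 -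
           ((1 / ((of_int n - 1 / 2) / \<tau> + of_int m) - 1 / ((of_int n + 1 / 2) / \<tau> + of_int m)) / \<tau>)) has_sum (int_shift_sum 2 (of_int n / \<tau>) / \<tau> ^ 2 -
           (int_shift_sum 1 ((of_int n - 1 / 2) / \<tau>) - int_shift_sum 1 ((of_int n + 1 / 2) / \<tau>)) / \<tau>)) UNIV"
    by (intro has_sum_minus has_sum_divide_const has_sum_int_shift_sum has_sum_int_shift_sum_1_diff nI) simp
  moreover have "(1 / (of_int n / \<tau> + of_int m) ^ 2) / \<tau> ^ 2 -
           ((1 / ((of_int n - 1 / 2) / \<tau> + of_int m) - 1 / ((of_int n + 1 / 2) / \<tau> + of_int m)) / \<tau>) = E2_term \<tau> m n" for m
  proof -
    have "1 / (of_int m * \<tau> + of_int n) ^ 2 = (1 / (of_int m * \<tau> + of_int n)) ^ 2" by (simp add: power_divide)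
    also have "\<dots> = (1 / (of_int n / \<tau> + of_int m) ^ 2) / \<tau> ^ 2" by (subst eq) (simp add: power_divide power_mult_distrib)
    finally show ?thesis
      using eq[of m "of_int n - 1 / 2"] eq[of m "of_int n + 1 / 2"]
      by (simp add: E2_term_def diff_divide_distrib add_diff_eq add.assoc)
  qed
  ultimately show ?thesis by simp
qed

text \<open>The classical weight 2 series in Eisenstein's order of summation, over \<open>n\<close>
  inside and over \<open>m\<close> outside; the origin contributes 0.\<close>

definition eisenstein_G2 :: "complex \<Rightarrow> complex" where
  "eisenstein_G2 \<tau> = infsum (\<lambda>m::int. int_shift_sum 2 (of_int m * \<tau>)) UNIV"

lemma has_sum_eisenstein_G2:
  assumes "Im \<tau> > 0"
  shows "((\<lambda>m::int. int_shift_sum 2 (of_int m * \<tau>)) has_sum eisenstein_G2 \<tau>) UNIV"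
    and "((\<lambda>(m, n). E2_term \<tau> m n) has_sum eisenstein_G2 \<tau>) (UNIV \<times> UNIV)"
proof -
  obtain S where S: "((\<lambda>(m, n). E2_term \<tau> m n) has_sum S) (UNIV \<times> UNIV)"
    using E2_term_summable[OF assms] by (auto simp: summable_on_def)
  from has_sum_SigmaD[OF this, of "\<lambda>m. int_shift_sum 2 (of_int m * \<tau>)"] has_sum_E2_term_row[OF assms]
  have *: "((\<lambda>m::int. int_shift_sum 2 (of_int m * \<tau>)) has_sum S) UNIV" by simp
  hence [simp]: "S = eisenstein_G2 \<tau>" by (simp add: eisenstein_G2_def infsumI)
  show "((\<lambda>m::int. int_shift_sum 2 (of_int m * \<tau>)) has_sum eisenstein_G2 \<tau>) UNIV"
    "((\<lambda>(m, n). E2_term \<tau> m n) has_sum eisenstein_G2 \<tau>) (UNIV \<times> UNIV)" using * S by simp_all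
qed

lemma int_shift_sum_2_minus: "int_shift_sum 2 (- z) = int_shift_sum 2 z"
proof -
  have "((\<lambda>n::int. 1 / (- z + of_int n) ^ 2) has_sum int_shift_sum 2 (- z)) UNIV"
    by (rule has_sum_int_shift_sum) simp
  also have "?this \<longleftrightarrow> ((\<lambda>n::int. 1 / (z + of_int n) ^ 2) has_sum int_shift_sum 2 (- z)) UNIV"
    by (rule has_sum_reindex_bij_witness[of _ uminus uminus]) (auto simp: power2_commute)
  finally show ?thesis using has_sum_int_shift_sum[of 2 z] has_sum_unique by blast
qed

text \<open>The column sums differ from the terms of the inverted series by
  \<open>(p n - p (n + 1)) / \<tau>\<close>. These telescope, and the defect
  \<open>2 * pi * \<i> / \<tau>\<close> comes from the two different limits of the cotangent at the
  ends.\<close>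

theorem eisenstein_G2_inversion:
  assumes \<tau>: "Im \<tau> > 0"
  shows "eisenstein_G2 (- 1 / \<tau>) / \<tau> ^ 2 = eisenstein_G2 \<tau> - 2 * of_real pi * \<i> / \<tau>"
proof -
  define a where "a = (\<lambda>n. int_shift_sum 2 (of_int n / \<tau>) / \<tau> ^ 2)"
  define p where "p = (\<lambda>x. int_shift_sum 1 ((of_int x - 1 / 2) / \<tau>))"
  have \<tau>0: "\<tau> \<noteq> 0" using \<tau> by auto
  have Imi: "Im (- 1 / \<tau>) > 0" using \<tau> by (simp add: Im_divide divide_pos_pos add_nonneg_pos)
  have "((\<lambda>(n, m). E2_term \<tau> m n) has_sum eisenstein_G2 \<tau>) (UNIV \<times> UNIV)"
    using has_sum_eisenstein_G2(2)[OF \<tau>] by (subst (asm) has_sum_swap) simp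
  from has_sum_SigmaD[OF this, of "\<lambda>n. a n - (p n - p (n + 1)) / \<tau>"] has_sum_E2_term_column[OF \<tau>]
  have 1: "((\<lambda>n. a n - (p n - p (n + 1)) / \<tau>) has_sum eisenstein_G2 \<tau>) UNIV"
    by (simp add: a_def p_def algebra_simps)
  have "((\<lambda>n::int. int_shift_sum 2 (of_int n * (- 1 / \<tau>)) / \<tau> ^ 2) has_sum eisenstein_G2 (- 1 / \<tau>) / \<tau> ^ 2) UNIV"
    by (intro has_sum_divide_const has_sum_eisenstein_G2 Imi)
  moreover have "int_shift_sum 2 (of_int n * (- 1 / \<tau>)) / \<tau> ^ 2 = a n" for n
    using int_shift_sum_2_minus[of "of_int n / \<tau>"] by (simp add: a_def)
  ultimately have 2: "(a has_sum eisenstein_G2 (- 1 / \<tau>) / \<tau> ^ 2) UNIV" by simp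
  from has_sum_int_LIMSEQ[OF has_sum_minus[OF 2 1]]
  have lim1: "(\<lambda>N. \<Sum>n\<in>{- int N..int N}. (p n - p (n + 1)) / \<tau>) \<longlonglongrightarrow> eisenstein_G2 (- 1 / \<tau>) / \<tau> ^ 2 - eisenstein_G2 \<tau>"
    by simp
  have tele: "(\<Sum>n\<in>{- int N..int N}. (p n - p (n + 1)) / \<tau>) = (p (- int N) - p (int N + 1)) / \<tau>" for N
  proof (induction N)
    case (Suc N)
    have "{- int (Suc N)..int (Suc N)} = insert (- int (Suc N)) (insert (int (Suc N)) {- int N..int N})"
      by auto
    thus ?case using Suc by (simp add: diff_divide_distrib) (simp add: algebra_simps)
  qed simp
  \<comment> \<open>The half-integers at the two ends of a symmetric interval are negatives of each
    other and the cotangent is odd, so the limit at one end suffices.\<close>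
  have pm: "p (int N + 1) = - p (- int N)" for N
  proof -
    have "of_int (int N + 1) - 1 / 2 = - (of_int (- int N) - 1 / 2 :: complex)" by simp
    moreover have "(of_int (- int N) - 1 / 2) / \<tau> \<notin> \<int>"
    proof (rule non_real_notin_Ints)
      have "real N + 1 / 2 \<noteq> 0" by linarith
      thus "Im ((of_int (- int N) - 1 / 2) / \<tau>) \<noteq> 0" using \<tau> \<tau>0 by (simp add: Im_divide complex_neq_0)
    qed
    ultimately show ?thesis unfolding p_def by (metis int_shift_sum_1_minus minus_divide_left)
  qed
  \<comment> \<open>As \<open>Im (1 / \<tau>)\<close> is negative, dividing a large negative number
    by \<tau> leads high up into the upper half-plane.\<close>
  have "(\<lambda>N. p (- int N)) \<longlonglongrightarrow> - of_real pi * \<i>"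
    unfolding p_def
  proof (rule tendsto_int_shift_sum_1)
    have "Im ((of_int (- int N) - 1 / 2) / \<tau>) = (Im \<tau> / ((Re \<tau>)\<^sup>2 + (Im \<tau>)\<^sup>2)) * (real N + 1 / 2)" for N
    proof -
      have "of_int (- int N) - 1 / 2 = complex_of_real (- (real N + 1 / 2))" by simp
      hence "Im ((of_int (- int N) - 1 / 2) / \<tau>) = Im (complex_of_real (- (real N + 1 / 2)) / \<tau>)" by (simp only:)
      also have "\<dots> = (Im \<tau> / ((Re \<tau>)\<^sup>2 + (Im \<tau>)\<^sup>2)) * (real N + 1 / 2)"
        unfolding Im_divide Re_complex_of_real Im_complex_of_real by (simp add: diff_divide_distrib add_divide_distrib algebra_simps)
      finally show ?thesis .
    qed
    moreover have "Im \<tau> / ((Re \<tau>)\<^sup>2 + (Im \<tau>)\<^sup>2) > 0" using \<tau> by (intro divide_pos_pos add_nonneg_pos) auto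
    hence "filterlim (\<lambda>N. (Im \<tau> / ((Re \<tau>)\<^sup>2 + (Im \<tau>)\<^sup>2)) * (real N + 1 / 2)) at_top sequentially"
    proof (intro filterlim_tendsto_pos_mult_at_top[OF tendsto_const])
      show "filterlim (\<lambda>N. real N + 1 / 2) at_top sequentially"
        by (rule filterlim_at_top_mono[OF filterlim_real_sequentially]) auto
    qed auto
    ultimately show "filterlim (\<lambda>N. Im ((of_int (- int N) - 1 / 2) / \<tau>)) at_top sequentially" by simp
  qed
  hence "(\<lambda>N. (p (- int N) - - p (- int N)) / \<tau>) \<longlonglongrightarrow> (- of_real pi * \<i> - - (- of_real pi * \<i>)) / \<tau>"
    using \<tau>0 by (intro tendsto_intros)
  hence "(\<lambda>N. \<Sum>n\<in>{- int N..int N}. (p n - p (n + 1)) / \<tau>) \<longlonglongrightarrow> - 2 * of_real pi * \<i> / \<tau>"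
    by (simp only: tele pm) (simp add: algebra_simps)
  with lim1 have "eisenstein_G2 (- 1 / \<tau>) / \<tau> ^ 2 - eisenstein_G2 \<tau> = - 2 * of_real pi * \<i> / \<tau>"
    using LIMSEQ_unique by blast
  thus ?thesis by (simp add: algebra_simps)
qed

subsection \<open>The Dedekind eta function\<close>

lemma has_sum_nat_Suc:
  fixes f :: "nat \<Rightarrow> 'a::topological_comm_monoid_add"
  assumes "((\<lambda>n. f (Suc n)) has_sum S) UNIV"
  shows "(f has_sum (f 0 + S)) UNIV"
proof -
  have "(f has_sum S) {1..}"
    using assms by (subst has_sum_reindex_bij_witness[of _ Suc "\<lambda>n. n - 1" UNIV "\<lambda>n. f (Suc n)" f S S]) auto
  hence "(f has_sum (f 0 + S)) (insert 0 {1..})"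
    by (intro has_sum_insert) auto
  moreover have "insert 0 {1..} = (UNIV :: nat set)" by auto
  ultimately show ?thesis by simp
qed

lemma has_sum_int_zero_split:
  fixes f :: "int \<Rightarrow> 'a::topological_comm_monoid_add"
  assumes "((\<lambda>n. f (int (Suc n))) has_sum A) UNIV" "((\<lambda>n. f (- int (Suc n))) has_sum B) UNIV"
  shows "(f has_sum (f 0 + A + B)) UNIV"
proof -
  have "- int (Suc n) = - int n - 1" for n by simp
  hence "((\<lambda>n. f (- int n - 1)) has_sum B) UNIV" using assms(2) by (simp only:)
  thus ?thesis
    using has_sum_int_split[of f "f 0 + A" B] has_sum_nat_Suc[of "\<lambda>n. f (int n)" A] assms(1)
    by (simp del: of_nat_Suc)
qed

lemma int_shift_sum_2_0: "int_shift_sum 2 0 = of_real (pi\<^sup>2 / 3)"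
proof -
  have "(\<lambda>n. 1 / real (Suc n) ^ 2) sums (pi\<^sup>2 / 6)"
    using inverse_squares_sums by (simp add: add_ac)
  hence "((\<lambda>n. 1 / real (Suc n) ^ 2) has_sum (pi\<^sup>2 / 6)) UNIV"
    by (intro norm_summable_imp_has_sum) (auto dest: sums_summable simp del: of_nat_Suc)
  hence *: "((\<lambda>n. complex_of_real (1 / real (Suc n) ^ 2)) has_sum of_real (pi\<^sup>2 / 6)) UNIV"
    by (rule has_sum_of_real)
  have "((\<lambda>n::int. 1 / (0 + of_int n :: complex) ^ 2) has_sum (1 / (0 + of_int 0) ^ 2 + of_real (pi\<^sup>2 / 6) + of_real (pi\<^sup>2 / 6))) UNIV"
    by (rule has_sum_int_zero_split) (use * in \<open>simp_all add: power2_eq_square algebra_simps\<close>)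
  moreover have "((\<lambda>n::int. 1 / (0 + of_int n :: complex) ^ 2) has_sum int_shift_sum 2 0) UNIV"
    by (rule has_sum_int_shift_sum) simp
  ultimately have "int_shift_sum 2 0 = 1 / (0 + of_int 0) ^ 2 + of_real (pi\<^sup>2 / 6) + of_real (pi\<^sup>2 / 6)"
    using has_sum_unique by blast
  thus ?thesis by simp
qed

section \<open>Lambert series and the q-expansion of \<open>eisenstein_G2\<close>\<close>

lemma summable_lambert_real:
  fixes r :: real
  assumes "0 \<le> r" "r < 1"
  shows "(\<lambda>(n, m). real (Suc n) ^ k * r ^ (Suc m * Suc n)) summable_on UNIV \<times> UNIV"
proof (rule summable_on_SigmaI)
  have geo: "((\<lambda>m. real (Suc n) ^ k * r ^ (Suc m * Suc n)) has_sum
           (real (Suc n) ^ k * (r ^ Suc n * (1 / (1 - r ^ Suc n))))) UNIV" for n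
  proof -
    have "r ^ Suc n < 1" using assms by (simp add: power_less_one_iff del: power_Suc)
    hence "(\<lambda>m. (r ^ Suc n) ^ m) sums (1 / (1 - r ^ Suc n))"
      using assms by (intro geometric_sums) auto
    hence "(\<lambda>m. real (Suc n) ^ k * (r ^ Suc n * (r ^ Suc n) ^ m)) sums (real (Suc n) ^ k * (r ^ Suc n * (1 / (1 - r ^ Suc n))))"
      by (intro sums_mult)
    moreover have "real (Suc n) ^ k * (r ^ Suc n * (r ^ Suc n) ^ m) = real (Suc n) ^ k * r ^ (Suc m * Suc n)" for m
      by (metis power_Suc power_mult mult.commute)
    ultimately have "(\<lambda>m. real (Suc n) ^ k * r ^ (Suc m * Suc n)) sums (real (Suc n) ^ k * (r ^ Suc n * (1 / (1 - r ^ Suc n))))"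
      by (simp only:)
    thus ?thesis
      by (rule sums_nonneg_imp_has_sum) (use assms in auto)
  qed
  show "((\<lambda>m. case (n, m) of (n, m) \<Rightarrow> real (Suc n) ^ k * r ^ (Suc m * Suc n)) has_sum
           (real (Suc n) ^ k * (r ^ Suc n * (1 / (1 - r ^ Suc n))))) UNIV" for n
    using geo[of n] by simp
  have "summable (\<lambda>n. real (Suc n) ^ k * r ^ Suc n)"
    by (subst summable_Suc_iff[of "\<lambda>n. real n ^ k * r ^ n"]) (use assms in \<open>intro summable_power_times_geometric, auto\<close>)
  hence "summable (\<lambda>n. real (Suc n) ^ k * r ^ Suc n * (1 / (1 - r)))" by (rule summable_mult2)
  hence "summable (\<lambda>n. norm (real (Suc n) ^ k * (r ^ Suc n * (1 / (1 - r ^ Suc n)))))"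
  proof (rule summable_comparison_test[rotated], intro exI[of _ 0] allI impI)
    fix n :: nat
    have "r ^ Suc n \<le> r" using assms by (simp add: mult_left_le power_le_one)
    hence "1 / (1 - r ^ Suc n) \<le> 1 / (1 - r)" "1 - r ^ Suc n > 0" using assms by (auto intro!: divide_left_mono)
    hence "real (Suc n) ^ k * r ^ Suc n * (1 / (1 - r ^ Suc n)) \<le> real (Suc n) ^ k * r ^ Suc n * (1 / (1 - r))"
      using assms by (intro mult_left_mono) auto
    thus "norm (norm (real (Suc n) ^ k * (r ^ Suc n * (1 / (1 - r ^ Suc n))))) \<le> real (Suc n) ^ k * r ^ Suc n * (1 / (1 - r))"
      using assms \<open>1 - r ^ Suc n > 0\<close> by (simp add: abs_mult mult_ac del: power_Suc of_nat_Suc)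
  qed
  thus "(\<lambda>n. real (Suc n) ^ k * (r ^ Suc n * (1 / (1 - r ^ Suc n)))) summable_on UNIV"
    by (rule norm_summable_imp_summable_on)
qed (use assms in auto)

text \<open>Bounded coefficients in both variables are allowed since the same double series serves
  eta, with coefficients 1, and the Eisenstein series, twisted by \<open>chi_m4\<close> and by
  \<open>(- 1) ^ d\<close>.\<close>

lemma summable_lambert:
  assumes "Im \<tau> > 0" "\<And>m. norm (c m) \<le> C" "\<And>n. norm (p n) \<le> C"
  shows "(\<lambda>(n, m). c m * (p n * (of_nat (Suc n) ^ k * qexp (of_nat (Suc m * Suc n) * \<tau>)))) summable_on UNIV \<times> UNIV"
proof -
  define r where "r = norm (qexp \<tau>)"
  have r: "0 \<le> r" "r < 1" using norm_qexp_less_1[OF assms(1)] by (auto simp: r_def)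
  have "(\<lambda>x. norm (case x of (n, m) \<Rightarrow> c m * (p n * (of_nat (Suc n) ^ k * qexp (of_nat (Suc m * Suc n) * \<tau>))))) summable_on UNIV \<times> UNIV"
  proof (rule Infinite_Sum.abs_summable_on_comparison_test')
    show "(\<lambda>x. (C * C) * (case x of (n, m) \<Rightarrow> real (Suc n) ^ k * r ^ (Suc m * Suc n))) summable_on UNIV \<times> UNIV"
      by (intro summable_on_cmult_right summable_lambert_real r)
    fix x :: "nat \<times> nat"
    obtain n m where x: "x = (n, m)" by force
    have C: "C \<ge> 0" using assms(2)[of 0] norm_ge_zero order_trans by blast
    have "norm (c m) * norm (p n) * (real (Suc n) ^ k * r ^ (Suc m * Suc n)) \<le>
          (C * C) * (real (Suc n) ^ k * r ^ (Suc m * Suc n))"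
      using r C assms by (intro mult_right_mono mult_mono) auto
    thus "norm (case x of (n, m) \<Rightarrow> c m * (p n * (of_nat (Suc n) ^ k * qexp (of_nat (Suc m * Suc n) * \<tau>)))) \<le>
          (C * C) * (case x of (n, m) \<Rightarrow> real (Suc n) ^ k * r ^ (Suc m * Suc n))"
      unfolding x prod.case qexp_of_nat_mult norm_mult norm_power norm_of_nat r_def by (simp only: mult.assoc)
  qed
  thus ?thesis by (simp add: abs_summable_summable)
qed

lemma has_sum_power_qexp_sum:
  assumes "Im z > 0"
  shows "((\<lambda>n. of_nat (Suc n) ^ k * qexp (of_nat (Suc n) * z)) has_sum power_qexp_sum (Suc k) z) UNIV"
  unfolding power_qexp_sum_def diff_Suc_1
  by (intro norm_summable_imp_has_sum summable_norm_power_qexp assms summable_sums summable_norm_cancel[OF summable_norm_power_qexp])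

text \<open>The double series of \<open>n ^ k * q ^ (m * n)\<close> summed in both orders: over
  \<open>n\<close> inside it gives polylogarithms, over \<open>m\<close> inside geometric
  series.\<close>

lemma lambert_series:
  assumes "Im \<tau> > 0"
  obtains S where "((\<lambda>m. power_qexp_sum (Suc k) (of_nat (Suc m) * \<tau>)) has_sum S) UNIV"
    "((\<lambda>n. of_nat (Suc n) ^ k * (qexp \<tau> ^ Suc n / (1 - qexp \<tau> ^ Suc n))) has_sum S) UNIV"
proof -
  obtain S where S: "((\<lambda>(n, m). of_nat (Suc n) ^ k * qexp (of_nat (Suc m * Suc n) * \<tau>)) has_sum S) (UNIV \<times> UNIV)"
    using summable_lambert[OF assms, of "\<lambda>_. 1" 1 "\<lambda>_. 1" k] by (auto simp: summable_on_def)
  have "((\<lambda>(m, n). of_nat (Suc n) ^ k * qexp (of_nat (Suc m * Suc n) * \<tau>)) has_sum S) (UNIV \<times> UNIV)"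
    using S by (subst (asm) has_sum_swap) simp
  hence 1: "((\<lambda>m. power_qexp_sum (Suc k) (of_nat (Suc m) * \<tau>)) has_sum S) UNIV"
  proof (rule has_sum_SigmaD)
    fix m :: nat
    have "Im (of_nat (Suc m) * \<tau>) > 0" using assms by simp
    from has_sum_power_qexp_sum[OF this, of k]
    show "((\<lambda>n. case (m, n) of (m, n) \<Rightarrow> of_nat (Suc n) ^ k * qexp (of_nat (Suc m * Suc n) * \<tau>)) has_sum power_qexp_sum (Suc k) (of_nat (Suc m) * \<tau>)) UNIV"
      by (simp only: prod.case of_nat_mult mult_ac)
  qed
  have "((\<lambda>n. of_nat (Suc n) ^ k * (qexp \<tau> ^ Suc n / (1 - qexp \<tau> ^ Suc n))) has_sum S) UNIV"
  proof (rule has_sum_SigmaD[OF S])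
    fix n :: nat
    define u where "u = qexp \<tau> ^ Suc n"
    have "norm (qexp \<tau>) ^ Suc n < 1" using norm_qexp_less_1[OF assms] by (simp add: power_less_one_iff del: power_Suc)
    hence u: "norm u < 1" by (simp add: u_def norm_power del: power_Suc)
    have "((\<lambda>m. u ^ Suc m) has_sum (u / (1 - u))) UNIV"
    proof (rule norm_summable_imp_has_sum)
      show "summable (\<lambda>m. norm (u ^ Suc m))"
        using u by (subst summable_Suc_iff) (auto simp: norm_power intro!: summable_geometric)
      have "(\<lambda>m. u * u ^ m) sums (u * (1 / (1 - u)))"
        by (intro sums_mult geometric_sums u)
      thus "(\<lambda>m. u ^ Suc m) sums (u / (1 - u))" by simp
    qed
    moreover have "u ^ Suc m = qexp (of_nat (Suc m * Suc n) * \<tau>)" for m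
      unfolding u_def qexp_of_nat_mult by (metis power_mult mult.commute)
    ultimately have "((\<lambda>m. qexp (of_nat (Suc m * Suc n) * \<tau>)) has_sum (u / (1 - u))) UNIV" by simp
    from has_sum_cmult_right[OF this]
    show "((\<lambda>m. case (n, m) of (n, m) \<Rightarrow> of_nat (Suc n) ^ k * qexp (of_nat (Suc m * Suc n) * \<tau>)) has_sum
        of_nat (Suc n) ^ k * (qexp \<tau> ^ Suc n / (1 - qexp \<tau> ^ Suc n))) UNIV"
      by (simp add: u_def)
  qed
  with 1 that show ?thesis by blast
qed

text \<open>The Lipschitz formula with \<open>w = 2\<close> applies to the rows with
  \<open>m > 0\<close>; the rows \<open>m\<close> and \<open>- m\<close> agree, and the row
  \<open>m = 0\<close> is twice the Basel sum.\<close>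

lemma eisenstein_G2_lambert:
  assumes "Im \<tau> > 0"
  shows "((\<lambda>n. of_nat (Suc n) * (qexp \<tau> ^ Suc n / (1 - qexp \<tau> ^ Suc n))) has_sum
            ((of_real (pi\<^sup>2 / 3) - eisenstein_G2 \<tau>) / (8 * of_real pi ^ 2))) UNIV"
proof -
  obtain S where S: "((\<lambda>m. power_qexp_sum (Suc 1) (of_nat (Suc m) * \<tau>)) has_sum S) UNIV"
    "((\<lambda>n. of_nat (Suc n) ^ 1 * (qexp \<tau> ^ Suc n / (1 - qexp \<tau> ^ Suc n))) has_sum S) UNIV"
    using lambert_series[OF assms] by blast
  have "((\<lambda>m. (- 4 * of_real pi ^ 2) * power_qexp_sum 2 (of_nat (Suc m) * \<tau>)) has_sum ((- 4 * of_real pi ^ 2) * S)) UNIV"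
    by (intro has_sum_cmult_right) (use S in \<open>simp add: numeral_2_eq_2\<close>)
  also have "(\<lambda>m. (- 4 * of_real pi ^ 2) * power_qexp_sum 2 (of_nat (Suc m) * \<tau>)) = (\<lambda>m. int_shift_sum 2 (of_nat (Suc m) * \<tau>))"
  proof
    fix m
    have "Im (of_nat (Suc m) * \<tau>) > 0" using assms by simp
    from lipschitz_summation[OF _ this, of 2]
    show "(- 4 * of_real pi ^ 2) * power_qexp_sum 2 (of_nat (Suc m) * \<tau>) = int_shift_sum 2 (of_nat (Suc m) * \<tau>)"
      by (simp add: power_mult_distrib fact_numeral)
  qed
  finally have *: "((\<lambda>m. int_shift_sum 2 (of_nat (Suc m) * \<tau>)) has_sum ((- 4 * of_real pi ^ 2) * S)) UNIV" .
  have "((\<lambda>m::int. int_shift_sum 2 (of_int m * \<tau>)) has_sum (int_shift_sum 2 (of_int 0 * \<tau>) + (- 4 * of_real pi ^ 2) * S + (- 4 * of_real pi ^ 2) * S)) UNIV"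
  proof (rule has_sum_int_zero_split)
    show "((\<lambda>m. int_shift_sum 2 (of_int (int (Suc m)) * \<tau>)) has_sum ((- 4 * of_real pi ^ 2) * S)) UNIV"
      using * by (simp del: of_nat_Suc)
    show "((\<lambda>m. int_shift_sum 2 (of_int (- int (Suc m)) * \<tau>)) has_sum ((- 4 * of_real pi ^ 2) * S)) UNIV"
      using * int_shift_sum_2_minus by (simp del: of_nat_Suc)
  qed
  hence "eisenstein_G2 \<tau> = of_real (pi\<^sup>2 / 3) - 8 * of_real pi ^ 2 * S"
    using has_sum_unique[OF has_sum_eisenstein_G2(1)[OF assms]] int_shift_sum_2_0 by simp
  hence "S = (of_real (pi\<^sup>2 / 3) - eisenstein_G2 \<tau>) / (8 * of_real pi ^ 2)"
    by simp
  with S(2) show ?thesis by simp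
qed

section \<open>The Euler product, the logarithmic derivative of eta, and inversion\<close>

definition euler_prod :: "complex \<Rightarrow> complex" where
  "euler_prod x = (\<Prod>n. 1 - x ^ Suc n)"

lemma dedekind_eta_altdef: "dedekind_eta \<tau> = qexp (\<tau> / 24) * euler_prod (qexp \<tau>)"
proof -
  have "exp (2 * of_real pi * \<i> * of_nat (Suc n) * \<tau>) = qexp \<tau> ^ Suc n" for n
    unfolding qexp_of_nat_mult[symmetric] by (simp add: qexp_def mult_ac)
  thus ?thesis by (simp add: dedekind_eta_def euler_prod_def) (simp add: qexp_def)
qed

lemma power_Suc_norm_less_1: "norm (x :: complex) < 1 \<Longrightarrow> norm (x ^ Suc n) < 1"
  by (simp add: norm_power power_less_one_iff del: power_Suc)

lemma convergent_prod_one_minus_power: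
  assumes "norm (x :: complex) < 1" "a > 0"
  shows "convergent_prod (\<lambda>n. 1 - x ^ (a * n + b))"
proof (rule abs_convergent_prod_imp_convergent_prod)
  have "norm x ^ a < 1" using assms by (simp add: power_less_one_iff)
  hence "summable (\<lambda>n. norm x ^ b * (norm x ^ a) ^ n)" by (intro summable_mult summable_geometric) auto
  moreover have "norm x ^ b * (norm x ^ a) ^ n = norm x ^ (a * n + b)" for n
    by (simp add: power_add power_mult)
  ultimately have "summable (\<lambda>n. norm x ^ (a * n + b))" by (simp only:)
  thus "abs_convergent_prod (\<lambda>n. 1 - x ^ (a * n + b))"
    by (subst abs_convergent_prod_conv_summable) (simp add: norm_power)
qed

lemma convergent_euler_prod: "norm (x :: complex) < 1 \<Longrightarrow> convergent_prod (\<lambda>n. 1 - x ^ Suc n)"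
  using convergent_prod_one_minus_power[of x 1 1] by simp

lemma euler_prod_nonzero:
  assumes "norm x < 1"
  shows "euler_prod x \<noteq> 0"
  unfolding euler_prod_def
proof (rule prodinf_nonzero[OF convergent_euler_prod[OF assms]])
  fix n
  show "1 - x ^ Suc n \<noteq> 0" using power_Suc_norm_less_1[OF assms, of n] by auto
qed

lemma summable_Ln_one_minus_power:
  assumes "norm x < 1"
  shows "summable (\<lambda>n. norm (Ln (1 - x ^ Suc n)))"
proof (rule summable_comparison_test_ev)
  have "(\<lambda>n. norm x ^ Suc n) \<longlonglongrightarrow> 0"
    using assms by (intro LIMSEQ_Suc LIMSEQ_power_zero) auto
  hence "\<forall>\<^sub>F n in sequentially. norm x ^ Suc n < 1 / 2"
    by (rule order_tendstoD) auto
  thus "\<forall>\<^sub>F n in sequentially. norm (norm (Ln (1 - x ^ Suc n))) \<le> 2 * norm x ^ Suc n"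
  proof eventually_elim
    case (elim n)
    hence "norm (- (x ^ Suc n)) < 1 / 2" by (simp add: norm_power del: power_Suc)
    from norm_Ln_le[OF this] show ?case by (simp add: norm_power del: power_Suc)
  qed
  show "summable (\<lambda>n. 2 * norm x ^ Suc n)"
    using assms by (intro summable_mult) (subst summable_Suc_iff, auto intro!: summable_geometric)
qed

lemma euler_prod_exp:
  assumes "norm x < 1"
  shows "euler_prod x = exp (\<Sum>n. Ln (1 - x ^ Suc n))"
proof -
  have nz: "1 - x ^ Suc n \<noteq> 0" for n using power_Suc_norm_less_1[OF assms, of n] by auto
  have "euler_prod x = (\<Prod>n. exp (Ln (1 - x ^ Suc n)))"
    unfolding euler_prod_def by (intro prodinf_cong) (simp only: exp_Ln[OF nz])
  also have "\<dots> = exp (\<Sum>n. Ln (1 - x ^ Suc n))"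
    by (intro prodinf_exp summable_norm_cancel[OF summable_Ln_one_minus_power] assms)
  finally show ?thesis .
qed

text \<open>The sum of the logarithms is at most \<open>4 * norm y\<close> for
  \<open>norm y < 1 / 2\<close>. This limit yields all values of the eta quotient at the
  cusps.\<close>

lemma tendsto_euler_prod:
  assumes "(f \<longlongrightarrow> 0) F"
  shows "((\<lambda>x. euler_prod (f x)) \<longlongrightarrow> 1) F"
proof -
  have n0: "((\<lambda>x. norm (f x)) \<longlongrightarrow> 0) F" using assms by (rule tendsto_norm_zero)
  hence ev: "\<forall>\<^sub>F x in F. norm (f x) < 1 / 2" by (rule order_tendstoD) auto
  have bound: "norm (\<Sum>n. Ln (1 - y ^ Suc n)) \<le> 4 * norm y" if y: "norm y < 1 / 2" for y :: complex
  proof -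
    have y1: "norm y < 1" using y by simp
    have "norm (\<Sum>n. Ln (1 - y ^ Suc n)) \<le> (\<Sum>n. norm (Ln (1 - y ^ Suc n)))"
      by (rule summable_norm[OF summable_Ln_one_minus_power[OF y1]])
    also have "\<dots> \<le> (\<Sum>n. 2 * norm y * norm y ^ n)"
    proof (rule suminf_le[OF _ summable_Ln_one_minus_power[OF y1]])
      show "summable (\<lambda>n. 2 * norm y * norm y ^ n)" using y1 by (intro summable_mult summable_geometric) auto
      fix n
      have "norm y ^ Suc n \<le> norm y" using y1 by (simp add: mult_left_le power_le_one)
      hence "norm (- (y ^ Suc n)) < 1 / 2" using y by (simp add: norm_power del: power_Suc)
      from norm_Ln_le[OF this] show "norm (Ln (1 - y ^ Suc n)) \<le> 2 * norm y * norm y ^ n"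
        by (simp add: norm_power norm_mult mult_ac)
    qed
    also have "(\<Sum>n. 2 * norm y * norm y ^ n) = 2 * norm y * (1 / (1 - norm y))"
      using y1 by (intro sums_unique[symmetric] sums_mult geometric_sums) auto
    also have "\<dots> \<le> 2 * norm y * 2"
      using y by (intro mult_left_mono) (auto simp: field_simps)
    finally show ?thesis by simp
  qed
  have "((\<lambda>x. \<Sum>n. Ln (1 - f x ^ Suc n)) \<longlongrightarrow> 0) F"
  proof (rule Lim_null_comparison)
    show "\<forall>\<^sub>F x in F. norm (\<Sum>n. Ln (1 - f x ^ Suc n)) \<le> 4 * norm (f x)"
      using ev by eventually_elim (rule bound)
    show "((\<lambda>x. 4 * norm (f x)) \<longlongrightarrow> 0) F" using tendsto_mult_right_zero[OF n0] .
  qed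
  hence "((\<lambda>x. exp (\<Sum>n. Ln (1 - f x ^ Suc n))) \<longlongrightarrow> exp 0) F" by (rule tendsto_exp)
  moreover have "\<forall>\<^sub>F x in F. exp (\<Sum>n. Ln (1 - f x ^ Suc n)) = euler_prod (f x)"
    using ev by eventually_elim (use euler_prod_exp in force)
  ultimately show ?thesis by (simp add: tendsto_cong)
qed

lemma dedekind_eta_nonzero: "Im \<tau> > 0 \<Longrightarrow> dedekind_eta \<tau> \<noteq> 0"
  by (simp add: dedekind_eta_altdef euler_prod_nonzero norm_qexp_less_1)

lemma has_field_derivative_log_euler_prod:
  assumes "Im \<tau> > 0"
  shows "\<exists>D. ((\<lambda>\<tau>. \<Sum>n. Ln (1 - qexp \<tau> ^ Suc n)) has_field_derivative D) (at \<tau>) \<and>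
           (\<lambda>n. - 2 * of_real pi * \<i> * (of_nat (Suc n) * (qexp \<tau> ^ Suc n / (1 - qexp \<tau> ^ Suc n)))) sums D"
proof -
  define S where "S = {z. Im z > 0}"
  have opS: "open S" unfolding S_def by (rule open_halfspace_Im_gt)
  define f where "f = (\<lambda>n z. Ln (1 - qexp z ^ Suc n))"
  define f' where "f' = (\<lambda>n z. - 2 * of_real pi * \<i> * (of_nat (Suc n) * (qexp z ^ Suc n / (1 - qexp z ^ Suc n))))"
  have "\<exists>g g'. \<forall>x\<in>S. (\<lambda>n. f n x) sums g x \<and> (\<lambda>n. f' n x) sums g' x \<and> (g has_field_derivative g' x) (at x)"
  proof (rule series_and_derivative_comparison_local[OF opS])
    fix n x assume "x \<in> S"
    hence *: "norm (qexp x ^ Suc n) < 1"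
      by (intro power_Suc_norm_less_1 norm_qexp_less_1) (simp add: S_def)
    \<comment> \<open>Hence the factor has positive real part and stays off the branch cut of
      \<open>Ln\<close>.\<close>
    have "Re (qexp x ^ Suc n) < 1" using complex_Re_le_cmod[of "qexp x ^ Suc n"] * by linarith
    hence nr: "1 - qexp x ^ Suc n \<notin> \<real>\<^sub>\<le>\<^sub>0"
      by (auto simp: complex_nonpos_Reals_iff simp del: power_Suc)
    have "((\<lambda>z. 1 - qexp z ^ Suc n) has_field_derivative
             (0 - of_nat (Suc n) * (2 * of_real pi * \<i> * 1 * qexp x * qexp x ^ n))) (at x)"
      by (rule derivative_eq_intros refl)+ simp
    from DERIV_chain2[OF has_field_derivative_Ln[OF nr] this]
    show "(f n has_field_derivative f' n x) (at x)"
      by (simp add: f_def f'_def divide_inverse mult_ac del: of_nat_Suc)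
  next
    fix x assume x: "x \<in> S"
    define d where "d = Im x / 2"
    define r where "r = exp (- 2 * pi * d)"
    have d: "d > 0" using x by (simp add: d_def S_def)
    have r: "0 < r" "r < 1" using d by (auto simp: r_def)
    have rb: "norm (qexp y) \<le> r" if "y \<in> ball x d" for y
    proof -
      have "Im y \<ge> d" using that unfolding d_def by (rule Im_ge_half_in_ball)
      thus ?thesis by (simp add: norm_qexp r_def)
    qed
    have "(\<lambda>n. r ^ Suc n) \<longlonglongrightarrow> 0" using r by (intro LIMSEQ_Suc LIMSEQ_power_zero) auto
    hence "\<forall>\<^sub>F n in sequentially. r ^ Suc n < 1 / 2" by (rule order_tendstoD) auto
    hence "\<forall>\<^sub>F n in sequentially. \<forall>y\<in>ball x d \<inter> S. norm (f n y) \<le> 2 * r ^ Suc n"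
    proof eventually_elim
      case (elim n)
      show ?case
      proof
        fix y assume "y \<in> ball x d \<inter> S"
        hence "norm (qexp y) ^ Suc n \<le> r ^ Suc n" by (intro power_mono rb) auto
        hence *: "norm (- (qexp y ^ Suc n)) \<le> r ^ Suc n" by (simp add: norm_power del: power_Suc)
        hence "norm (- (qexp y ^ Suc n)) < 1 / 2" using elim by linarith
        from norm_Ln_le[OF this] * show "norm (f n y) \<le> 2 * r ^ Suc n" by (simp add: f_def del: power_Suc)
      qed
    qed
    moreover have "summable (\<lambda>n. 2 * r ^ Suc n)"
      using r by (intro summable_mult) (subst summable_Suc_iff, auto intro!: summable_geometric)
    ultimately show "\<exists>d h. 0 < d \<and> summable h \<and> (\<forall>\<^sub>F n in sequentially. \<forall>y\<in>ball x d \<inter> S. norm (f n y) \<le> h n)"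
      using d by (intro exI[of _ d] exI[of _ "\<lambda>n. 2 * r ^ Suc n"]) auto
  qed
  then obtain g g' where g: "\<And>x. x \<in> S \<Longrightarrow> (\<lambda>n. f n x) sums g x"
    "\<And>x. x \<in> S \<Longrightarrow> (\<lambda>n. f' n x) sums g' x"
    "\<And>x. x \<in> S \<Longrightarrow> (g has_field_derivative g' x) (at x)" by blast
  have z: "\<tau> \<in> S" using assms by (simp add: S_def)
  have "((\<lambda>\<tau>. \<Sum>n. Ln (1 - qexp \<tau> ^ Suc n)) has_field_derivative g' \<tau>) (at \<tau>)"
  proof (rule has_field_derivative_transform_within_open[OF g(3)[OF z] opS z])
    fix x assume "x \<in> S"
    thus "g x = (\<Sum>n. Ln (1 - qexp x ^ Suc n))"
      using g(1)[of x] by (simp add: f_def sums_iff)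
  qed
  with g(2)[OF z] show ?thesis unfolding f'_def by blast
qed

text \<open>The factor \<open>qexp (\<tau> / 24)\<close> contributes
  \<open>2 * pi * \<i> / 24\<close>, exactly what the constant term \<open>pi\<^sup>2 / 3\<close> of
  the weight 2 series requires. So the logarithmic derivative is a pure multiple of
  \<open>eisenstein_G2\<close>.\<close>

theorem has_field_derivative_dedekind_eta:
  assumes "Im \<tau> > 0"
  shows "(dedekind_eta has_field_derivative
           dedekind_eta \<tau> * (\<i> / (4 * of_real pi) * eisenstein_G2 \<tau>)) (at \<tau>)"
proof -
  obtain D where D: "((\<lambda>\<tau>. \<Sum>n. Ln (1 - qexp \<tau> ^ Suc n)) has_field_derivative D) (at \<tau>)"
    "(\<lambda>n. - 2 * of_real pi * \<i> * (of_nat (Suc n) * (qexp \<tau> ^ Suc n / (1 - qexp \<tau> ^ Suc n)))) sums D"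
    using has_field_derivative_log_euler_prod[OF assms] by blast
  have "(\<lambda>n. - 2 * of_real pi * \<i> * (of_nat (Suc n) * (qexp \<tau> ^ Suc n / (1 - qexp \<tau> ^ Suc n)))) sums
          (- 2 * of_real pi * \<i> * ((of_real (pi\<^sup>2 / 3) - eisenstein_G2 \<tau>) / (8 * of_real pi ^ 2)))"
    by (intro sums_mult has_sum_imp_sums eisenstein_G2_lambert assms)
  with D(2) have Deq: "D = - 2 * of_real pi * \<i> * ((of_real (pi\<^sup>2 / 3) - eisenstein_G2 \<tau>) / (8 * of_real pi ^ 2))"
    using sums_unique2 by blast
  have open_H: "open {z. Im z > 0}" by (rule open_halfspace_Im_gt)
  have "((\<lambda>\<tau>. qexp (\<tau> / 24) * exp (\<Sum>n. Ln (1 - qexp \<tau> ^ Suc n))) has_field_derivative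
          (2 * of_real pi * \<i> * (1 / 24) * qexp (\<tau> / 24) * exp (\<Sum>n. Ln (1 - qexp \<tau> ^ Suc n)) +
           (exp (\<Sum>n. Ln (1 - qexp \<tau> ^ Suc n)) * D) * qexp (\<tau> / 24))) (at \<tau>)"
    by (intro DERIV_mult DERIV_fun_exp D(1)) (rule derivative_eq_intros refl | simp)+
  also have "2 * of_real pi * \<i> * (1 / 24) * qexp (\<tau> / 24) * exp (\<Sum>n. Ln (1 - qexp \<tau> ^ Suc n)) +
           (exp (\<Sum>n. Ln (1 - qexp \<tau> ^ Suc n)) * D) * qexp (\<tau> / 24) =
           (qexp (\<tau> / 24) * exp (\<Sum>n. Ln (1 - qexp \<tau> ^ Suc n))) * (2 * of_real pi * \<i> * (1 / 24) + D)"
    by (simp only: algebra_simps)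
  also have "2 * of_real pi * \<i> * (1 / 24) + D = \<i> / (4 * of_real pi) * eisenstein_G2 \<tau>"
    unfolding Deq by (simp add: field_simps power2_eq_square)
  also have "qexp (\<tau> / 24) * exp (\<Sum>n. Ln (1 - qexp \<tau> ^ Suc n)) = dedekind_eta \<tau>"
    using assms by (simp only: dedekind_eta_altdef euler_prod_exp norm_qexp_less_1)
  finally show ?thesis
    by (rule has_field_derivative_transform_within_open[OF _ open_H])
       (use assms in \<open>simp_all only: dedekind_eta_altdef euler_prod_exp norm_qexp_less_1 mem_Collect_eq\<close>)
qed

lemma Im_minus_inverse_pos: "Im \<tau> > 0 \<Longrightarrow> Im (- 1 / \<tau>) > 0"
  by (simp add: Im_divide divide_pos_pos add_nonneg_pos)

text \<open>The quotient \<open>R\<close> of the two sides, without the constant, has derivative 0: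
  the defect in \<open>eisenstein_G2_inversion\<close> cancels the derivative of the factor
  \<open>z\<close>. On the convex upper half-plane \<open>R\<close> is therefore constant.\<close>

theorem dedekind_eta_inversion:
  assumes \<tau>: "Im \<tau> > 0"
  shows "dedekind_eta (- 1 / \<tau>) ^ 2 = - \<i> * \<tau> * dedekind_eta \<tau> ^ 2"
proof -
  define H where "H = {z. Im z > 0}"
  define R where "R = (\<lambda>z. dedekind_eta (- 1 / z) ^ 2 / (z * dedekind_eta z ^ 2))"
  have "convex H" unfolding H_def by (rule convex_halfspace_Im_gt)
  moreover have "(R has_field_derivative 0) (at z within H)" if "z \<in> H" for z
  proof -
    have z: "Im z > 0" "z \<noteq> 0" using that by (auto simp: H_def)
    note nz = dedekind_eta_nonzero[OF z(1)]
    define a b where "a = dedekind_eta z" and "b = dedekind_eta (- 1 / z)"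
    define G where "G = eisenstein_G2 z"
    define c where "c = \<i> / (4 * complex_of_real pi)"
    define G' where "G' = eisenstein_G2 (- 1 / z)"
    have G': "G' = z ^ 2 * (G - 2 * of_real pi * \<i> / z)"
      using eisenstein_G2_inversion[OF z(1)] z by (simp add: G_def G'_def field_simps)
    have "((\<lambda>z. - 1 / z) has_field_derivative 1 / z ^ 2) (at z)"
      using z by (auto intro!: derivative_eq_intros simp: power2_eq_square)
    from DERIV_chain2[OF has_field_derivative_dedekind_eta[OF Im_minus_inverse_pos[OF z(1)]] this]
    have 1: "((\<lambda>z. dedekind_eta (- 1 / z)) has_field_derivative b * (c * G') * (1 / z ^ 2)) (at z)"
      by (simp add: b_def c_def G'_def)
    have 2: "(dedekind_eta has_field_derivative a * (c * G)) (at z)"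
      using has_field_derivative_dedekind_eta[OF z(1)] by (simp add: a_def c_def G_def)
    have "(R has_field_derivative
        ((of_nat 2 * (b * (c * G') * (1 / z ^ 2) * b ^ (2 - Suc 0))) * (z * a ^ 2) -
         b ^ 2 * (1 * a ^ 2 + of_nat 2 * (a * (c * G) * a ^ (2 - Suc 0)) * z)) / ((z * a ^ 2) * (z * a ^ 2))) (at z)"
      unfolding R_def a_def b_def
      by (intro DERIV_divide DERIV_mult DERIV_power DERIV_ident 1[unfolded b_def a_def] 2[unfolded a_def]) (use z nz in auto)
    also have "(of_nat 2 * (b * (c * G') * (1 / z ^ 2) * b ^ (2 - Suc 0))) * (z * a ^ 2) -
         b ^ 2 * (1 * a ^ 2 + of_nat 2 * (a * (c * G) * a ^ (2 - Suc 0)) * z) =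
         a ^ 2 * b ^ 2 * (2 * c * (z * (G' / z ^ 2 - G)) - 1)"
      by (simp add: power2_eq_square algebra_simps)
    also have "z * (G' / z ^ 2 - G) = - 2 * of_real pi * \<i>"
      using z by (simp add: G' field_simps power2_eq_square)
    also have "2 * c * (- 2 * of_real pi * \<i>) - 1 = 0"
      by (simp add: c_def)
    finally show ?thesis by (simp add: has_field_derivative_at_within)
  qed
  ultimately have "\<exists>C. \<forall>z\<in>H. R z = C"
    by (rule has_field_derivative_zero_constant)
  then obtain C where C: "\<And>z. z \<in> H \<Longrightarrow> R z = C" by blast
  \<comment> \<open>\<i> is the fixed point of the inversion, so both eta values coincide
    there.\<close>
  have "R \<i> = 1 / \<i>"
    using dedekind_eta_nonzero[of \<i>] by (simp add: R_def)
  hence "C = - \<i>" using C[of \<i>] by (simp add: H_def)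
  hence "R \<tau> = - \<i>" using C[of \<tau>] \<tau> by (simp add: H_def)
  moreover have "\<tau> * dedekind_eta \<tau> ^ 2 \<noteq> 0" using dedekind_eta_nonzero[OF \<tau>] \<tau> by auto
  ultimately show ?thesis by (simp add: R_def field_simps)
qed

lemma dedekind_eta_plus_of_nat: "dedekind_eta (\<tau> + of_nat n) = qexp (of_nat n / 24) * dedekind_eta \<tau>"
proof -
  have "qexp (of_nat n) = 1" using qexp_of_nat_mult[of n 1] by (simp add: qexp_def exp_two_pi_i)
  thus ?thesis by (simp add: dedekind_eta_altdef qexp_add add_divide_distrib)
qed

section \<open>The eta function at \<open>\<tau> + 1 / 2\<close>\<close>

lemma prodinf_even_odd:
  fixes f :: "nat \<Rightarrow> complex"
  assumes "convergent_prod f" "convergent_prod (\<lambda>n. f (2 * n))" "convergent_prod (\<lambda>n. f (2 * n + 1))"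
  shows "prodinf f = prodinf (\<lambda>n. f (2 * n)) * prodinf (\<lambda>n. f (2 * n + 1))"
proof -
  have eq: "(\<Prod>i\<le>2 * N + 1. f i) = (\<Prod>i\<le>N. f (2 * i)) * (\<Prod>i\<le>N. f (2 * i + 1))" for N
    by (induction N) (simp_all add: mult_ac)
  have "(\<lambda>N. (\<Prod>i\<le>N. f (2 * i)) * (\<Prod>i\<le>N. f (2 * i + 1))) \<longlonglongrightarrow> prodinf (\<lambda>n. f (2 * n)) * prodinf (\<lambda>n. f (2 * n + 1))"
    by (intro tendsto_mult convergent_prod_LIMSEQ assms)
  moreover have "(\<lambda>N. \<Prod>i\<le>2 * N + 1. f i) \<longlonglongrightarrow> prodinf f"
    by (rule LIMSEQ_subseq_LIMSEQ[OF convergent_prod_LIMSEQ[OF assms(1)], unfolded o_def]) (simp add: strict_mono_def)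
  ultimately show ?thesis unfolding eq using LIMSEQ_unique by fast
qed

lemma euler_prod_even_odd:
  assumes "norm x < 1"
  shows "euler_prod x = (\<Prod>n. 1 - x ^ (2 * n + 1)) * euler_prod (x\<^sup>2)"
proof -
  have "euler_prod x = (\<Prod>n. 1 - x ^ Suc (2 * n)) * (\<Prod>n. 1 - x ^ Suc (2 * n + 1))"
    unfolding euler_prod_def
  proof (rule prodinf_even_odd)
    show "convergent_prod (\<lambda>n. 1 - x ^ Suc n)" by (rule convergent_euler_prod[OF assms])
    show "convergent_prod (\<lambda>n. 1 - x ^ Suc (2 * n))" "convergent_prod (\<lambda>n. 1 - x ^ Suc (2 * n + 1))"
      using convergent_prod_one_minus_power[OF assms, of 2 1] convergent_prod_one_minus_power[OF assms, of 2 2] by simp_all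
  qed
  also have "(\<lambda>n. 1 - x ^ Suc (2 * n + 1)) = (\<lambda>n. 1 - (x\<^sup>2) ^ Suc n)"
    by (simp add: power_mult[symmetric] fun_eq_iff) (simp add: power2_eq_square mult_ac)
  finally show ?thesis by (simp add: euler_prod_def)
qed

text \<open>Let \<open>W\<close> be the product over odd exponents. Then
  \<open>W x * W (- x) = W (x\<^sup>2)\<close>, since for odd powers the factors pair up as (1 -
  y)(1 + y), and \<open>W\<close> is a quotient of two Euler products.\<close>

lemma euler_prod_minus:
  assumes "norm x < 1"
  shows "euler_prod x * euler_prod (- x) * euler_prod (x ^ 4) = euler_prod (x\<^sup>2) ^ 3"
proof -
  define W where "W = (\<lambda>x::complex. \<Prod>n. 1 - x ^ (2 * n + 1))"
  have x2: "norm (x\<^sup>2) < 1" using assms by (simp add: norm_power power_less_one_iff)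
  have conv: "convergent_prod (\<lambda>n. 1 - y ^ (2 * n + 1))" if "norm y < 1" for y :: complex
    using convergent_prod_one_minus_power[OF that, of 2 1] by simp
  have "W x * W (- x) = (\<Prod>n. (1 - x ^ (2 * n + 1)) * (1 - (- x) ^ (2 * n + 1)))"
    unfolding W_def by (intro prodinf_mult conv) (use assms in auto)
  also have "(\<lambda>n. (1 - x ^ (2 * n + 1)) * (1 - (- x) ^ (2 * n + 1))) = (\<lambda>n. 1 - (x\<^sup>2) ^ (2 * n + 1))"
  proof
    fix n
    have "(- x) ^ (2 * n + 1) = - (x ^ (2 * n + 1))" by (rule power_minus_odd) simp
    moreover have "(x\<^sup>2) ^ (2 * n + 1) = (x ^ (2 * n + 1))\<^sup>2" by (metis power_mult mult.commute)
    ultimately show "(1 - x ^ (2 * n + 1)) * (1 - (- x) ^ (2 * n + 1)) = 1 - (x\<^sup>2) ^ (2 * n + 1)"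
      by (simp only:) (simp only: power2_eq_square algebra_simps, simp)
  qed
  finally have W: "W x * W (- x) = W (x\<^sup>2)" by (simp add: W_def)
  have e: "euler_prod x = W x * euler_prod (x\<^sup>2)" "euler_prod (- x) = W (- x) * euler_prod (x\<^sup>2)"
    using euler_prod_even_odd[of x] euler_prod_even_odd[of "- x"] assms by (simp_all add: W_def)
  have "euler_prod (x\<^sup>2) = W (x\<^sup>2) * euler_prod (x ^ 4)"
    using euler_prod_even_odd[OF x2] by (simp add: W_def power_mult[symmetric])
  hence "euler_prod (x\<^sup>2) ^ 3 = (W (x\<^sup>2) * euler_prod (x ^ 4)) * euler_prod (x\<^sup>2) * euler_prod (x\<^sup>2)"
    by (simp add: power3_eq_cube)
  thus ?thesis unfolding e W[symmetric] by (simp add: mult_ac)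
qed

text \<open>Translation by 1/2 replaces \<open>x = qexp \<tau>\<close> by \<open>- x\<close>, and
  \<open>euler_prod_minus\<close> expresses this again by eta values. At the cusp 1/2 the argument
  \<open>\<tau> / 4\<close> undergoes this translation.\<close>

lemma dedekind_eta_plus_half:
  assumes "Im \<tau> > 0"
  shows "dedekind_eta (\<tau> + 1 / 2) = qexp (1 / 48) * dedekind_eta (2 * \<tau>) ^ 3 / (dedekind_eta \<tau> * dedekind_eta (4 * \<tau>))"
proof -
  define x where "x = qexp \<tau>"
  have x: "norm x < 1" using norm_qexp_less_1[OF assms] by (simp add: x_def)
  have p: "qexp (2 * \<tau>) = x\<^sup>2" "qexp (4 * \<tau>) = x ^ 4"
    using qexp_of_nat_mult[of 2 \<tau>] qexp_of_nat_mult[of 4 \<tau>] by (simp_all add: x_def)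
  have "qexp (1 / 2) = - 1" using exp_pi_i by (simp add: qexp_def mult_ac)
  hence h: "qexp (\<tau> + 1 / 2) = - x" by (simp add: qexp_add x_def)
  define u where "u = qexp (\<tau> / 24)"
  have u: "qexp (2 * \<tau> / 24) = u ^ 2" "qexp (4 * \<tau> / 24) = u ^ 4" "u \<noteq> 0"
    using qexp_of_nat_mult[of 2 "\<tau> / 24"] qexp_of_nat_mult[of 4 "\<tau> / 24"] by (simp_all add: u_def)
  have v: "qexp ((\<tau> + 1 / 2) / 24) = u * qexp (1 / 48)"
    by (simp add: u_def qexp_add[symmetric] add_divide_distrib)
  have x4: "norm (x ^ 4) < 1" using x by (simp add: norm_power power_less_one_iff)
  have nz: "euler_prod x \<noteq> 0" "euler_prod (x ^ 4) \<noteq> 0"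
    by (rule euler_prod_nonzero, fact)+
  have "euler_prod (- x) = euler_prod (x\<^sup>2) ^ 3 / (euler_prod x * euler_prod (x ^ 4))"
    using euler_prod_minus[OF x] nz by (simp add: field_simps)
  moreover have "u * qexp (1 / 48) * (E / (A * B)) = qexp (1 / 48) * (u ^ 6 * E) / ((u * A) * (u ^ 4 * B))" for E A B
    using u(3) by (simp add: divide_simps) (simp add: power_numeral_reduce)
  ultimately show ?thesis
    unfolding dedekind_eta_altdef h p v u x_def[symmetric] u_def[symmetric]
    by (simp add: power_mult_distrib power_mult[symmetric])
qed

subsection \<open>Cusp forms from forms on \<open>\<Gamma>\<^sub>0(4)\<close>\<close>

lemma in_upper_half_plane [simp]: "\<tau> \<in> \<H> \<longleftrightarrow> Im \<tau> > 0"
  by (simp add: upper_half_plane_def)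

lemma eventually_upper_half_plane: "\<forall>\<^sub>F \<tau> in at_i_infinity. Im \<tau> > 0"
  unfolding at_i_infinity_def by (rule eventually_filtercomapI[OF eventually_gt_at_top])

lemma filterlim_at_i_infinity_iff: "filterlim f at_i_infinity F \<longleftrightarrow> filterlim (\<lambda>x. Im (f x)) at_top F"
  unfolding at_i_infinity_def by (simp add: filterlim_filtercomap_iff o_def)

lemma filterlim_Im_at_i_infinity: "filterlim Im at_top at_i_infinity"
  unfolding at_i_infinity_def by (rule filterlim_filtercomap)

lemma tendsto_0_cmult_at_i_infinity:
  fixes f g :: "complex \<Rightarrow> complex"
  assumes "(f \<longlongrightarrow> 0) at_i_infinity" "\<And>\<tau>. Im \<tau> > 0 \<Longrightarrow> g \<tau> = r * f \<tau>"
  shows "(g \<longlongrightarrow> 0) at_i_infinity"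
proof (rule Lim_transform_eventually)
  show "((\<lambda>\<tau>. r * f \<tau>) \<longlongrightarrow> 0) at_i_infinity" by (rule tendsto_mult_right_zero[OF assms(1)])
  show "\<forall>\<^sub>F \<tau> in at_i_infinity. r * f \<tau> = g \<tau>"
    using eventually_upper_half_plane by eventually_elim (simp add: assms(2))
qed

lemma moebius_denom_nonzero:
  assumes "Im \<tau> > 0" "a * d - b * c = (1 :: int)"
  shows "of_int c * \<tau> + of_int d \<noteq> 0"
proof -
  have "c \<noteq> 0 \<or> d \<noteq> 0" using assms by auto
  thus ?thesis using lattice_point_nonzero[OF assms(1), of "of_int c" "of_int d"] by simp
qed

lemma Im_moebius_pos:
  assumes "Im \<tau> > 0" "a * d - b * c = (1 :: int)"
  shows "Im ((of_int a * \<tau> + of_int b) / (of_int c * \<tau> + of_int d)) > 0"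
proof -
  define z where "z = of_int c * \<tau> + of_int d"
  have z: "z \<noteq> 0" using moebius_denom_nonzero[OF assms] by (simp add: z_def)
  have "real_of_int (a * d - b * c) = 1" using assms by simp
  hence det: "real_of_int a * real_of_int d - real_of_int b * real_of_int c = 1" by simp
  have "Im ((of_int a * \<tau> + of_int b) / z) = Im ((of_int a * \<tau> + of_int b) * cnj z) / (norm z)\<^sup>2"
    by (subst complex_div_cnj) (simp only: of_real_power[symmetric] Im_divide_of_real)
  also have "Im ((of_int a * \<tau> + of_int b) * cnj z) = (of_int a * of_int d - of_int b * of_int c) * Im \<tau>"
    by (simp add: z_def) algebra
  finally have "Im ((of_int a * \<tau> + of_int b) / z) = Im \<tau> / (norm z)\<^sup>2" by (simp only: det mult_1)
  thus ?thesis using assms(1) z by (simp add: z_def)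
qed

lemma slash_cong:
  assumes "\<And>\<tau>. Im \<tau> > 0 \<Longrightarrow> f \<tau> = g \<tau>" "Im \<tau> > 0" "a * d - b * c = 1"
  shows "slash w a b c d f \<tau> = slash w a b c d g \<tau>"
  unfolding slash_def using Im_moebius_pos[OF assms(2,3)] assms(1) by simp

text \<open>The cocycle relation for \<open>c * \<tau> + d\<close>. \<open>slash\<close> is a right
  action: the matrix applied earlier stands on the left in the product.\<close>

lemma slash_slash:
  assumes "Im \<tau> > 0" "a * d - b * c = 1" "a' * d' - b' * c' = 1"
  shows "slash w a' b' c' d' (slash w a b c d f) \<tau> =
         slash w (a * a' + b * c') (a * b' + b * d') (c * a' + d * c') (c * b' + d * d') f \<tau>"
proof -
  define q where "q = of_int c' * \<tau> + of_int d'"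
  define p where "p = of_int a' * \<tau> + of_int b'"
  have q: "q \<noteq> 0" using moebius_denom_nonzero[OF assms(1,3)] by (simp add: q_def)
  have r: "of_int c * (p / q) + of_int d \<noteq> 0"
    using moebius_denom_nonzero[OF Im_moebius_pos[OF assms(1,3)] assms(2)] by (simp add: p_def q_def)
  have cq: "of_int c * (p / q) + of_int d = (of_int (c * a' + d * c') * \<tau> + of_int (c * b' + d * d')) / q"
    using q by (simp add: field_simps p_def q_def)
  have aq: "of_int a * (p / q) + of_int b = (of_int (a * a' + b * c') * \<tau> + of_int (a * b' + b * d')) / q"
    using q by (simp add: field_simps p_def q_def)
  have "slash w a' b' c' d' (slash w a b c d f) \<tau> =
    f ((of_int a * (p / q) + of_int b) / (of_int c * (p / q) + of_int d)) / ((of_int c * (p / q) + of_int d) * q) ^ w"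
    by (simp add: slash_def p_def q_def power_mult_distrib)
  also have "(of_int c * (p / q) + of_int d) * q = of_int (c * a' + d * c') * \<tau> + of_int (c * b' + d * d')"
    unfolding cq using q by simp
  also have "(of_int a * (p / q) + of_int b) / (of_int c * (p / q) + of_int d) =
      (of_int (a * a' + b * c') * \<tau> + of_int (a * b' + b * d')) / (of_int (c * a' + d * c') * \<tau> + of_int (c * b' + d * d'))"
    unfolding cq aq using q by simp
  finally show ?thesis by (simp add: slash_def)
qed

lemma slash_cmult: "slash w a b c d (\<lambda>\<tau>. r * f \<tau>) \<tau> = r * slash w a b c d f \<tau>"
  by (simp add: slash_def)

lemma chi_m4_plus: "4 dvd n \<Longrightarrow> chi_m4 (m + n) = chi_m4 m"
  by (elim dvdE) (simp add: chi_m4_def)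

lemma chi_m4_minus: "chi_m4 (- m) = - chi_m4 m"
proof -
  have "m mod 4 = 0 \<or> m mod 4 = 1 \<or> m mod 4 = 2 \<or> m mod 4 = 3" by presburger
  moreover have "m mod 4 = 0 \<Longrightarrow> (- m) mod 4 = 0" "m mod 4 = 1 \<Longrightarrow> (- m) mod 4 = 3"
    "m mod 4 = 2 \<Longrightarrow> (- m) mod 4 = 2" "m mod 4 = 3 \<Longrightarrow> (- m) mod 4 = 1" by presburger+
  ultimately show ?thesis by (auto simp: chi_m4_def)
qed

text \<open>Only the behaviour under two generators is assumed. In odd weight \<open>-1\<close> acts
  by the sign -1, which agrees with \<open>chi_m4 (- 1)\<close>.\<close>

locale gamma0_4_form =
  fixes w :: nat and \<epsilon> :: complex and D :: "complex \<Rightarrow> complex"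
  assumes odd_weight: "odd w"
    and eps: "\<epsilon> = 1 \<or> \<epsilon> = - 1"
    and translate: "\<And>\<tau>. Im \<tau> > 0 \<Longrightarrow> D (\<tau> + 1) = \<epsilon> * D \<tau>"
    and unipotent: "\<And>\<tau>. Im \<tau> > 0 \<Longrightarrow> slash w 1 0 4 1 D \<tau> = D \<tau>"
begin

text \<open>The value \<open>\<epsilon> ^ b\<close>. On \<open>\<Gamma>\<^sub>0(4)\<close> the
  diagonal entries are odd, so the parity of \<open>b\<close> is additive and this is a
  character.\<close>

definition multiplier :: "int \<Rightarrow> complex" where
  "multiplier b = (if even b then 1 else \<epsilon>)"

lemma multiplier_add_odd: "odd s \<Longrightarrow> multiplier (b + s) = \<epsilon> * multiplier b"
  using eps by (auto simp: multiplier_def)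

lemma translate_back:
  assumes "Im \<tau> > 0"
  shows "D (\<tau> - 1) = \<epsilon> * D \<tau>"
  using translate[of "\<tau> - 1"] assms eps by auto

lemma translate_int:
  assumes "Im \<tau> > 0"
  shows "D (\<tau> + of_int b) = multiplier b * D \<tau>"
proof (induction b rule: int_induct[of _ 0])
  case base
  show ?case by (simp add: multiplier_def)
next
  case (step1 i)
  have "D (\<tau> + of_int (i + 1)) = D ((\<tau> + of_int i) + 1)" by (simp add: add_ac)
  also have "\<dots> = \<epsilon> * (multiplier i * D \<tau>)"
    using translate[of "\<tau> + of_int i"] step1 assms by simp
  finally show ?case by (simp add: multiplier_add_odd)
next
  case (step2 i)
  have "D (\<tau> + of_int (i - 1)) = D ((\<tau> + of_int i) - 1)" by (simp add: add_diff_eq)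
  also have "\<dots> = \<epsilon> * (multiplier i * D \<tau>)"
    using translate_back[of "\<tau> + of_int i"] step2 assms by simp
  finally show ?case using multiplier_add_odd[of "- 1" i] by simp
qed

lemma slash_translate:
  assumes "Im \<tau> > 0" "s = 1 \<or> s = - 1"
  shows "slash w 1 s 0 1 D \<tau> = \<epsilon> * D \<tau>"
  using assms translate[of \<tau>] translate_back[of \<tau>] by (auto simp: slash_def)

lemma slash_unipotent:
  assumes "Im \<tau> > 0" "s = 1 \<or> s = - 1"
  shows "slash w 1 0 (4 * s) 1 D \<tau> = D \<tau>"
proof (cases "s = 1")
  case True
  thus ?thesis using unipotent assms by simp
next
  case False
  hence s: "s = - 1" using assms by simp
  have "slash w 1 0 (- 4) 1 D \<tau> = slash w 1 0 (- 4) 1 (slash w 1 0 4 1 D) \<tau>"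
    by (rule slash_cong) (use unipotent assms in auto)
  also have "\<dots> = D \<tau>"
    by (subst slash_slash) (use assms in \<open>auto simp: slash_def\<close>)
  finally show ?thesis by (simp add: s)
qed

text \<open>Euclidean descent on the lower row: a translation changes \<open>d\<close> by
  \<open>c\<close>, the unipotent generator changes \<open>c\<close> by \<open>4 * d\<close>, and
  one of the two always decreases \<open>\<bar>c\<bar> + \<bar>d\<bar>\<close>. It ends at
  \<open>c = 0\<close>, where the matrix is a translation up to sign.\<close>

lemma slash_gamma0_4:
  assumes "a * d - b * c = 1" "4 dvd c" "Im \<tau> > 0"
  shows "slash w a b c d D \<tau> = multiplier b * chi_m4 d * D \<tau>"
  using assms
proof (induction "nat \<bar>c\<bar> + nat \<bar>d\<bar>" arbitrary: a b c d \<tau> rule: less_induct)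
  case less
  have "odd (a * d)"
  proof -
    have "a * d = 1 + b * c" using less.prems by simp
    moreover have "even c" using less.prems by presburger
    ultimately show ?thesis by simp
  qed
  hence odd: "odd a" "odd d" by auto
  show ?case
  proof (cases "c = 0")
    case True
    hence "a * d = 1" using less.prems by simp
    hence "a = 1 \<and> d = 1 \<or> a = - 1 \<and> d = - 1" by (simp add: zmult_eq_1_iff)
    thus ?thesis
    proof (elim disjE conjE)
      assume "a = 1" "d = 1"
      thus ?thesis using translate_int[OF less.prems(3), of b] True by (simp add: slash_def chi_m4_def)
    next
      assume ad: "a = - 1" "d = - 1"
      have "multiplier (- b) = multiplier b" by (simp add: multiplier_def)
      moreover have "(- \<tau> + of_int b) / - 1 = \<tau> + of_int (- b)" by simp
      ultimately show ?thesis
        using translate_int[OF less.prems(3), of "- b"] True ad odd_weight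
        by (simp add: slash_def chi_m4_def)
    qed
  next
    case c0: False
    show ?thesis
    proof (cases "\<bar>c\<bar> < 2 * \<bar>d\<bar>")
      case True
      \<comment> \<open>\<open>s\<close> is chosen so that \<open>s * c\<close> and \<open>d\<close>
        have opposite signs; then \<open>\<bar>c\<bar> < 2 * \<bar>d\<bar>\<close> gives the
        descent.\<close>
      obtain s where s: "s = 1 \<or> s = - 1" "\<bar>d + s * c\<bar> < \<bar>d\<bar>"
      proof (cases "c * d > 0")
        case True
        have "\<bar>d + (- 1) * c\<bar> < \<bar>d\<bar>" using \<open>\<bar>c\<bar> < 2 * \<bar>d\<bar>\<close> True by (auto simp: zero_less_mult_iff)
        thus ?thesis using that by blast
      next
        case False
        have "\<bar>d + 1 * c\<bar> < \<bar>d\<bar>" using \<open>\<bar>c\<bar> < 2 * \<bar>d\<bar>\<close> False c0 by (auto simp: zero_less_mult_iff)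
        thus ?thesis using that by blast
      qed
      have IH: "slash w a (b + s * a) c (d + s * c) D \<sigma> = multiplier (b + s * a) * chi_m4 (d + s * c) * D \<sigma>"
        if "Im \<sigma> > 0" for \<sigma>
        by (rule less.hyps) (use s less.prems that in \<open>auto simp: algebra_simps\<close>)
      have det: "a * (d + s * c) - (b + s * a) * c = 1" using less.prems by (simp add: algebra_simps)
      have "slash w a b c d D \<tau> = slash w 1 (- s) 0 1 (slash w a (b + s * a) c (d + s * c) D) \<tau>"
        by (subst slash_slash) (use less.prems det in \<open>auto simp: algebra_simps\<close>)
      also have "\<dots> = slash w 1 (- s) 0 1 (\<lambda>\<tau>. multiplier (b + s * a) * chi_m4 (d + s * c) * D \<tau>) \<tau>"
        by (rule slash_cong) (use IH less.prems in auto)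
      also have "\<dots> = multiplier (b + s * a) * chi_m4 (d + s * c) * (\<epsilon> * D \<tau>)"
        using slash_translate[of \<tau> "- s"] s less.prems by (subst slash_cmult) auto
      also have "multiplier (b + s * a) = \<epsilon> * multiplier b"
        using s odd by (intro multiplier_add_odd) auto
      also have "chi_m4 (d + s * c) = chi_m4 d"
        using less.prems by (intro chi_m4_plus) auto
      finally show ?thesis using eps by auto
    next
      case False
      \<comment> \<open>Equality would make \<open>d\<close> even, as \<open>c\<close> is divisible
        by 4; so one of the two descents is always strict.\<close>
      have "\<bar>c\<bar> \<noteq> 2 * \<bar>d\<bar>" using odd less.prems(2) by presburger
      hence lt: "2 * \<bar>d\<bar> < \<bar>c\<bar>" using False by linarith
      have d0: "d \<noteq> 0" using odd by auto
      obtain s where s: "s = 1 \<or> s = - 1" "\<bar>c + 4 * s * d\<bar> < \<bar>c\<bar>"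
      proof (cases "c * d > 0")
        case True
        have "\<bar>c + 4 * (- 1) * d\<bar> < \<bar>c\<bar>" using lt True by (auto simp: zero_less_mult_iff)
        thus ?thesis using that by blast
      next
        case False
        have "\<bar>c + 4 * 1 * d\<bar> < \<bar>c\<bar>" using lt False c0 d0 by (auto simp: zero_less_mult_iff)
        thus ?thesis using that by blast
      qed
      have IH: "slash w (a + 4 * s * b) b (c + 4 * s * d) d D \<sigma> = multiplier b * chi_m4 d * D \<sigma>"
        if "Im \<sigma> > 0" for \<sigma>
        by (rule less.hyps) (use s less.prems that in \<open>auto simp: algebra_simps\<close>)
      have det: "(a + 4 * s * b) * d - b * (c + 4 * s * d) = 1" using less.prems by (simp add: algebra_simps)
      have "slash w a b c d D \<tau> = slash w 1 0 (4 * - s) 1 (slash w (a + 4 * s * b) b (c + 4 * s * d) d D) \<tau>"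
        by (subst slash_slash) (use less.prems det in \<open>auto simp: algebra_simps\<close>)
      also have "\<dots> = slash w 1 0 (4 * - s) 1 (\<lambda>\<tau>. multiplier b * chi_m4 d * D \<tau>) \<tau>"
        by (rule slash_cong) (use IH less.prems in auto)
      also have "\<dots> = multiplier b * chi_m4 d * D \<tau>"
        using slash_unipotent[of \<tau> "- s"] s less.prems by (subst slash_cmult) auto
      finally show ?thesis .
    qed
  qed
qed

end

locale gamma0_4_cusp_form = gamma0_4_form +
  assumes holomorphic: "D holomorphic_on \<H>"
    and cusp_infinity: "(D \<longlongrightarrow> 0) at_i_infinity"
    and cusp_zero: "(slash w 0 (- 1) 1 0 D \<longlongrightarrow> 0) at_i_infinity"
    and cusp_half: "(slash w (- 1) 0 2 (- 1) D \<longlongrightarrow> 0) at_i_infinity"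
begin

text \<open>The residue of \<open>c\<close> modulo 4 decides the cusp: 0 when \<open>c\<close> is
  odd, 1/2 when it is 2, infinity when \<open>4 dvd c\<close>. In each case the matrix is an element
  of \<open>\<Gamma>\<^sub>0(4)\<close> times a representative of the cusp, up to a
  translation.\<close>

lemma slash_tendsto_0:
  assumes det: "a * d - b * c = (1 :: int)"
  shows "(slash w a b c d D \<longlongrightarrow> 0) at_i_infinity"
proof -
  have "odd c \<or> c mod 4 = 2 \<or> 4 dvd c" by presburger
  then consider "odd c" | "c mod 4 = 2" | "4 dvd c" by blast
  thus ?thesis
  proof cases
    case 1
    \<comment> \<open>The matrix has to be a product of an element of
      \<open>\<Gamma>\<^sub>0(4)\<close> and (0 -1; 1 j), which requires
      \<open>4 dvd d - c * j\<close>. Since the square of an odd \<open>c\<close> is 1 modulo 4,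
      this \<open>j\<close> works.\<close>
    define j where "j = c * d"
    have "\<exists>m. c * c = 4 * m + 1"
    proof -
      obtain l where "c = 2 * l + 1" using 1 by (auto elim: oddE)
      thus ?thesis by (intro exI[of _ "l * l + l"]) (simp add: algebra_simps)
    qed
    then obtain m where m: "c * c = 4 * m + 1" by blast
    have "d - c * j = d - (c * c) * d" by (simp add: j_def)
    also have "\<dots> = - 4 * (m * d)" unfolding m by (simp add: algebra_simps)
    finally have j: "4 dvd - (d - c * j)" by simp
    have detg: "- (b - a * j) * c - a * (- (d - c * j)) = 1"
      using det by (simp add: algebra_simps)
    show ?thesis
    proof (rule tendsto_0_cmult_at_i_infinity)
      show "((\<lambda>\<tau>. slash w 0 (- 1) 1 0 D (\<tau> + of_int j)) \<longlongrightarrow> 0) at_i_infinity"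
        by (rule filterlim_compose[OF cusp_zero])
           (simp add: filterlim_at_i_infinity_iff filterlim_Im_at_i_infinity)
      fix \<tau> :: complex assume \<tau>: "Im \<tau> > 0"
      have "slash w a b c d D \<tau> = slash w 0 (- 1) 1 j (slash w (- (b - a * j)) a (- (d - c * j)) c D) \<tau>"
        by (subst slash_slash) (use \<tau> detg in \<open>auto simp: algebra_simps\<close>)
      also have "\<dots> = slash w 0 (- 1) 1 j (\<lambda>\<tau>. multiplier a * chi_m4 c * D \<tau>) \<tau>"
        by (rule slash_cong) (use slash_gamma0_4[OF detg j] \<tau> in auto)
      also have "\<dots> = multiplier a * chi_m4 c * slash w 0 (- 1) 1 0 D (\<tau> + of_int j)"
        by (simp add: slash_def)
      finally show "slash w a b c d D \<tau> = multiplier a * chi_m4 c * slash w 0 (- 1) 1 0 D (\<tau> + of_int j)" .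
    qed
  next
    case 2
    have "odd d"
    proof
      assume "even d"
      hence "even (a * d - b * c)" using 2 by (auto, presburger)
      thus False using det by simp
    qed
    \<comment> \<open>This is the lower left entry after multiplication by the inverse of (-1 0; 2
      -1): both \<open>c\<close> and \<open>2 * d\<close> are 2 modulo 4.\<close>
    hence g: "4 dvd - c - 2 * d" using 2 by presburger
    have detg: "(- a - 2 * b) * (- d) - (- b) * (- c - 2 * d) = 1"
      using det by (simp add: algebra_simps)
    show ?thesis
    proof (rule tendsto_0_cmult_at_i_infinity[OF cusp_half])
      fix \<tau> :: complex assume \<tau>: "Im \<tau> > 0"
      have "slash w a b c d D \<tau> = slash w (- 1) 0 2 (- 1) (slash w (- a - 2 * b) (- b) (- c - 2 * d) (- d) D) \<tau>"
        by (subst slash_slash) (use \<tau> detg in \<open>auto simp: algebra_simps\<close>)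
      also have "\<dots> = slash w (- 1) 0 2 (- 1) (\<lambda>\<tau>. multiplier (- b) * chi_m4 (- d) * D \<tau>) \<tau>"
        by (rule slash_cong) (use slash_gamma0_4[OF detg g] \<tau> in auto)
      also have "\<dots> = multiplier (- b) * chi_m4 (- d) * slash w (- 1) 0 2 (- 1) D \<tau>"
        by (rule slash_cmult)
      finally show "slash w a b c d D \<tau> = multiplier (- b) * chi_m4 (- d) * slash w (- 1) 0 2 (- 1) D \<tau>" .
    qed
  next
    case 3
    show ?thesis
      by (rule tendsto_0_cmult_at_i_infinity[OF cusp_infinity]) (use slash_gamma0_4[OF det 3] in auto)
  qed
qed

text \<open>diag(2, 1) times a matrix of determinant 1 is again such a matrix times (2 0; 0 1), (1
  0; 0 2) or (1 1; 0 2), according to the parities of \<open>c\<close> and \<open>d\<close>. So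
  every cusp of \<open>f\<close> is a cusp of \<open>D\<close>, seen at \<open>2 * \<tau>\<close>,
  \<open>\<tau> / 2\<close> or \<open>(\<tau> + 1) / 2\<close>.\<close>

lemma double_in_cusp_forms:
  assumes f: "\<And>\<tau>. Im \<tau> > 0 \<Longrightarrow> f \<tau> = D (2 * \<tau>)"
  shows "f \<in> cusp_forms w 8 chi_m4"
proof -
  have f_slash: "slash w a b c d f \<tau> = D ((2 * (of_int a * \<tau> + of_int b)) / (of_int c * \<tau> + of_int d)) / (of_int c * \<tau> + of_int d) ^ w"
    if "a * d - b * c = 1" "Im \<tau> > 0" for a b c d \<tau>
    using f[OF Im_moebius_pos[OF that(2,1)]] by (simp add: slash_def)
  have even_c: "slash w a b (2 * c) d f \<tau> = slash w a (2 * b) c d D (2 * \<tau>)"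
    if "a * d - b * (2 * c) = 1" "Im \<tau> > 0" for a b c d \<tau>
    using f_slash[OF that] by (simp add: slash_def algebra_simps)
  have "f holomorphic_on \<H>"
  proof (rule holomorphic_transform)
    show "(D \<circ> (\<lambda>\<tau>. 2 * \<tau>)) holomorphic_on \<H>"
      by (rule holomorphic_on_compose_gen[OF _ holomorphic]) (auto intro!: holomorphic_intros)
  qed (use f in auto)
  moreover have "slash w a b c d f \<tau> = chi_m4 d * f \<tau>"
    if h: "a * d - b * c = 1" "8 dvd c" "Im \<tau> > 0" for a b c d \<tau>
  proof -
    obtain e where e: "c = 8 * e" using h(2) unfolding dvd_def by blast
    have "slash w a b (2 * (4 * e)) d f \<tau> = slash w a (2 * b) (4 * e) d D (2 * \<tau>)"
      using h by (intro even_c) (auto simp: e)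
    also have "\<dots> = multiplier (2 * b) * chi_m4 d * D (2 * \<tau>)"
      using h by (intro slash_gamma0_4) (auto simp: e)
    finally show ?thesis using f[OF h(3)] by (simp add: e multiplier_def)
  qed
  moreover have lim: "(slash w a b c d f \<longlongrightarrow> 0) at_i_infinity" if det: "a * d - b * c = 1" for a b c d :: int
  proof -
    have scale: "((\<lambda>\<tau>. slash w a' b' c' d' D (of_real r * \<tau> + of_real s)) \<longlongrightarrow> 0) at_i_infinity"
      if "r > 0" "a' * d' - b' * c' = 1" for a' b' c' d' r s
    proof (rule filterlim_compose[OF slash_tendsto_0[OF that(2)]])
      have "filterlim (\<lambda>\<tau>. r * Im \<tau>) at_top at_i_infinity"
        by (rule filterlim_tendsto_pos_mult_at_top[OF tendsto_const that(1) filterlim_Im_at_i_infinity])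
      thus "filterlim (\<lambda>\<tau>. of_real r * \<tau> + of_real s) at_i_infinity at_i_infinity"
        by (simp add: filterlim_at_i_infinity_iff)
    qed
    show ?thesis
    proof (cases "even c")
      case True
      then obtain e where e: "c = 2 * e" by (auto elim: evenE)
      show ?thesis
      proof (rule tendsto_0_cmult_at_i_infinity[where r = 1, OF scale[of 2 a d "2 * b" e 0]])
        show "a * d - 2 * b * e = 1" using det e by simp
        fix \<tau> :: complex assume "Im \<tau> > 0"
        thus "slash w a b c d f \<tau> = 1 * slash w a (2 * b) e d D (of_real 2 * \<tau> + of_real 0)"
          using even_c[of a d b e \<tau>] det e by simp
      qed auto
    next
      case c: False
      show ?thesis
      proof (cases "even d")
        case True
        then obtain e where e: "d = 2 * e" by (auto elim: evenE)
        show ?thesis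
        proof (rule tendsto_0_cmult_at_i_infinity[where r = "1 / 2 ^ w", OF scale[of "1/2" "2 * a" e b c 0]])
          show "2 * a * e - b * c = 1" using det e by simp
          fix \<tau> :: complex assume \<tau>: "Im \<tau> > 0"
          define z where "z = of_int c * (\<tau> / 2) + of_int e"
          have "of_int c * \<tau> + of_int d = 2 * z" by (simp add: z_def e algebra_simps)
          moreover have "2 * (of_int a * \<tau> + of_int b) = 2 * (of_int (2 * a) * (\<tau> / 2) + of_int b)" by simp
          ultimately have "slash w a b c d f \<tau> = D ((2 * (of_int (2 * a) * (\<tau> / 2) + of_int b)) / (2 * z)) / (2 * z) ^ w"
            using f_slash[OF det \<tau>] by (simp only:)
          also have "\<dots> = 1 / 2 ^ w * (D ((of_int (2 * a) * (\<tau> / 2) + of_int b) / z) / z ^ w)"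
            by (simp only: mult_divide_mult_cancel_left[OF zero_neq_numeral[symmetric]] power_mult_distrib) simp
          finally show "slash w a b c d f \<tau> = 1 / 2 ^ w * slash w (2 * a) b c e D (of_real (1 / 2) * \<tau> + of_real 0)"
            by (simp add: slash_def z_def)
        qed auto
      next
        case False
        with c have "even (d - c)" by simp
        then obtain e where "d - c = 2 * e" by (rule evenE)
        hence e: "d = c + 2 * e" by simp
        show ?thesis
        proof (rule tendsto_0_cmult_at_i_infinity[where r = "1 / 2 ^ w", OF scale[of "1/2" "2 * a" e "b - a" c "1/2"]])
          show "2 * a * e - (b - a) * c = 1" using det e by (simp add: algebra_simps)
          fix \<tau> :: complex assume \<tau>: "Im \<tau> > 0"
          define \<sigma> where "\<sigma> = (\<tau> + 1) / 2"
          define z where "z = of_int c * \<sigma> + of_int e"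
          have \<tau>': "\<tau> = 2 * \<sigma> - 1" by (simp add: \<sigma>_def field_simps)
          have "of_int c * \<tau> + of_int d = 2 * z" by (simp add: z_def e \<tau>' algebra_simps)
          moreover have "2 * (of_int a * \<tau> + of_int b) = 2 * (of_int (2 * a) * \<sigma> + of_int (b - a))"
            by (simp add: \<tau>' algebra_simps)
          ultimately have "slash w a b c d f \<tau> = D ((2 * (of_int (2 * a) * \<sigma> + of_int (b - a))) / (2 * z)) / (2 * z) ^ w"
            using f_slash[OF det \<tau>] by (simp only:)
          also have "\<dots> = 1 / 2 ^ w * (D ((of_int (2 * a) * \<sigma> + of_int (b - a)) / z) / z ^ w)"
            by (simp only: mult_divide_mult_cancel_left[OF zero_neq_numeral[symmetric]] power_mult_distrib) simp
          also have "\<dots> = 1 / 2 ^ w * slash w (2 * a) (b - a) c e D \<sigma>"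
            by (simp only: slash_def z_def)
          also have "\<sigma> = of_real (1 / 2) * \<tau> + of_real (1 / 2)" by (simp add: \<sigma>_def add_divide_distrib)
          finally show "slash w a b c d f \<tau> = 1 / 2 ^ w * slash w (2 * a) (b - a) c e D (of_real (1 / 2) * \<tau> + of_real (1 / 2))" .
        qed auto
      qed
    qed
  qed
  moreover have "Bfun (slash w a b c d f) at_i_infinity" if det: "a * d - b * c = 1" for a b c d :: int
  proof -
    have "((\<lambda>\<tau>. norm (slash w a b c d f \<tau>)) \<longlongrightarrow> 0) at_i_infinity"
      by (rule tendsto_norm_zero[OF lim[OF det]])
    hence "\<forall>\<^sub>F \<tau> in at_i_infinity. norm (slash w a b c d f \<tau>) < 1"
      by (rule order_tendstoD) auto
    hence "\<forall>\<^sub>F \<tau> in at_i_infinity. norm (slash w a b c d f \<tau>) \<le> 1"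
      by eventually_elim simp
    thus ?thesis by (rule BfunI)
  qed
  ultimately show ?thesis
    unfolding cusp_forms_def modular_forms_def by auto
qed

end

subsection \<open>The eta quotient\<close>

lemma tendsto_qexp_at_i_infinity:
  assumes "c > 0" "\<And>\<tau>. Im (f \<tau>) = c * Im \<tau>"
  shows "((\<lambda>\<tau>. qexp (f \<tau>)) \<longlongrightarrow> 0) at_i_infinity"
proof -
  have "filterlim (\<lambda>\<tau>. (- 2 * pi * c) * Im \<tau>) at_bot at_i_infinity"
    using assms(1) by (intro filterlim_tendsto_neg_mult_at_bot[OF tendsto_const _ filterlim_Im_at_i_infinity]) auto
  hence "((\<lambda>\<tau>. norm (qexp (f \<tau>))) \<longlongrightarrow> 0) at_i_infinity"
    unfolding norm_qexp assms(2) mult.assoc[symmetric] by (rule filterlim_compose[OF exp_at_bot])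
  thus ?thesis by (rule tendsto_norm_zero_cancel)
qed

lemma tendsto_euler_prod_at_i_infinity:
  assumes "c > 0" "\<And>\<tau>. Im (f \<tau>) = c * Im \<tau>"
  shows "((\<lambda>\<tau>. euler_prod (qexp (f \<tau>))) \<longlongrightarrow> 1) at_i_infinity"
  by (rule tendsto_euler_prod[OF tendsto_qexp_at_i_infinity[OF assms]])

lemma dedekind_eta_holomorphic: "dedekind_eta holomorphic_on \<H>"
  unfolding holomorphic_on_def field_differentiable_def
  using has_field_derivative_dedekind_eta has_field_derivative_at_within in_upper_half_plane by blast

definition eta_form :: "nat \<Rightarrow> complex \<Rightarrow> complex" where
  "eta_form k \<tau> = dedekind_eta (2 * \<tau>) ^ (8 * k - 2) * dedekind_eta (4 * \<tau>) ^ 4 / dedekind_eta \<tau> ^ (4 * k)"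

text \<open>\<open>eta_form k\<close> transported to the cusp 0, without constant and automorphy
  factor: inversion turns the multiples of the argument into fractions.\<close>

definition eta_form_zero :: "nat \<Rightarrow> complex \<Rightarrow> complex" where
  "eta_form_zero k \<tau> = dedekind_eta (\<tau> / 2) ^ (8 * k - 2) * dedekind_eta (\<tau> / 4) ^ 4 / dedekind_eta \<tau> ^ (4 * k)"

text \<open>The same at the cusp 1/2. \<open>dedekind_eta_plus_half\<close>, raised to the fourth
  power, adds 12 to the exponent \<open>8 * k - 2\<close>, adds 4 to \<open>4 * k\<close>, and moves
  the remaining fourth power into the denominator.\<close>

definition eta_form_half :: "nat \<Rightarrow> complex \<Rightarrow> complex" where
  "eta_form_half k \<tau> = dedekind_eta (2 * \<tau>) ^ (8 * k + 10) / (dedekind_eta (4 * \<tau>) ^ 4 * dedekind_eta \<tau> ^ (4 * k + 4))"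

lemma eta_quotient_eq: "eta_quotient k \<tau> = eta_form k (2 * \<tau>)"
  by (simp add: eta_quotient_def eta_form_def)

lemma eta_form_holomorphic: "eta_form k holomorphic_on \<H>"
proof -
  have h: "(\<lambda>\<tau>. dedekind_eta (of_nat n * \<tau>)) holomorphic_on \<H>" if "n > 0" for n
  proof -
    have "(dedekind_eta \<circ> (\<lambda>\<tau>. of_nat n * \<tau>)) holomorphic_on \<H>"
      using that by (intro holomorphic_on_compose_gen[OF _ dedekind_eta_holomorphic]) (auto intro!: holomorphic_intros)
    thus ?thesis by (simp add: o_def)
  qed
  show ?thesis
    unfolding eta_form_def[abs_def] using h[of 2] h[of 4] dedekind_eta_nonzero
    by (intro holomorphic_intros dedekind_eta_holomorphic) auto
qed

lemma qexp_power_24: "qexp (1 / 24) ^ 12 = - 1" "qexp (1 / 24) ^ 24 = 1"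
proof -
  have "qexp (1 / 24) ^ 12 = qexp (1 / 2)" using qexp_of_nat_mult[of 12 "1 / 24"] by simp
  also have "\<dots> = - 1" using exp_pi_i by (simp add: qexp_def mult_ac)
  finally show *: "qexp (1 / 24) ^ 12 = - 1" .
  have "qexp (1 / 24) ^ 24 = (qexp (1 / 24) ^ 12) ^ 2" by (simp add: power_mult[symmetric])
  thus "qexp (1 / 24) ^ 24 = 1" unfolding * by simp
qed

lemma dedekind_eta_plus_nat: "dedekind_eta (\<tau> + of_nat n) = qexp (1 / 24) ^ n * dedekind_eta \<tau>"
  using dedekind_eta_plus_of_nat[of \<tau> n] qexp_of_nat_mult[of n "1 / 24"] by simp

text \<open>The leading exponent is \<open>(12 * k + 12) / 24 = (k + 1) / 2\<close>, a half-integer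
  or an integer according to the parity of \<open>k\<close>.\<close>

lemma eta_form_plus_1:
  assumes "k \<ge> 1"
  shows "eta_form k (\<tau> + 1) = (- 1) ^ (k + 1) * eta_form k \<tau>"
proof -
  define u where "u = qexp (1 / 24)"
  have u0: "u \<noteq> 0" by (simp add: u_def)
  have e: "dedekind_eta (2 * (\<tau> + 1)) = u ^ 2 * dedekind_eta (2 * \<tau>)"
    "dedekind_eta (4 * (\<tau> + 1)) = u ^ 4 * dedekind_eta (4 * \<tau>)"
    "dedekind_eta (\<tau> + 1) = u * dedekind_eta \<tau>"
    using dedekind_eta_plus_nat[of "2 * \<tau>" 2] dedekind_eta_plus_nat[of "4 * \<tau>" 4] dedekind_eta_plus_nat[of \<tau> 1]
    by (simp_all add: u_def distrib_left)
  have "eta_form k (\<tau> + 1) = (u ^ 2) ^ (8 * k - 2) * (u ^ 4) ^ 4 / u ^ (4 * k) * eta_form k \<tau>"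
    unfolding eta_form_def e by (simp add: power_mult_distrib)
  also have "(u ^ 2) ^ (8 * k - 2) * (u ^ 4) ^ 4 = u ^ (12 * (k + 1) + 4 * k)"
    using assms by (simp only: power_mult[symmetric] power_add[symmetric]) (rule arg_cong[of _ _ "\<lambda>n. u ^ n"], simp)
  also have "\<dots> / u ^ (4 * k) = u ^ (12 * (k + 1))"
    by (subst power_add) (simp only: nonzero_mult_div_cancel_right[OF power_not_zero[OF u0]])
  also have "\<dots> = (u ^ 12) ^ (k + 1)"
    by (rule power_mult)
  finally show ?thesis using qexp_power_24 by (simp add: u_def)
qed

text \<open>The factors \<open>z / 2\<close> and \<open>z / 4\<close> of the inverted squares occur
  to the powers \<open>4 * k - 1\<close> and 2, which gives the power \<open>4 * k + 3\<close> of 2.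
  The weight is half the sum of exponents, and \<open>(- 1) ^ k * (- \<i>)\<close> is
  \<open>(- \<i>) ^ (2 * k + 1)\<close>.\<close>

lemma eta_form_inversion:
  assumes k: "k \<ge> 1" and \<tau>: "Im \<tau> > 0"
  shows "eta_form k (- 1 / \<tau>) = (- 1) ^ k * (- \<i>) / 2 ^ (4 * k + 3) * \<tau> ^ (2 * k + 1) * eta_form_zero k \<tau>"
proof -
  \<comment> \<open>Writing \<open>k\<close> as a successor removes the truncated subtraction from
    \<open>8 * k - 2\<close>.\<close>
  obtain j where j: "k = Suc j" using k by (cases k) auto
  define z where "z = - \<i> * \<tau>"
  have \<tau>0: "\<tau> \<noteq> 0" using \<tau> by auto
  have z0: "z \<noteq> 0" using \<tau>0 by (simp add: z_def)
  define a b c where "a = dedekind_eta (\<tau> / 2) ^ 2" and "b = dedekind_eta (\<tau> / 4) ^ 2" and "c = dedekind_eta \<tau> ^ 2"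
  have c0: "c \<noteq> 0" using dedekind_eta_nonzero[OF \<tau>] by (simp add: c_def)
  have e: "dedekind_eta (2 * (- 1 / \<tau>)) ^ 2 = (z / 2) * a" "dedekind_eta (4 * (- 1 / \<tau>)) ^ 2 = (z / 4) * b"
    "dedekind_eta (- 1 / \<tau>) ^ 2 = z * c"
    using dedekind_eta_inversion[of "\<tau> / 2"] dedekind_eta_inversion[of "\<tau> / 4"] dedekind_eta_inversion[OF \<tau>] \<tau>
    by (simp_all add: a_def b_def c_def z_def)
  have "8 * k - 2 = 2 * (4 * j + 3)" "4 * k = 2 * (2 * j + 2)" by (simp_all add: j)
  hence pow: "x ^ (8 * k - 2) = (x ^ 2) ^ (4 * j + 3)" "x ^ 4 = (x ^ 2) ^ 2" "x ^ (4 * k) = (x ^ 2) ^ (2 * j + 2)"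
    for x :: complex by (simp_all only: power_mult) (simp only: power_mult[symmetric], simp)
  have "eta_form k (- 1 / \<tau>) = (dedekind_eta (2 * (- 1 / \<tau>)) ^ 2) ^ (4 * j + 3) * (dedekind_eta (4 * (- 1 / \<tau>)) ^ 2) ^ 2 / (dedekind_eta (- 1 / \<tau>) ^ 2) ^ (2 * j + 2)"
    by (simp only: eta_form_def pow)
  also have "\<dots> = ((z / 2) * a) ^ (4 * j + 3) * ((z / 4) * b) ^ 2 / (z * c) ^ (2 * j + 2)"
    unfolding e ..
  also have "\<dots> = (z ^ (4 * j + 3) * z ^ 2) / (2 ^ (4 * j + 3) * 16 * z ^ (2 * j + 2)) * (a ^ (4 * j + 3) * b ^ 2 / c ^ (2 * j + 2))"
    unfolding power_mult_distrib power_divide by (simp add: mult_ac)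
  also have "z ^ (4 * j + 3) * z ^ 2 = z ^ (2 * j + 3) * z ^ (2 * j + 2)"
    by (simp only: power_add[symmetric]) (rule arg_cong[of _ _ "\<lambda>n. z ^ n"], simp)
  also have "2 ^ (4 * j + 3) * 16 * z ^ (2 * j + 2) = 2 ^ (4 * k + 3) * z ^ (2 * j + 2)"
    by (simp add: j power_add)
  also have "z ^ (2 * j + 3) * z ^ (2 * j + 2) / (2 ^ (4 * k + 3) * z ^ (2 * j + 2)) = z ^ (2 * k + 1) / 2 ^ (4 * k + 3)"
  proof -
    have e: "2 * k + 1 = 2 * j + 3" by (simp add: j)
    show ?thesis unfolding e by (rule mult_divide_mult_cancel_right[OF power_not_zero[OF z0]])
  qed
  also have "z ^ (2 * k + 1) = ((- \<i>) ^ 2) ^ k * (- \<i>) * \<tau> ^ (2 * k + 1)"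
    unfolding z_def power_mult_distrib by (simp add: power_mult)
  also have "(- \<i>) ^ 2 = (- 1 :: complex)" by simp
  also have "a ^ (4 * j + 3) * b ^ 2 / c ^ (2 * j + 2) = eta_form_zero k \<tau>"
    by (simp only: eta_form_zero_def pow a_def b_def c_def)
  finally show ?thesis by simp
qed

text \<open>The 24th roots of unity cancel completely because the leading exponent of
  \<open>eta_form_zero k\<close> is 0. For the same reason the eta quotient does not vanish at the
  cusp 0.\<close>

lemma eta_form_zero_plus_4:
  assumes "k \<ge> 1"
  shows "eta_form_zero k (\<tau> + 4) = eta_form_zero k \<tau>"
proof -
  define u where "u = qexp (1 / 24)"
  have u0: "u \<noteq> 0" by (simp add: u_def)
  have e: "dedekind_eta ((\<tau> + 4) / 2) = u ^ 2 * dedekind_eta (\<tau> / 2)"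
    "dedekind_eta ((\<tau> + 4) / 4) = u * dedekind_eta (\<tau> / 4)"
    "dedekind_eta (\<tau> + 4) = u ^ 4 * dedekind_eta \<tau>"
    using dedekind_eta_plus_nat[of "\<tau> / 2" 2] dedekind_eta_plus_nat[of "\<tau> / 4" 1] dedekind_eta_plus_nat[of \<tau> 4]
    by (simp_all add: u_def add_divide_distrib)
  have "eta_form_zero k (\<tau> + 4) = (u ^ 2) ^ (8 * k - 2) * u ^ 4 / (u ^ 4) ^ (4 * k) * eta_form_zero k \<tau>"
    unfolding eta_form_zero_def e by (simp add: power_mult_distrib)
  also have "(u ^ 2) ^ (8 * k - 2) * u ^ 4 = (u ^ 4) ^ (4 * k)"
    using assms by (simp only: power_mult[symmetric] power_add[symmetric]) (rule arg_cong[of _ _ "\<lambda>n. u ^ n"], simp)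
  finally show ?thesis using u0 by simp
qed

text \<open>(1 0; 4 1) is the translation by -4 conjugated by the inversion, so invariance comes
  from \<open>eta_form_inversion\<close> and the period 4 of \<open>eta_form_zero k\<close>.\<close>

lemma eta_form_unipotent:
  assumes k: "k \<ge> 1" and \<tau>: "Im \<tau> > 0"
  shows "slash (2 * k + 1) 1 0 4 1 (eta_form k) \<tau> = eta_form k \<tau>"
proof -
  define \<rho> where "\<rho> = - 1 / \<tau> - 4"
  have \<tau>0: "\<tau> \<noteq> 0" "4 * \<tau> + 1 \<noteq> 0" using \<tau> moebius_denom_nonzero[OF \<tau>, of 1 1 0 4] by auto
  have \<rho>: "Im \<rho> > 0" using Im_minus_inverse_pos[OF \<tau>] by (simp add: \<rho>_def)
  have \<rho>\<tau>: "\<rho> = - (4 * \<tau> + 1) / \<tau>" using \<tau>0 by (simp add: \<rho>_def field_simps)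
  have "x / y = - 1 / (- y / x)" for x y :: complex by simp
  hence U: "\<tau> / (4 * \<tau> + 1) = - 1 / \<rho>" unfolding \<rho>\<tau> .
  have inv: "- 1 / (- 1 / \<tau>) = \<tau>" by simp
  define C where "C = (- 1) ^ k * (- \<i>) / 2 ^ (4 * k + 3)"
  have F: "eta_form k \<tau> = C * (- 1 / \<tau>) ^ (2 * k + 1) * eta_form_zero k \<rho>"
    using eta_form_inversion[OF k Im_minus_inverse_pos[OF \<tau>]] eta_form_zero_plus_4[OF k, of \<rho>]
    unfolding inv by (simp add: C_def \<rho>_def)
  have "slash (2 * k + 1) 1 0 4 1 (eta_form k) \<tau> = C * \<rho> ^ (2 * k + 1) * eta_form_zero k \<rho> / (4 * \<tau> + 1) ^ (2 * k + 1)"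
    using eta_form_inversion[OF k \<rho>] U by (simp add: slash_def C_def)
  also have "\<rho> ^ (2 * k + 1) = (- 1 / \<tau>) ^ (2 * k + 1) * (4 * \<tau> + 1) ^ (2 * k + 1)"
    unfolding power_mult_distrib[symmetric] \<rho>\<tau> by (rule arg_cong[of _ _ "\<lambda>x. x ^ (2 * k + 1)"]) (use \<tau>0 in \<open>simp add: field_simps\<close>)
  finally show ?thesis using \<tau>0 by (simp add: F)
qed

lemma dedekind_eta_qexp_power:
  assumes "\<tau> = of_nat n * \<sigma>"
  shows "dedekind_eta \<tau> = qexp (\<sigma> / 24) ^ n * euler_prod (qexp \<tau>)"
  unfolding dedekind_eta_altdef qexp_of_nat_mult[symmetric] using assms by simp

lemma dedekind_eta_multiples:
  "dedekind_eta (2 * \<tau>) = qexp (\<tau> / 24) ^ 2 * euler_prod (qexp (2 * \<tau>))"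
  "dedekind_eta (4 * \<tau>) = qexp (\<tau> / 24) ^ 4 * euler_prod (qexp (4 * \<tau>))"
  "dedekind_eta \<tau> = qexp (\<tau> / 24) * euler_prod (qexp \<tau>)"
  using dedekind_eta_qexp_power[of "2 * \<tau>" 2 \<tau>] dedekind_eta_qexp_power[of "4 * \<tau>" 4 \<tau>]
  by (simp_all add: dedekind_eta_altdef)

text \<open>The fractional powers of q collect to the positive exponent
  \<open>(12 * k + 12) / 24\<close>, and the remaining Euler products tend to 1. The other two cusps
  are treated in the same way.\<close>

lemma eta_form_tendsto_0:
  assumes k: "k \<ge> 1"
  shows "(eta_form k \<longlongrightarrow> 0) at_i_infinity"
proof -
  define P where "P = (\<lambda>\<tau>. euler_prod (qexp (2 * \<tau>)) ^ (8 * k - 2) * euler_prod (qexp (4 * \<tau>)) ^ 4 / euler_prod (qexp \<tau>) ^ (4 * k))"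
  have eq: "eta_form k = (\<lambda>\<tau>. qexp (\<tau> / 24) ^ (12 * k + 12) * P \<tau>)"
  proof
    fix \<tau>
    define u where "u = qexp (\<tau> / 24)"
    have u0: "u \<noteq> 0" by (simp add: u_def)
    note e = dedekind_eta_multiples[of \<tau>, folded u_def]
    have "eta_form k \<tau> = (u ^ 2) ^ (8 * k - 2) * (u ^ 4) ^ 4 / u ^ (4 * k) * P \<tau>"
      unfolding eta_form_def e P_def by (simp add: power_mult_distrib)
    also have "(u ^ 2) ^ (8 * k - 2) * (u ^ 4) ^ 4 = u ^ (12 * k + 12) * u ^ (4 * k)"
      using k by (simp only: power_mult[symmetric] power_add[symmetric]) (rule arg_cong[of _ _ "\<lambda>n. u ^ n"], simp)
    finally show "eta_form k \<tau> = u ^ (12 * k + 12) * P \<tau>" using u0 by simp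
  qed
  have "(P \<longlongrightarrow> 1 ^ (8 * k - 2) * 1 ^ 4 / 1 ^ (4 * k)) at_i_infinity"
    unfolding P_def
    by (intro tendsto_intros tendsto_euler_prod_at_i_infinity[of 1] tendsto_euler_prod_at_i_infinity[of 2] tendsto_euler_prod_at_i_infinity[of 4]) auto
  moreover have "((\<lambda>\<tau>. qexp (\<tau> / 24) ^ (12 * k + 12)) \<longlongrightarrow> 0 ^ (12 * k + 12)) at_i_infinity"
    by (intro tendsto_power tendsto_qexp_at_i_infinity[of "1 / 24"]) auto
  ultimately have "((\<lambda>\<tau>. qexp (\<tau> / 24) ^ (12 * k + 12) * P \<tau>) \<longlongrightarrow> 0 ^ (12 * k + 12) * (1 ^ (8 * k - 2) * 1 ^ 4 / 1 ^ (4 * k))) at_i_infinity"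
    by (intro tendsto_mult)
  thus ?thesis unfolding eq by (simp add: power_0_left)
qed

lemma eta_form_zero_tendsto_1:
  assumes k: "k \<ge> 1"
  shows "(eta_form_zero k \<longlongrightarrow> 1) at_i_infinity"
proof -
  define P where "P = (\<lambda>\<tau>. euler_prod (qexp (\<tau> / 2)) ^ (8 * k - 2) * euler_prod (qexp (\<tau> / 4)) ^ 4 / euler_prod (qexp \<tau>) ^ (4 * k))"
  have eq: "eta_form_zero k = P"
  proof
    fix \<tau>
    define u where "u = qexp (\<tau> / 4 / 24)"
    have u0: "u \<noteq> 0" by (simp add: u_def)
    have e: "dedekind_eta (\<tau> / 2) = u ^ 2 * euler_prod (qexp (\<tau> / 2))"
      "dedekind_eta (\<tau> / 4) = u * euler_prod (qexp (\<tau> / 4))"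
      "dedekind_eta \<tau> = u ^ 4 * euler_prod (qexp \<tau>)"
      using dedekind_eta_qexp_power[of "\<tau> / 2" 2 "\<tau> / 4"] dedekind_eta_qexp_power[of "\<tau> / 4" 1 "\<tau> / 4"] dedekind_eta_qexp_power[of \<tau> 4 "\<tau> / 4"]
      by (simp_all add: u_def)
    have "eta_form_zero k \<tau> = (u ^ 2) ^ (8 * k - 2) * u ^ 4 / (u ^ 4) ^ (4 * k) * P \<tau>"
      unfolding eta_form_zero_def e P_def by (simp add: power_mult_distrib)
    also have "(u ^ 2) ^ (8 * k - 2) * u ^ 4 = (u ^ 4) ^ (4 * k)"
      using k by (simp only: power_mult[symmetric] power_add[symmetric]) (rule arg_cong[of _ _ "\<lambda>n. u ^ n"], simp)
    finally show "eta_form_zero k \<tau> = P \<tau>" using u0 by simp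
  qed
  have "(P \<longlongrightarrow> 1 ^ (8 * k - 2) * 1 ^ 4 / 1 ^ (4 * k)) at_i_infinity"
    unfolding P_def
    by (intro tendsto_intros tendsto_euler_prod_at_i_infinity[of 1] tendsto_euler_prod_at_i_infinity[of "1/2"] tendsto_euler_prod_at_i_infinity[of "1/4"]) auto
  thus ?thesis unfolding eq by simp
qed

text \<open>The leading exponent at this cusp is \<open>k / 2\<close>, positive because
  \<open>k \<ge> 1\<close>.\<close>

lemma eta_form_half_tendsto_0:
  assumes k: "k \<ge> 1"
  shows "(eta_form_half k \<longlongrightarrow> 0) at_i_infinity"
proof -
  define P where "P = (\<lambda>\<tau>. euler_prod (qexp (2 * \<tau>)) ^ (8 * k + 10) / (euler_prod (qexp (4 * \<tau>)) ^ 4 * euler_prod (qexp \<tau>) ^ (4 * k + 4)))"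
  have eq: "eta_form_half k = (\<lambda>\<tau>. qexp (\<tau> / 24) ^ (12 * k) * P \<tau>)"
  proof
    fix \<tau>
    define u where "u = qexp (\<tau> / 24)"
    have u0: "u \<noteq> 0" by (simp add: u_def)
    note e = dedekind_eta_multiples[of \<tau>, folded u_def]
    have "eta_form_half k \<tau> = (u ^ 2) ^ (8 * k + 10) / ((u ^ 4) ^ 4 * u ^ (4 * k + 4)) * P \<tau>"
      unfolding eta_form_half_def e P_def power_mult_distrib by simp
    also have "(u ^ 2) ^ (8 * k + 10) = u ^ (12 * k) * ((u ^ 4) ^ 4 * u ^ (4 * k + 4))"
      by (simp only: power_mult[symmetric] power_add[symmetric]) (rule arg_cong[of _ _ "\<lambda>n. u ^ n"], simp)
    finally show "eta_form_half k \<tau> = u ^ (12 * k) * P \<tau>" using u0 by simp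
  qed
  have "(P \<longlongrightarrow> 1 ^ (8 * k + 10) / (1 ^ 4 * 1 ^ (4 * k + 4))) at_i_infinity"
    unfolding P_def
    by (intro tendsto_intros tendsto_euler_prod_at_i_infinity[of 1] tendsto_euler_prod_at_i_infinity[of 2] tendsto_euler_prod_at_i_infinity[of 4]) auto
  moreover have "((\<lambda>\<tau>. qexp (\<tau> / 24) ^ (12 * k)) \<longlongrightarrow> 0 ^ (12 * k)) at_i_infinity"
    by (intro tendsto_power tendsto_qexp_at_i_infinity[of "1 / 24"]) auto
  ultimately have "((\<lambda>\<tau>. qexp (\<tau> / 24) ^ (12 * k) * P \<tau>) \<longlongrightarrow> 0 ^ (12 * k) * (1 ^ (8 * k + 10) / (1 ^ 4 * 1 ^ (4 * k + 4)))) at_i_infinity"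
    by (intro tendsto_mult)
  thus ?thesis unfolding eq using k by (simp add: power_0_left)
qed

text \<open>Translation by 2 moves \<open>\<sigma> / 4\<close> by 1/2, so
  \<open>dedekind_eta_plus_half\<close> enters before each eta value is inverted. The constant is
  left implicit, since the limit at this cusp is 0.\<close>

lemma eta_form_zero_inversion:
  assumes k: "k \<ge> 1"
  obtains C where "\<And>\<tau>. Im \<tau> > 0 \<Longrightarrow> eta_form_zero k (2 - 1 / \<tau>) = C * \<tau> ^ (2 * k + 1) * eta_form_half k \<tau>"
proof -
  define u v where "u = qexp (1 / 24)" and "v = qexp (1 / 48)"
  define C where "C = u ^ (8 * k - 2) * v ^ 4 / (u ^ 2) ^ (4 * k) * ((- \<i>) ^ (2 * k + 1) * 2 ^ (4 * k + 5) / 16)"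
  have "eta_form_zero k (2 - 1 / \<tau>) = C * \<tau> ^ (2 * k + 1) * eta_form_half k \<tau>" if \<tau>: "Im \<tau> > 0" for \<tau>
  proof -
    define \<sigma> where "\<sigma> = - 1 / \<tau>"
    have \<tau>0: "\<tau> \<noteq> 0" using \<tau> by auto
    have \<sigma>: "Im \<sigma> > 0" using Im_minus_inverse_pos[OF \<tau>] by (simp add: \<sigma>_def)
    define A B E where "A = dedekind_eta (\<sigma> / 2)" and "B = dedekind_eta (\<sigma> / 4)" and "E = dedekind_eta \<sigma>"
    have nz: "A \<noteq> 0" "B \<noteq> 0" "E \<noteq> 0" using \<sigma> by (auto simp: A_def B_def E_def dedekind_eta_nonzero)
    have e1: "dedekind_eta ((2 - 1 / \<tau>) / 2) = u * A"
      using dedekind_eta_plus_nat[of "\<sigma> / 2" 1] by (simp add: u_def A_def \<sigma>_def diff_divide_distrib)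
    have e3: "dedekind_eta (2 - 1 / \<tau>) = u ^ 2 * E"
      using dedekind_eta_plus_nat[of "\<sigma>" 2] by (simp add: u_def E_def \<sigma>_def)
    have "Im (\<sigma> / 4) > 0" using \<sigma> by simp
    from dedekind_eta_plus_half[OF this]
    have "dedekind_eta (\<sigma> / 4 + 1 / 2) = v * A ^ 3 / (B * E)"
      by (simp add: v_def A_def B_def E_def)
    also have "\<sigma> / 4 + 1 / 2 = (2 - 1 / \<tau>) / 4" by (simp add: \<sigma>_def diff_divide_distrib)
    finally have e2: "dedekind_eta ((2 - 1 / \<tau>) / 4) = v * A ^ 3 / (B * E)" .
    define z a b c where "z = - \<i> * \<tau>" and "a = dedekind_eta (2 * \<tau>) ^ 2" and "b = dedekind_eta (4 * \<tau>) ^ 2" and "c = dedekind_eta \<tau> ^ 2"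
    have z0: "z \<noteq> 0" using \<tau>0 by (simp add: z_def)
    have h: "- 1 / (2 * \<tau>) = \<sigma> / 2" "- 1 / (4 * \<tau>) = \<sigma> / 4" by (simp_all add: \<sigma>_def)
    have sq: "A ^ 2 = (2 * z) * a" "B ^ 2 = (4 * z) * b" "E ^ 2 = z * c"
      using dedekind_eta_inversion[of "2 * \<tau>", unfolded h] dedekind_eta_inversion[of "4 * \<tau>", unfolded h]
        dedekind_eta_inversion[OF \<tau>, folded \<sigma>_def] \<tau>
      by (simp_all add: A_def B_def E_def a_def b_def c_def z_def)
    have "eta_form_zero k (2 - 1 / \<tau>) = (u * A) ^ (8 * k - 2) * (v * A ^ 3 / (B * E)) ^ 4 / (u ^ 2 * E) ^ (4 * k)"
      unfolding eta_form_zero_def e1 e2 e3 ..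
    also have "\<dots> = u ^ (8 * k - 2) * v ^ 4 / (u ^ 2) ^ (4 * k) * (A ^ (8 * k - 2) * (A ^ 3) ^ 4 / (B ^ 4 * (E ^ 4 * E ^ (4 * k))))"
      unfolding power_mult_distrib power_divide by (simp add: mult_ac)
    also have "A ^ (8 * k - 2) * (A ^ 3) ^ 4 = (A ^ 2) ^ (4 * k + 5)"
      using k by (simp only: power_mult[symmetric] power_add[symmetric]) (rule arg_cong[of _ _ "\<lambda>n. A ^ n"], simp)
    also have "B ^ 4 = (B ^ 2) ^ 2" by (simp only: power_mult[symmetric]) simp
    also have "E ^ 4 * E ^ (4 * k) = (E ^ 2) ^ (2 * k + 2)"
      by (simp only: power_mult[symmetric] power_add[symmetric]) (rule arg_cong[of _ _ "\<lambda>n. E ^ n"], simp)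
    also have "(A ^ 2) ^ (4 * k + 5) / ((B ^ 2) ^ 2 * (E ^ 2) ^ (2 * k + 2)) =
       (2 ^ (4 * k + 5) / 16) * (z ^ (4 * k + 5) / (z ^ 2 * z ^ (2 * k + 2))) * (a ^ (4 * k + 5) / (b ^ 2 * c ^ (2 * k + 2)))"
      unfolding sq power_mult_distrib by (simp add: mult_ac)
    also have "z ^ (4 * k + 5) = z ^ (2 * k + 1) * (z ^ 2 * z ^ (2 * k + 2))"
      by (simp only: power_add[symmetric]) (rule arg_cong[of _ _ "\<lambda>n. z ^ n"], simp)
    also have "z ^ (2 * k + 1) * (z ^ 2 * z ^ (2 * k + 2)) / (z ^ 2 * z ^ (2 * k + 2)) = (- \<i>) ^ (2 * k + 1) * \<tau> ^ (2 * k + 1)"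
      using z0 unfolding z_def power_mult_distrib by simp
    also have "a ^ (4 * k + 5) / (b ^ 2 * c ^ (2 * k + 2)) = eta_form_half k \<tau>"
    proof -
      have "2 * (4 * k + 5) = 8 * k + 10" "2 * (2 * k + 2) = 4 * k + 4" by simp_all
      thus ?thesis by (simp add: eta_form_half_def a_def b_def c_def power_mult[symmetric] del: power_Suc add_2_eq_Suc' distrib_left_numeral)
    qed
    finally show ?thesis by (simp add: C_def)
  qed
  thus ?thesis using that by blast
qed

lemma eta_form_cusp_half:
  assumes k: "k \<ge> 1"
  shows "(slash (2 * k + 1) (- 1) 0 2 (- 1) (eta_form k) \<longlongrightarrow> 0) at_i_infinity"
proof -
  obtain C where C: "\<And>\<tau>. Im \<tau> > 0 \<Longrightarrow> eta_form_zero k (2 - 1 / \<tau>) = C * \<tau> ^ (2 * k + 1) * eta_form_half k \<tau>"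
    using eta_form_zero_inversion[OF k] by blast
  define C' where "C' = (- 1) ^ k * (- \<i>) / 2 ^ (4 * k + 3)"
  have "slash (2 * k + 1) (- 1) 0 2 (- 1) (eta_form k) \<tau> = (C' * C) * eta_form_half k \<tau>" if \<tau>: "Im \<tau> > 0" for \<tau>
  proof -
    \<comment> \<open>The matrix (-1 0; 2 -1) sends \<tau> to \<open>- 1 / \<rho>\<close>: two
      inversions with a translation by 2 in between.\<close>
    define \<rho> where "\<rho> = 2 - 1 / \<tau>"
    have \<tau>0: "\<tau> \<noteq> 0" "2 * \<tau> - 1 \<noteq> 0" using \<tau> moebius_denom_nonzero[OF \<tau>, of "- 1" "- 1" 0 2] by auto
    have \<rho>: "Im \<rho> > 0" using Im_minus_inverse_pos[OF \<tau>] by (simp add: \<rho>_def)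
    have \<rho>\<tau>: "\<rho> = (2 * \<tau> - 1) / \<tau>" using \<tau>0 by (simp add: \<rho>_def field_simps)
    have V: "- \<tau> / (2 * \<tau> - 1) = - 1 / \<rho>" using \<tau>0 by (simp add: \<rho>\<tau>)
    have "slash (2 * k + 1) (- 1) 0 2 (- 1) (eta_form k) \<tau> = eta_form k (- 1 / \<rho>) / (2 * \<tau> - 1) ^ (2 * k + 1)"
      using V by (simp add: slash_def)
    also have "eta_form k (- 1 / \<rho>) = C' * \<rho> ^ (2 * k + 1) * (C * \<tau> ^ (2 * k + 1) * eta_form_half k \<tau>)"
      using eta_form_inversion[OF k \<rho>] C[OF \<tau>] by (simp add: C'_def \<rho>_def)
    also have "\<rho> ^ (2 * k + 1) = (2 * \<tau> - 1) ^ (2 * k + 1) / \<tau> ^ (2 * k + 1)"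
      unfolding \<rho>\<tau> power_divide ..
    finally show ?thesis using \<tau>0 by simp
  qed
  with eta_form_half_tendsto_0[OF k] show ?thesis by (rule tendsto_0_cmult_at_i_infinity)
qed

lemma eta_form_cusp_zero:
  assumes k: "k \<ge> 1"
  shows "(slash (2 * k + 1) 0 (- 1) 1 0 (eta_form k) \<longlongrightarrow> (- 1) ^ k * (- \<i>) / 2 ^ (4 * k + 3)) at_i_infinity"
proof -
  define C where "C = (- 1) ^ k * (- \<i>) / 2 ^ (4 * k + 3)"
  have eq: "C * eta_form_zero k \<tau> = slash (2 * k + 1) 0 (- 1) 1 0 (eta_form k) \<tau>" if "Im \<tau> > 0" for \<tau>
    using eta_form_inversion[OF k that] that by (auto simp: slash_def C_def)
  have "((\<lambda>\<tau>. C * eta_form_zero k \<tau>) \<longlongrightarrow> C * 1) at_i_infinity"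
    by (intro tendsto_intros eta_form_zero_tendsto_1 k)
  moreover have "\<forall>\<^sub>F \<tau> in at_i_infinity. C * eta_form_zero k \<tau> = slash (2 * k + 1) 0 (- 1) 1 0 (eta_form k) \<tau>"
    using eventually_upper_half_plane by eventually_elim (rule eq)
  ultimately have "(slash (2 * k + 1) 0 (- 1) 1 0 (eta_form k) \<longlongrightarrow> C * 1) at_i_infinity"
    by (rule Lim_transform_eventually)
  thus ?thesis by (simp add: C_def)
qed

subsection \<open>Lattice sums\<close>

text \<open>The sum runs over all pairs; for positive \<open>w\<close> the origin contributes 0
  because its denominator is 0.\<close>

definition lattice_sum :: "nat \<Rightarrow> (int \<Rightarrow> int \<Rightarrow> complex) \<Rightarrow> complex \<Rightarrow> complex" where
  "lattice_sum w \<phi> \<tau> = (\<Sum>\<^sub>\<infinity>(m, n)\<in>UNIV. \<phi> m n / (of_int m * \<tau> + of_int n) ^ w)"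

lemma lattice_sum_term_bound:
  assumes \<tau>: "Im \<tau> > 0" and w: "w \<ge> 3" and \<phi>: "\<And>m n. norm (\<phi> m n) \<le> 1"
  shows "norm (\<phi> m n / (of_int m * \<tau> + of_int n) ^ w) \<le> 8 * lattice_const \<tau> ^ w * (int_weight m * int_weight n)"
proof (cases "m = 0 \<and> n = 0")
  case True
  have "0 \<le> 8 * lattice_const \<tau> ^ w * (int_weight m * int_weight n)"
    using lattice_const_ge_1[OF \<tau>] by (intro mult_nonneg_nonneg) auto
  thus ?thesis using True w by (simp add: power_0_left)
next
  case False
  define K where "K = lattice_const \<tau>"
  have K: "K \<ge> 1" using lattice_const_ge_1[OF \<tau>] by (simp add: K_def)
  define M where "M = max \<bar>real_of_int m\<bar> \<bar>real_of_int n\<bar>"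
  have M: "M \<ge> 1" using False by (auto simp: M_def)
  define z where "z = of_int m * \<tau> + of_int n"
  have b0: "M / K \<le> norm z"
    using lattice_bound[OF \<tau>, where a = "of_int m" and b = "of_int n"] K
    by (auto simp: z_def M_def K_def divide_le_eq mult.commute)
  have "norm (\<phi> m n / z ^ w) = norm (\<phi> m n) * (1 / norm z ^ w)"
    by (simp add: norm_divide norm_power)
  also have "\<dots> \<le> 1 * (1 / (M / K) ^ w)"
  proof (intro mult_mono \<phi> divide_left_mono power_mono b0 mult_pos_pos zero_less_power)
    have "0 < M / K" using M K by simp
    thus "0 < M / K" "0 < norm z" using b0 by linarith+
  qed (use M K in auto)
  also have "\<dots> = K ^ w * (1 / M ^ w)" by (simp add: power_divide)
  also have "\<dots> \<le> K ^ w * (1 / M ^ 3)"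
    using M K w by (intro mult_left_mono divide_left_mono power_increasing) auto
  also have "\<dots> \<le> K ^ w * (8 * (int_weight m * int_weight n))"
    using M K by (intro mult_left_mono inverse_cube_le_int_weight) (auto simp: M_def)
  finally show ?thesis by (simp add: K_def z_def)
qed

lemma has_sum_lattice_sum:
  assumes \<tau>: "Im \<tau> > 0" and w: "w \<ge> 3" and \<phi>: "\<And>m n. norm (\<phi> m n) \<le> 1"
  shows "((\<lambda>(m, n). \<phi> m n / (of_int m * \<tau> + of_int n) ^ w) has_sum lattice_sum w \<phi> \<tau>) (UNIV \<times> UNIV)"
proof -
  have "(\<lambda>x. norm (case x of (m, n) \<Rightarrow> \<phi> m n / (of_int m * \<tau> + of_int n) ^ w)) summable_on UNIV"
  proof (rule Infinite_Sum.abs_summable_on_comparison_test')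
    show "(\<lambda>x. 8 * lattice_const \<tau> ^ w * (case x of (m, n) \<Rightarrow> int_weight m * int_weight n)) summable_on UNIV"
      by (intro summable_on_cmult_right summable_int_weight_product)
  qed (use lattice_sum_term_bound[OF assms] in auto)
  hence "(\<lambda>(m, n). \<phi> m n / (of_int m * \<tau> + of_int n) ^ w) summable_on UNIV"
    by (rule abs_summable_summable)
  thus ?thesis unfolding lattice_sum_def by (simp add: has_sum_infsum)
qed

text \<open>Right multiplication of the row vector (m, n) by the matrix permutes the lattice. The
  action thus moves from \<tau> to the weight, where it appears as the inverse matrix.\<close>

lemma slash_lattice_sum:
  assumes \<tau>: "Im \<tau> > 0" and det: "a * d - b * c = 1"
  shows "slash w a b c d (lattice_sum w \<phi>) \<tau> = lattice_sum w (\<lambda>m n. \<phi> (m * d - n * c) (n * a - m * b)) \<tau>"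
proof -
  define q where "q = of_int c * \<tau> + of_int d"
  have q: "q \<noteq> 0" using moebius_denom_nonzero[OF \<tau> det] by (simp add: q_def)
  have "slash w a b c d (lattice_sum w \<phi>) \<tau> =
    (\<Sum>\<^sub>\<infinity>(m, n)\<in>UNIV. \<phi> m n / (of_int m * ((of_int a * \<tau> + of_int b) / q) + of_int n) ^ w) * (1 / q ^ w)"
    by (simp add: slash_def lattice_sum_def q_def)
  also have "\<dots> = (\<Sum>\<^sub>\<infinity>x\<in>UNIV. (case x of (m, n) \<Rightarrow> \<phi> m n / (of_int m * ((of_int a * \<tau> + of_int b) / q) + of_int n) ^ w) * (1 / q ^ w))"
    by (rule infsum_cmult_left'[symmetric])
  also have "\<dots> = (\<Sum>\<^sub>\<infinity>(m, n)\<in>UNIV. \<phi> (m * d - n * c) (n * a - m * b) / (of_int m * \<tau> + of_int n) ^ w)"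
  proof (rule infsum_reindex_bij_witness[of _ "\<lambda>(m, n). (m * d - n * c, n * a - m * b)" "\<lambda>(m, n). (m * a + n * c, m * b + n * d)"])
    fix x :: "int \<times> int"
    obtain m n where x: "x = (m, n)" by force
    have i1: "(m * a + n * c) * d - (m * b + n * d) * c = m" "(m * b + n * d) * a - (m * a + n * c) * b = n"
      using det by algebra+
    have i2: "(m * d - n * c) * a + (n * a - m * b) * c = m" "(m * d - n * c) * b + (n * a - m * b) * d = n"
      using det by algebra+
    show "(case case x of (m, n) \<Rightarrow> (m * a + n * c, m * b + n * d) of (m, n) \<Rightarrow> (m * d - n * c, n * a - m * b)) = x"
      "(case case x of (m, n) \<Rightarrow> (m * d - n * c, n * a - m * b) of (m, n) \<Rightarrow> (m * a + n * c, m * b + n * d)) = x"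
      using i1 i2 by (simp_all add: x)
    have "of_int (m * a + n * c) * \<tau> + of_int (m * b + n * d) = (of_int m * ((of_int a * \<tau> + of_int b) / q) + of_int n) * q"
      using q by (simp add: field_simps) (simp add: q_def algebra_simps)
    hence "\<phi> m n / (of_int (m * a + n * c) * \<tau> + of_int (m * b + n * d)) ^ w =
      \<phi> m n / (of_int m * ((of_int a * \<tau> + of_int b) / q) + of_int n) ^ w * (1 / q ^ w)"
      by (simp only: power_mult_distrib) simp
    thus "(case case x of (m, n) \<Rightarrow> (m * a + n * c, m * b + n * d) of
       (m, n) \<Rightarrow> \<phi> (m * d - n * c) (n * a - m * b) / (of_int m * \<tau> + of_int n) ^ w) =
       (case x of (m, n) \<Rightarrow> \<phi> m n / (of_int m * ((of_int a * \<tau> + of_int b) / q) + of_int n) ^ w) * (1 / q ^ w)"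
      using i1 by (simp add: x)
  qed auto
  finally show ?thesis by (simp add: lattice_sum_def)
qed

text \<open>The imaginary part of the lattice point is \<open>m * Im \<tau>\<close>, and its real
  part is within 1 of the shifted index. So Re \<tau> enters only through the shift. The constant 6
  is 2 from \<open>1 + \<bar>m\<bar>\<close> times 3 from one plus the shifted index.\<close>

lemma lattice_row_bound:
  assumes \<tau>: "Im \<tau> \<ge> 1" and m: "m \<noteq> 0" and w: "w \<ge> 3"
  shows "1 / norm (of_int m * \<tau> + of_int n) ^ w \<le>
           6 powr (3 / 2) * Im \<tau> powr (- 3 / 2) * (int_weight m * int_weight (n + \<lfloor>of_int m * Re \<tau>\<rfloor>))"
proof -
  define z where "z = of_int m * \<tau> + of_int n"
  define y where "y = Im \<tau>"
  define j where "j = n + \<lfloor>of_int m * Re \<tau>\<rfloor>"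
  have y: "y \<ge> 1" using \<tau> by (simp add: y_def)
  have m1: "\<bar>real_of_int m\<bar> \<ge> 1" using m by linarith
  have "\<bar>real_of_int m\<bar> * y = \<bar>Im z\<bar>" using y by (simp add: z_def y_def abs_mult)
  also have "\<dots> \<le> norm z" by (rule abs_Im_le_cmod)
  finally have im: "\<bar>real_of_int m\<bar> * y \<le> norm z" .
  have z1: "norm z \<ge> 1" using mult_mono[OF m1 y] im by simp
  have "\<bar>real_of_int j\<bar> - 1 \<le> \<bar>Re z\<bar>" unfolding z_def j_def by simp linarith
  also have "\<dots> \<le> norm z" by (rule abs_Re_le_cmod)
  finally have re: "\<bar>real_of_int j\<bar> \<le> norm z + 1" by simp
  have "1 / norm z ^ w \<le> 1 / norm z ^ 3"
    using z1 w by (intro divide_left_mono power_increasing mult_pos_pos zero_less_power) auto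
  also have "\<dots> \<le> 6 powr (3 / 2) * (y * ((1 + \<bar>of_int m\<bar>) * (1 + \<bar>of_int j\<bar>))) powr (- 3 / 2)"
  proof (rule powr_three_halves_le)
    have "(1 + \<bar>real_of_int m\<bar>) * y \<le> (2 * \<bar>real_of_int m\<bar>) * y"
      using m1 y by (intro mult_right_mono) auto
    also have "\<dots> \<le> 2 * norm z" using im by simp
    finally have "(1 + \<bar>real_of_int m\<bar>) * y \<le> 2 * norm z" .
    hence "((1 + \<bar>real_of_int m\<bar>) * y) * (1 + \<bar>real_of_int j\<bar>) \<le> (2 * norm z) * (3 * norm z)"
      by (rule mult_mono) (use re z1 in auto)
    thus "y * ((1 + \<bar>of_int m\<bar>) * (1 + \<bar>of_int j\<bar>)) \<le> 6 * (norm z)\<^sup>2"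
      by (simp add: power2_eq_square mult_ac)
    show "0 < y * ((1 + \<bar>real_of_int m\<bar>) * (1 + \<bar>real_of_int j\<bar>))"
      using y by (intro mult_pos_pos) auto
  qed (use z1 in auto)
  also have "\<dots> = 6 powr (3 / 2) * y powr (- 3 / 2) * (int_weight m * int_weight j)"
    using y by (simp add: int_weight_def powr_mult)
  finally show ?thesis by (simp add: z_def y_def j_def)
qed

text \<open>Only the row \<open>m = 0\<close> survives at the cusp. Shifting \<open>n\<close> by \<open>\<lfloor>m Re \<tau>\<rfloor>\<close> makes the bound
  on the other rows uniform in \<open>Re \<tau>\<close>.\<close>

lemma lattice_sum_tendsto:
  assumes w: "w \<ge> 3" and \<phi>: "\<And>m n. norm (\<phi> m n) \<le> 1"
    and L: "((\<lambda>n. \<phi> 0 n / of_int n ^ w) has_sum L) UNIV"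
  shows "(lattice_sum w \<phi> \<longlongrightarrow> L) at_i_infinity"
proof -
  define W where "W = infsum int_weight UNIV"
  define C where "C = 6 powr (3 / 2 :: real)"
  have bound: "norm (lattice_sum w \<phi> \<tau> - L) \<le> C * W\<^sup>2 * Im \<tau> powr (- 3 / 2)" if \<tau>: "Im \<tau> \<ge> 1" for \<tau>
  proof -
    define f where "f = (\<lambda>(m, n). \<phi> m n / (of_int m * \<tau> + of_int n) ^ w)"
    have f: "(f has_sum lattice_sum w \<phi> \<tau>) UNIV"
      using has_sum_lattice_sum[of \<tau> w \<phi>] assms that by (simp add: f_def)
    have "(f has_sum L) ((\<lambda>n. (0, n)) ` UNIV)"
      by (subst has_sum_reindex) (use L in \<open>auto simp: inj_on_def o_def f_def\<close>)
    moreover have "((\<lambda>x. if fst x = 0 then f x else 0) has_sum L) UNIV \<longleftrightarrow> (f has_sum L) ((\<lambda>n. (0, n)) ` UNIV)"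
      by (rule has_sum_cong_neutral) (auto simp: image_iff)
    ultimately have f0: "((\<lambda>x. if fst x = 0 then f x else 0) has_sum L) UNIV" by blast
    have diff: "((\<lambda>x. f x - (if fst x = 0 then f x else 0)) has_sum (lattice_sum w \<phi> \<tau> - L)) (UNIV \<times> UNIV)"
      using has_sum_minus[OF f f0] by simp
    have g: "((\<lambda>x. C * Im \<tau> powr (- 3 / 2) * (case x of (m, n) \<Rightarrow> int_weight m * int_weight (n + \<lfloor>of_int m * Re \<tau>\<rfloor>))) has_sum
            (C * Im \<tau> powr (- 3 / 2) * W\<^sup>2)) (UNIV \<times> UNIV)"
      unfolding W_def by (intro has_sum_cmult_right has_sum_int_weight_product)
    have "norm (lattice_sum w \<phi> \<tau> - L) \<le> C * Im \<tau> powr (- 3 / 2) * W\<^sup>2"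
    proof (rule norm_infsum_le[OF diff g])
      fix x :: "int \<times> int"
      obtain m n where x: "x = (m, n)" by force
      show "norm (f x - (if fst x = 0 then f x else 0)) \<le>
         C * Im \<tau> powr (- 3 / 2) * (case x of (m, n) \<Rightarrow> int_weight m * int_weight (n + \<lfloor>of_int m * Re \<tau>\<rfloor>))"
      proof (cases "m = 0")
        case True
        thus ?thesis by (simp add: x C_def)
      next
        case False
        have "norm (f x) \<le> 1 / norm (of_int m * \<tau> + of_int n) ^ w"
          using \<phi>[of m n] by (simp add: f_def x norm_divide norm_power divide_right_mono)
        also have "\<dots> \<le> C * Im \<tau> powr (- 3 / 2) * (int_weight m * int_weight (n + \<lfloor>of_int m * Re \<tau>\<rfloor>))"
          unfolding C_def by (rule lattice_row_bound[OF \<tau> False w])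
        finally show ?thesis using False by (simp add: x)
      qed
    qed
    thus ?thesis by (simp add: mult_ac)
  qed
  have "((\<lambda>\<tau>. Im \<tau> powr (- 3 / 2)) \<longlongrightarrow> 0) at_i_infinity"
    by (rule filterlim_compose[OF _ filterlim_Im_at_i_infinity]) (rule tendsto_neg_powr[OF _ filterlim_ident], simp)
  hence "((\<lambda>\<tau>. C * W\<^sup>2 * Im \<tau> powr (- 3 / 2)) \<longlongrightarrow> 0) at_i_infinity"
    by (rule tendsto_mult_right_zero)
  moreover have "\<forall>\<^sub>F \<tau> in at_i_infinity. norm (lattice_sum w \<phi> \<tau> - L) \<le> C * W\<^sup>2 * Im \<tau> powr (- 3 / 2)"
    unfolding at_i_infinity_def
    by (rule eventually_filtercomapI[OF eventually_ge_at_top[of 1], THEN eventually_mono]) (rule bound)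
  ultimately have "((\<lambda>\<tau>. lattice_sum w \<phi> \<tau> - L) \<longlongrightarrow> 0) at_i_infinity"
    by (rule Lim_null_comparison[rotated])
  thus ?thesis by (simp add: LIM_zero_iff)
qed

subsection \<open>Divisor sums and Euler numbers\<close>

lemma has_sum_divisor_pairs:
  fixes g :: "nat \<Rightarrow> nat \<Rightarrow> complex"
  assumes "((\<lambda>(d, m). g (Suc d) (Suc m)) has_sum S) (UNIV \<times> UNIV)"
  shows "((\<lambda>n. \<Sum>d | d dvd Suc n. g d (Suc n div d)) has_sum S) UNIV"
proof -
  have "((\<lambda>(n, d). g d (n div d)) has_sum S) (Sigma {1..} (\<lambda>n. {d. d dvd n}))"
    using assms
    by (subst has_sum_reindex_bij_witness[of _ "\<lambda>(d, m). (Suc m * Suc d, Suc d)" "\<lambda>(n, d). (d - 1, n div d - 1)" "UNIV \<times> UNIV"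
          "\<lambda>(d, m). g (Suc d) (Suc m)" "\<lambda>(n, d). g d (n div d)" S S])
       (auto simp: dvd_def Suc_le_eq simp del: mult_Suc mult_Suc_right)
  hence "((\<lambda>n. \<Sum>d | d dvd n. g d (n div d)) has_sum S) {1..}"
    by (rule has_sum_SigmaD) (auto intro!: has_sum_finiteI)
  thus ?thesis
    by (subst has_sum_reindex_bij_witness[of UNIV "\<lambda>n. n - 1" Suc "{1..}" "\<lambda>n. \<Sum>d | d dvd n. g d (n div d)" _ S S]) auto
qed

definition divisor_coeff :: "(nat \<Rightarrow> complex) \<Rightarrow> nat \<Rightarrow> nat \<Rightarrow> complex" where
  "divisor_coeff p k n = (\<Sum>d | d dvd n. chi_m4 (int (n div d)) * (p d * of_nat d ^ k))"

lemma norm_chi_m4_le: "norm (chi_m4 n) \<le> 1"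
  by (simp add: chi_m4_def)

definition twisted_qexp_sum :: "(nat \<Rightarrow> complex) \<Rightarrow> nat \<Rightarrow> complex \<Rightarrow> complex" where
  "twisted_qexp_sum p k z = (\<Sum>n. p (Suc n) * (of_nat (Suc n) ^ k * qexp (of_nat (Suc n) * z)))"

lemma has_sum_twisted_qexp_sum:
  assumes "Im z > 0" "\<And>d. norm (p d) \<le> 1"
  shows "((\<lambda>n. p (Suc n) * (of_nat (Suc n) ^ k * qexp (of_nat (Suc n) * z))) has_sum twisted_qexp_sum p k z) UNIV"
proof -
  have sm: "summable (\<lambda>n. norm (p (Suc n) * (of_nat (Suc n) ^ k * qexp (of_nat (Suc n) * z))))"
  proof (rule summable_comparison_test'[OF summable_norm_power_qexp[OF assms(1), of k]])
    fix n
    have "norm (p (Suc n) * y) \<le> norm y" for y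
      using mult_right_mono[OF assms(2)[of "Suc n"] norm_ge_zero[of y]] by (simp add: norm_mult)
    thus "norm (norm (p (Suc n) * (of_nat (Suc n) ^ k * qexp (of_nat (Suc n) * z)))) \<le>
        norm (of_nat (Suc n) ^ k * qexp (of_nat (Suc n) * z))" by simp
  qed
  show ?thesis unfolding twisted_qexp_sum_def
    by (rule norm_summable_imp_has_sum[OF sm summable_sums[OF summable_norm_cancel[OF sm]]])
qed

definition divisor_series :: "(nat \<Rightarrow> complex) \<Rightarrow> nat \<Rightarrow> complex \<Rightarrow> complex" where
  "divisor_series p k \<tau> = (\<Sum>n. divisor_coeff p k (Suc n) * qexp (of_nat (Suc n) * \<tau>))"

text \<open>One absolutely convergent double series over (d, m) in two groupings: by the product
  \<open>m * d\<close> it is the q-expansion, and with \<open>d\<close> inside it is the series over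
  \<open>m\<close> that is to be matched with the rows of a lattice sum.\<close>

lemma has_sum_divisor_series:
  assumes "Im \<tau> > 0" "\<And>d. norm (p d) \<le> 1"
  shows "((\<lambda>n. divisor_coeff p k (Suc n) * qexp (of_nat (Suc n) * \<tau>)) has_sum divisor_series p k \<tau>) UNIV"
    and "((\<lambda>m. chi_m4 (int (Suc m)) * twisted_qexp_sum p k (of_nat (Suc m) * \<tau>)) has_sum divisor_series p k \<tau>) UNIV"
proof -
  define g where "g = (\<lambda>d m. chi_m4 (int m) * (p d * (of_nat d ^ k * qexp (of_nat (m * d) * \<tau>))))"
  obtain S where S: "((\<lambda>(d, m). g (Suc d) (Suc m)) has_sum S) (UNIV \<times> UNIV)"
    using summable_lambert[OF assms(1), of "\<lambda>m. chi_m4 (int (Suc m))" 1 "\<lambda>n. p (Suc n)" k] norm_chi_m4_le assms(2)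
    unfolding g_def by (auto simp: summable_on_def)
  have "((\<lambda>n. \<Sum>d | d dvd Suc n. g d (Suc n div d)) has_sum S) UNIV"
    by (rule has_sum_divisor_pairs[OF S])
  moreover have "(\<Sum>d | d dvd Suc n. g d (Suc n div d)) = divisor_coeff p k (Suc n) * qexp (of_nat (Suc n) * \<tau>)" for n
    unfolding divisor_coeff_def sum_distrib_right
  proof (rule sum.cong[OF refl])
    fix d assume "d \<in> {d. d dvd Suc n}"
    hence "Suc n div d * d = Suc n" by simp
    thus "g d (Suc n div d) = chi_m4 (int (Suc n div d)) * (p d * of_nat d ^ k) * qexp (of_nat (Suc n) * \<tau>)"
      unfolding g_def by (simp only: mult.assoc)
  qed
  ultimately have 1: "((\<lambda>n. divisor_coeff p k (Suc n) * qexp (of_nat (Suc n) * \<tau>)) has_sum S) UNIV" by simp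
  have "((\<lambda>(m, d). g (Suc d) (Suc m)) has_sum S) (UNIV \<times> UNIV)"
    using S by (subst (asm) has_sum_swap) simp
  hence 2: "((\<lambda>m. chi_m4 (int (Suc m)) * twisted_qexp_sum p k (of_nat (Suc m) * \<tau>)) has_sum S) UNIV"
  proof (rule has_sum_SigmaD)
    fix m
    have "Im (of_nat (Suc m) * \<tau>) > 0" using assms(1) by simp
    from has_sum_cmult_right[OF has_sum_twisted_qexp_sum[of _ p k, OF this assms(2)], of "chi_m4 (int (Suc m))"]
    show "((\<lambda>d. case (m, d) of (m, d) \<Rightarrow> g (Suc d) (Suc m)) has_sum
        chi_m4 (int (Suc m)) * twisted_qexp_sum p k (of_nat (Suc m) * \<tau>)) UNIV"
      by (simp only: prod.case g_def of_nat_mult mult.assoc mult.left_commute)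
  qed
  have "S = divisor_series p k \<tau>"
    unfolding divisor_series_def using sums_unique[OF has_sum_imp_sums[OF 1]] .
  with 1 2 show "((\<lambda>n. divisor_coeff p k (Suc n) * qexp (of_nat (Suc n) * \<tau>)) has_sum divisor_series p k \<tau>) UNIV"
    "((\<lambda>m. chi_m4 (int (Suc m)) * twisted_qexp_sum p k (of_nat (Suc m) * \<tau>)) has_sum divisor_series p k \<tau>) UNIV"
    by simp_all
qed

text \<open>It is a power series in \<open>qexp \<tau>\<close>. One factor
  \<open>qexp \<tau>\<close> is split off because the sum starts with exponent 1.\<close>

lemma divisor_series_holomorphic:
  assumes "\<And>d. norm (p d) \<le> 1"
  shows "divisor_series p k holomorphic_on \<H>"
proof -
  define P where "P = (\<lambda>x. \<Sum>n. divisor_coeff p k (Suc n) * x ^ n)"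
  have "(\<lambda>n. divisor_coeff p k (Suc n) * (x - 0) ^ n) sums P x" if x: "x \<in> ball 0 1" for x
  proof (cases "x = 0")
    case True
    thus ?thesis by (simp add: P_def powser_sums_zero)
  next
    case False
    \<comment> \<open>Every nonzero point of the unit disc is \<open>qexp\<close> of a point of the
      upper half-plane, where convergence is already known.\<close>
    define \<tau> where "\<tau> = Ln x / (2 * of_real pi * \<i>)"
    have "qexp \<tau> = x" using False by (simp add: qexp_def \<tau>_def)
    moreover have "Im \<tau> > 0"
    proof -
      have "exp (- 2 * pi * Im \<tau>) < 1" using x \<open>qexp \<tau> = x\<close> norm_qexp[of \<tau>] by simp
      hence "- 2 * pi * Im \<tau> < 0" by (simp only: exp_less_one_iff)
      thus ?thesis by (simp add: zero_less_mult_iff)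
    qed
    from has_sum_imp_sums[OF has_sum_divisor_series(1)[of \<tau> p k, OF this assms]]
    have "summable (\<lambda>n. divisor_coeff p k (Suc n) * qexp \<tau> ^ Suc n)"
      unfolding qexp_of_nat_mult by (rule sums_summable)
    hence "summable (\<lambda>n. divisor_coeff p k (Suc n) * qexp \<tau> ^ Suc n * inverse x)" by (rule summable_mult2)
    ultimately have "summable (\<lambda>n. divisor_coeff p k (Suc n) * x ^ n)"
      using False by (simp add: field_simps)
    thus ?thesis by (simp add: P_def summable_sums)
  qed
  hence P: "P holomorphic_on ball 0 1" by (rule power_series_holomorphic)
  have "(\<lambda>\<tau>. qexp \<tau> * (P \<circ> qexp) \<tau>) holomorphic_on \<H>"
    by (intro holomorphic_on_mult holomorphic_on_compose_gen[OF _ P])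
       (auto simp: qexp_def[abs_def] norm_qexp_less_1[unfolded qexp_def] intro!: holomorphic_intros)
  moreover have "qexp \<tau> * (P \<circ> qexp) \<tau> = divisor_series p k \<tau>" if "\<tau> \<in> \<H>" for \<tau>
  proof -
    have "summable (\<lambda>n. divisor_coeff p k (Suc n) * qexp \<tau> ^ Suc n)"
      using sums_summable[OF has_sum_imp_sums[OF has_sum_divisor_series(1)[of \<tau> p k]]] assms that
      by (simp only: qexp_of_nat_mult in_upper_half_plane)
    hence "summable (\<lambda>n. divisor_coeff p k (Suc n) * qexp \<tau> ^ Suc n * inverse (qexp \<tau>))" by (rule summable_mult2)
    hence "summable (\<lambda>n. divisor_coeff p k (Suc n) * qexp \<tau> ^ n)" by (simp add: field_simps)
    hence "qexp \<tau> * P (qexp \<tau>) = (\<Sum>n. qexp \<tau> * (divisor_coeff p k (Suc n) * qexp \<tau> ^ n))"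
      unfolding P_def by (rule suminf_mult[symmetric])
    thus ?thesis unfolding divisor_series_def qexp_of_nat_mult by (simp only: o_def power_Suc mult_ac)
  qed
  ultimately show ?thesis by (rule holomorphic_transform)
qed

section \<open>Principal characters and the coefficients of the Eisenstein series\<close>

lemma dirichlet_char_1_iff: "dirichlet_char 1 \<phi> \<longleftrightarrow> \<phi> = (\<lambda>_. 1)"
proof
  assume *: "dirichlet_char 1 \<phi>"
  show "\<phi> = (\<lambda>_. 1)"
  proof
    fix a
    have step: "\<phi> (b + 1) = \<phi> b" for b using * by (simp add: dirichlet_char_def)
    have "\<phi> a = \<phi> 0"
    proof (induction a rule: int_induct[of _ 0])
      case (step2 i)
      thus ?case using step[of "i - 1"] by simp
    qed (auto simp: step)
    moreover have "\<phi> (0 * 0) = \<phi> 0 * \<phi> 0" using * unfolding dirichlet_char_def by blast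
    moreover have "\<phi> 0 \<noteq> 0" using * by (simp add: dirichlet_char_def)
    ultimately show "\<phi> a = 1" by simp
  qed
qed (simp add: dirichlet_char_def)

text \<open>The only character of modulus 1 is the constant 1. This uniqueness gives the description
  in \<open>primitive_char\<close> a definite value.\<close>

lemma induced_by_principal_char:
  "R > 0 \<Longrightarrow> induced_by R (principal_char R) 1 \<phi> \<longleftrightarrow> \<phi> = (\<lambda>_. 1)"
  by (auto simp: induced_by_def dirichlet_char_1_iff principal_char_def simp del: One_nat_def)

lemma conductor_principal_char:
  assumes "R > 0"
  shows "conductor R (principal_char R) = 1"
  unfolding conductor_def
proof (rule Least_equality)
  show "\<exists>\<phi>. induced_by R (principal_char R) 1 \<phi>"
    using induced_by_principal_char[OF assms] by blast
next
  fix r assume "\<exists>\<phi>. induced_by R (principal_char R) r \<phi>"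
  hence "r dvd R" by (auto simp: induced_by_def)
  thus "1 \<le> r" using assms by (cases r) auto
qed

lemma primitive_char_principal_char:
  assumes "R > 0"
  shows "primitive_char R (principal_char R) = (\<lambda>_. 1)"
  unfolding primitive_char_def conductor_principal_char[OF assms] induced_by_principal_char[OF assms]
  by simp

lemma moebius_1: "moebius 1 = 1" and moebius_2: "moebius 2 = - 1"
  by (simp_all add: moebius_def prime_factorization_prime squarefree_prime)

lemma eisenstein_coeff_principal_1:
  "eisenstein_coeff (Suc k) chi_m4 1 (principal_char 1) n = divisor_coeff (\<lambda>_. 1) k n"
proof -
  have 1: "{c. c dvd gcd (1::nat) d} = {1}" for d by auto
  show ?thesis
    unfolding eisenstein_coeff_def divisor_coeff_def Let_def conductor_principal_char[OF zero_less_one] div_by_1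
      primitive_char_principal_char[OF zero_less_one] 1
    by (simp add: moebius_1 del: One_nat_def)
qed

text \<open>With \<ell> = 2 the inner sum is -1 for odd \<open>d\<close>, where only
  \<open>c = 1\<close> divides, and -1 + 2 for even \<open>d\<close>. So modulus 2 amounts to the
  sign \<open>(- 1) ^ d\<close>.\<close>

lemma eisenstein_coeff_principal_2:
  "eisenstein_coeff (Suc k) chi_m4 2 (principal_char 2) n = divisor_coeff (\<lambda>d. (- 1) ^ d) k n"
proof -
  have "(\<Sum>c | c dvd gcd 2 d. of_nat c * of_int (moebius (2 div c))) = ((- 1) ^ d :: complex)" for d
  proof (cases "even d")
    case True
    hence "gcd 2 d = 2" by (simp add: gcd_nat.absorb1)
    moreover have "{c. c dvd (2::nat)} = {1, 2}"
    proof -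
      have "c = 1 \<or> c = 2" if "c dvd 2" for c :: nat
        using that two_is_prime_nat by (metis prime_nat_iff)
      thus ?thesis by auto
    qed
    ultimately show ?thesis using True by (simp add: moebius_1 moebius_2 del: One_nat_def)
  next
    case False
    hence "gcd 2 d = 1" by (simp add: coprime_iff_gcd_eq_1[symmetric])
    moreover have "{c. c dvd (1::nat)} = {1}" by auto
    ultimately show ?thesis using False by (simp add: moebius_2 del: One_nat_def)
  qed
  thus ?thesis
    by (simp add: eisenstein_coeff_def divisor_coeff_def conductor_principal_char primitive_char_principal_char Let_def mult_ac)
qed

lemma eisenstein_principal_1:
  "eisenstein (Suc k) chi_m4 1 (principal_char 1) \<tau> = divisor_series (\<lambda>_. 1) k \<tau>"
  unfolding eisenstein_def divisor_series_def eisenstein_coeff_principal_1 qexp_def by (simp add: mult_ac)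

lemma eisenstein_principal_2:
  "eisenstein (Suc k) chi_m4 2 (principal_char 2) \<tau> = divisor_series (\<lambda>d. (- 1) ^ d) k (\<tau> / 2)"
  unfolding eisenstein_def divisor_series_def eisenstein_coeff_principal_2 qexp_def by (simp add: mult_ac)

section \<open>The series at 1/4 and the Euler numbers\<close>

lemma sin_pi_nonzero:
  assumes "(z :: complex) \<notin> \<int>"
  shows "sin (of_real pi * z) \<noteq> 0"
proof -
  have "z \<notin> \<int>\<^sub>\<le>\<^sub>0" "1 - z \<notin> \<int>\<^sub>\<le>\<^sub>0"
    using assms nonpos_Ints_subset_Ints Ints_diff[of 1 "1 - z"] by auto
  hence "rGamma z * rGamma (1 - z) \<noteq> 0" by (auto simp: rGamma_eq_zero_iff)
  thus ?thesis by (simp add: rGamma_reflection_complex)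
qed

text \<open>The even part of \<open>\<pi> cot \<pi>(1/4 + x)\<close> is \<open>\<pi> sec 2\<pi>x\<close>, whose Taylor coefficients are
  the Euler numbers.\<close>

lemma cot_quarter_even_part:
  assumes "x + 1 / 4 \<notin> \<int>" "- x + 1 / 4 \<notin> (\<int> :: complex set)"
  shows "int_shift_sum 1 (x + 1 / 4) + int_shift_sum 1 (- x + 1 / 4) = 2 * of_real pi / cos (2 * (of_real pi * x))"
proof -
  define S C r where "S = sin (complex_of_real pi * x)" and "C = cos (complex_of_real pi * x)" and "r = complex_of_real (sqrt 2 / 2)"
  have r: "r \<noteq> 0" by (simp add: r_def)
  have trig: "sin (of_real pi / 4) = r" "cos (of_real pi / 4) = r"
  proof -
    have "complex_of_real pi / 4 = of_real (pi / 4)" by simp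
    thus "sin (of_real pi / 4) = r" "cos (of_real pi / 4) = r"
      by (simp_all only: sin_of_real cos_of_real sin_45 cos_45 r_def)
  qed
  have e: "of_real pi * (x + 1 / 4) = of_real pi * x + of_real pi / 4"
    "of_real pi * (- x + 1 / 4) = of_real pi / 4 - of_real pi * x" by (simp_all add: algebra_simps)
  have s1: "sin (of_real pi * (x + 1 / 4)) = r * (C + S)" "cos (of_real pi * (x + 1 / 4)) = r * (C - S)"
    unfolding e sin_add cos_add trig by (simp_all add: S_def C_def algebra_simps)
  have s2: "sin (of_real pi * (- x + 1 / 4)) = r * (C - S)" "cos (of_real pi * (- x + 1 / 4)) = r * (C + S)"
    unfolding e sin_diff cos_diff trig by (simp_all add: S_def C_def algebra_simps)
  have nz: "C + S \<noteq> 0" "C - S \<noteq> 0"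
    using sin_pi_nonzero[OF assms(1)] sin_pi_nonzero[OF assms(2)] s1 s2 by auto
  have c: "cot (of_real pi * (x + 1 / 4)) = (C - S) / (C + S)" "cot (of_real pi * (- x + 1 / 4)) = (C + S) / (C - S)"
    unfolding cot_def s1 s2 using r by simp_all
  have "(C - S) / (C + S) + (C + S) / (C - S) = 2 * (C\<^sup>2 + S\<^sup>2) / ((C - S) * (C + S))"
    using nz by (simp add: divide_simps) (simp add: power2_eq_square algebra_simps)
  also have "C\<^sup>2 + S\<^sup>2 = 1" by (simp add: C_def S_def)
  also have "(C - S) * (C + S) = cos (2 * (of_real pi * x))"
    unfolding cos_double C_def S_def by (simp add: power2_eq_square algebra_simps)
  finally show ?thesis
    unfolding int_shift_sum_1[OF assms(1)] int_shift_sum_1[OF assms(2)] c distrib_left[symmetric] by simp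
qed

text \<open>Compares the derivatives of order \<open>2 * k\<close> at 0 in
  \<open>cot_quarter_even_part\<close>. The order is even, so both cotangents contribute equally;
  the right side is \<open>s\<close>, the hyperbolic secant, at
  \<open>2 * pi * \<i> * x\<close>.\<close>

lemma int_shift_sum_quarter:
  "int_shift_sum (2 * k + 1) (1 / 4) = of_real pi * (2 * of_real pi * \<i>) ^ (2 * k) * euler_number (2 * k) / fact (2 * k)"
proof -
  define s where "s = (\<lambda>y::complex. 2 * inverse (exp y + exp (- y)))"
  define F where "F = (2 * inverse (fps_exp 1 + fps_exp (- 1)) :: complex fps)"
  define c where "c = 2 * complex_of_real pi * \<i>"
  have "s has_fps_expansion F"
    unfolding s_def F_def by (intro fps_expansion_intros) auto
  hence s0: "(deriv ^^ n) s 0 = fact n * fps_nth F n" for n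
    by (simp add: fps_nth_fps_expansion)
  have F: "F = 2 / (fps_exp 1 + fps_exp (- 1))"
    unfolding F_def by (subst fps_divide_unit) auto
  have sE: "(deriv ^^ n) s 0 = euler_number n" for n
    unfolding s0 F euler_number_def ..
  define T where "T = {y::complex. exp y + exp (- y) \<noteq> 0}"
  have T: "open T" unfolding T_def by (intro open_Collect_neq continuous_intros)
  have sT: "s holomorphic_on T" unfolding s_def T_def by (auto intro!: holomorphic_intros)
  have Z: "open (- \<int> :: complex set)" by (simp add: open_Compl)
  have hZ: "int_shift_sum 1 holomorphic_on - \<int>"
    unfolding holomorphic_on_def field_differentiable_def
    using has_field_derivative_int_shift_sum[of 1] has_field_derivative_at_within by blast
  \<comment> \<open>An open neighbourhood of 0 on which all three compositions are
    holomorphic.\<close>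
  define U where "U = (\<lambda>x. 1 * x + 1 / 4) -` (- \<int>) \<inter> (\<lambda>x. (- 1) * x + 1 / 4) -` (- \<int>) \<inter> (\<lambda>x::complex. c * x) -` T"
  have U: "open U" unfolding U_def
    by (intro open_Int continuous_open_vimage Z T continuous_intros)
  have "(1 / 4 :: complex) \<notin> \<int>"
  proof
    assume "(1 / 4 :: complex) \<in> \<int>"
    then obtain n where n: "(1 / 4 :: complex) = of_int n" by (auto elim: Ints_cases)
    hence "(of_int (4 * n) :: complex) = of_int 1" by (simp flip: n)
    hence "4 * n = 1" by (simp only: of_int_eq_iff)
    thus False by presburger
  qed
  hence U0: "0 \<in> U" by (simp add: U_def T_def)
  define f1 f2 where "f1 = (\<lambda>x. int_shift_sum 1 (1 * x + 1 / 4))" and "f2 = (\<lambda>x. int_shift_sum 1 ((- 1) * x + 1 / 4))"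
  have hol: "f1 holomorphic_on U" "f2 holomorphic_on U" "(\<lambda>x. s (c * x)) holomorphic_on U"
    unfolding f1_def f2_def
    by (rule holomorphic_on_compose_gen[OF _ hZ, unfolded o_def] holomorphic_on_compose_gen[OF _ sT, unfolded o_def];
        force simp: U_def intro!: holomorphic_intros)+
  have eq: "f1 x + f2 x = (2 * of_real pi) * s (c * x)" if "x \<in> U" for x
  proof -
    have "cos (2 * (of_real pi * x)) = (exp (c * x) + exp (- (c * x))) / 2"
      by (simp add: cos_exp_eq c_def mult_ac)
    moreover have "f1 x + f2 x = 2 * of_real pi / cos (2 * (of_real pi * x))"
      using cot_quarter_even_part[of x] that by (simp add: f1_def f2_def U_def del: One_nat_def)
    ultimately have "f1 x + f2 x = 2 * of_real pi / ((exp (c * x) + exp (- (c * x))) / 2)" by (simp only:)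
    moreover have "a / (G / 2) = a * (2 * inverse G)" for a G :: complex by (simp add: field_simps)
    ultimately show ?thesis unfolding s_def by (simp only:)
  qed
  define n where "n = 2 * k"
  have "(deriv ^^ n) (\<lambda>x. f1 x + f2 x) 0 = (deriv ^^ n) (\<lambda>x. (2 * of_real pi) * s (c * x)) 0"
    by (rule higher_deriv_transform_within_open[OF _ _ U U0 eq]) (intro holomorphic_intros hol)+
  also have "\<dots> = (2 * of_real pi) * (deriv ^^ n) (\<lambda>x. s (c * x)) 0"
    by (rule higher_deriv_cmult[OF hol(3) U0 U])
  also have "(deriv ^^ n) (\<lambda>x. s (c * x)) 0 = c ^ n * (deriv ^^ n) s (c * 0)"
    by (rule higher_deriv_compose_linear[OF sT U T U0]) (auto simp: U_def)
  also have "(deriv ^^ n) (\<lambda>x. f1 x + f2 x) 0 = (deriv ^^ n) f1 0 + (deriv ^^ n) f2 0"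
    by (rule higher_deriv_add[OF hol(1,2) U U0])
  also have "(deriv ^^ n) f1 0 = 1 ^ n * (deriv ^^ n) (int_shift_sum 1) (1 * 0 + 1 / 4)"
    unfolding f1_def by (rule higher_deriv_compose_linear'[OF hZ U Z U0]) (auto simp: U_def)
  also have "(deriv ^^ n) f2 0 = (- 1) ^ n * (deriv ^^ n) (int_shift_sum 1) ((- 1) * 0 + 1 / 4)"
    unfolding f2_def by (rule higher_deriv_compose_linear'[OF hZ U Z U0]) (auto simp: U_def)
  finally have "(deriv ^^ n) (int_shift_sum 1) (1 / 4) = of_real pi * c ^ n * euler_number n"
    using sE[of n] by (simp add: n_def del: One_nat_def)
  moreover have "int_shift_sum (Suc n) (1 / 4) = (- 1) ^ n * (deriv ^^ n) (int_shift_sum 1) (1 / 4) / fact n"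
    by (rule int_shift_sum_eq_higher_deriv) fact
  ultimately show ?thesis by (simp add: n_def c_def)
qed

text \<open>Up to a factorial this is the difference of a polygamma function of even order at 3/4
  and 1/4, and that function is strictly increasing on the positive reals. It justifies dividing by
  the Euler number.\<close>

lemma int_shift_sum_quarter_nonzero: "int_shift_sum (2 * k + 1) (1 / 4) \<noteq> 0"
proof -
  have "Polygamma (2 * k) (1 / 4 :: real) < Polygamma (2 * k) (3 / 4)" by (rule Polygamma_real_strict_mono) auto
  hence "complex_of_real (Polygamma (2 * k) (1 / 4)) \<noteq> complex_of_real (Polygamma (2 * k) (3 / 4))" by simp
  hence "Polygamma (2 * k) (1 / 4 :: complex) \<noteq> Polygamma (2 * k) (3 / 4)"
    by (simp add: Polygamma_of_real[symmetric])
  thus ?thesis by (simp add: int_shift_sum_def)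
qed

corollary euler_number_even_nonzero: "euler_number (2 * k) \<noteq> 0"
  using int_shift_sum_quarter[of k] int_shift_sum_quarter_nonzero[of k] by auto

subsection \<open>The Eisenstein part\<close>

definition parity_sign :: "complex \<Rightarrow> int \<Rightarrow> complex" where
  "parity_sign \<epsilon> n = (if even n then 1 else \<epsilon>)"

lemma int_shift_sum_minus:
  assumes "w \<ge> 2" "odd w"
  shows "int_shift_sum w (- z) = - int_shift_sum w z"
proof -
  have "((\<lambda>n::int. - (1 / (z + of_int n) ^ w)) has_sum - int_shift_sum w z) UNIV"
    using has_sum_int_shift_sum[OF assms(1)] by (simp add: has_sum_uminus)
  also have "?this \<longleftrightarrow> ((\<lambda>n::int. 1 / (- z + of_int n) ^ w) has_sum - int_shift_sum w z) UNIV"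
  proof (rule has_sum_reindex_bij_witness[of _ uminus uminus])
    fix n :: int
    have "- z + of_int (- n) = - (z + of_int n)" by simp
    moreover have "1 / (- x) ^ w = - (1 / x ^ w)" for x :: complex using assms(2) by simp
    ultimately show "1 / (- z + of_int (- n)) ^ w = - (1 / (z + of_int n) ^ w)" by (simp only:)
  qed auto
  finally show ?thesis using has_sum_unique[OF has_sum_int_shift_sum[OF assms(1)]] by blast
qed

lemma has_sum_sparse:
  fixes f :: "'a \<Rightarrow> 'b::topological_comm_monoid_add" and g :: "'c \<Rightarrow> 'a"
  assumes "inj g" "((\<lambda>x. f (g x)) has_sum S) UNIV" "\<And>y. y \<notin> range g \<Longrightarrow> f y = 0"
  shows "(f has_sum S) UNIV"
proof -
  have "(f has_sum S) (range g)"
    using assms(1,2) by (subst has_sum_reindex) (auto simp: o_def)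
  moreover have "(f has_sum S) UNIV \<longleftrightarrow> (f has_sum S) (range g)"
    by (rule has_sum_cong_neutral) (use assms(3) in auto)
  ultimately show ?thesis by blast
qed

lemma has_sum_int_shift_sum_even:
  assumes "w \<ge> 2"
  shows "((\<lambda>n::int. if even n then 1 / (z + of_int n) ^ w else 0) has_sum int_shift_sum w (z / 2) / 2 ^ w) UNIV"
proof (rule has_sum_sparse[of "\<lambda>j. 2 * j"])
  have "1 / (z / 2 + of_int j) ^ w / 2 ^ w = 1 / (z + of_int (2 * j)) ^ w" for j
  proof -
    have "z + of_int (2 * j) = (z / 2 + of_int j) * 2" by simp
    thus ?thesis by (simp only: power_mult_distrib) simp
  qed
  thus "((\<lambda>j. if even (2 * j) then 1 / (z + of_int (2 * j)) ^ w else 0) has_sum int_shift_sum w (z / 2) / 2 ^ w) UNIV"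
    using has_sum_divide_const[OF has_sum_int_shift_sum[OF assms, of "z / 2"], of "2 ^ w"] by simp
qed (auto simp: inj_on_def)

text \<open>The sum of \<open>\<epsilon> ^ n / (z + n) ^ w\<close>: a sign \<open>(- 1) ^ n\<close>
  is twice the indicator of the even numbers minus 1.\<close>

definition signed_shift_sum :: "nat \<Rightarrow> complex \<Rightarrow> complex \<Rightarrow> complex" where
  "signed_shift_sum w \<epsilon> z =
     (if \<epsilon> = 1 then int_shift_sum w z else 2 * (int_shift_sum w (z / 2) / 2 ^ w) - int_shift_sum w z)"

lemma has_sum_signed_shift_sum:
  assumes "w \<ge> 2" "\<epsilon> = 1 \<or> \<epsilon> = - 1"
  shows "((\<lambda>n. parity_sign \<epsilon> n / (z + of_int n) ^ w) has_sum signed_shift_sum w \<epsilon> z) UNIV"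
proof (cases "\<epsilon> = 1")
  case True
  thus ?thesis using has_sum_int_shift_sum[OF assms(1), of z] by (simp add: parity_sign_def signed_shift_sum_def)
next
  case False
  hence \<epsilon>: "\<epsilon> = - 1" using assms by simp
  have "((\<lambda>n::int. 2 * (if even n then 1 / (z + of_int n) ^ w else 0) - 1 / (z + of_int n) ^ w) has_sum
          (2 * (int_shift_sum w (z / 2) / 2 ^ w) - int_shift_sum w z)) UNIV"
    by (intro has_sum_minus has_sum_cmult_right has_sum_int_shift_sum_even has_sum_int_shift_sum assms)
  moreover have "2 * (if even n then 1 / (z + of_int n) ^ w else 0) - 1 / (z + of_int n) ^ w = parity_sign \<epsilon> n / (z + of_int n) ^ w" for n
    by (simp add: parity_sign_def \<epsilon>)
  ultimately show ?thesis using False by (simp add: signed_shift_sum_def)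
qed

lemma signed_shift_sum_minus:
  "w \<ge> 2 \<Longrightarrow> odd w \<Longrightarrow> signed_shift_sum w \<epsilon> (- z) = - signed_shift_sum w \<epsilon> z"
  using int_shift_sum_minus[of w z] int_shift_sum_minus[of w "z / 2"] by (simp add: signed_shift_sum_def)

definition eis_weight :: "complex \<Rightarrow> int \<Rightarrow> int \<Rightarrow> complex" where
  "eis_weight \<epsilon> m n = chi_m4 m * parity_sign \<epsilon> n"

lemma norm_eis_weight_le: "\<epsilon> = 1 \<or> \<epsilon> = - 1 \<Longrightarrow> norm (eis_weight \<epsilon> m n) \<le> 1"
  using norm_chi_m4_le[of m] by (auto simp: eis_weight_def norm_mult parity_sign_def)

lemma chi_m4_even: "even m \<Longrightarrow> chi_m4 m = 0"
proof -
  assume "even m"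
  hence "m mod 4 \<noteq> 1" "m mod 4 \<noteq> 3" by presburger+
  thus ?thesis by (simp add: chi_m4_def)
qed

lemma lattice_sum_cmult: "lattice_sum w (\<lambda>m n. c * \<phi> m n) \<tau> = c * lattice_sum w \<phi> \<tau>"
proof -
  have "lattice_sum w (\<lambda>m n. c * \<phi> m n) \<tau> = (\<Sum>\<^sub>\<infinity>x\<in>UNIV. c * (case x of (m, n) \<Rightarrow> \<phi> m n / (of_int m * \<tau> + of_int n) ^ w))"
    unfolding lattice_sum_def by (intro infsum_cong) (auto split: prod.splits)
  thus ?thesis by (simp add: lattice_sum_def infsum_cmult_right')
qed

text \<open>Replacing \<open>n\<close> by \<open>n - m\<close> produces
  \<open>\<epsilon> ^ m\<close>, and \<open>chi_m4\<close> restricts the sum to odd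
  \<open>m\<close>.\<close>

lemma lattice_sum_translate:
  assumes "\<epsilon> = 1 \<or> \<epsilon> = - 1" "Im \<tau> > 0"
  shows "lattice_sum w (eis_weight \<epsilon>) (\<tau> + 1) = \<epsilon> * lattice_sum w (eis_weight \<epsilon>) \<tau>"
proof -
  have "eis_weight \<epsilon> m (n - m) = \<epsilon> * eis_weight \<epsilon> m n" for m n
    using assms(1) chi_m4_even[of m] by (cases "even m") (auto simp: eis_weight_def parity_sign_def)
  thus ?thesis
    using slash_lattice_sum[of \<tau> 1 1 1 0 w "eis_weight \<epsilon>"] assms(2)
    by (simp add: slash_def lattice_sum_cmult)
qed

lemma lattice_sum_unipotent:
  assumes "Im \<tau> > 0"
  shows "slash w 1 0 4 1 (lattice_sum w (eis_weight \<epsilon>)) \<tau> = lattice_sum w (eis_weight \<epsilon>) \<tau>"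
proof -
  have "eis_weight \<epsilon> (m - n * 4) n = eis_weight \<epsilon> m n" for m n
    using chi_m4_plus[of "- (n * 4)" m] by (simp add: eis_weight_def)
  thus ?thesis using slash_lattice_sum[of \<tau> 1 1 0 4 w "eis_weight \<epsilon>"] assms by simp
qed

text \<open>The numbers \<open>4 * j + 1\<close> cover the residue 1 and their negatives the residue
  3. As \<open>w\<close> is odd, both classes contribute the same amount, hence the factor
  2.\<close>

lemma has_sum_chi_m4_power:
  assumes "w \<ge> 2" "odd w"
  shows "((\<lambda>n. chi_m4 n / of_int n ^ w) has_sum (2 * int_shift_sum w (1 / 4) / 4 ^ w)) UNIV"
proof -
  define R where "R = int_shift_sum w (1 / 4)"
  have base: "((\<lambda>j::int. 1 / of_int (4 * j + 1) ^ w) has_sum R / 4 ^ w) UNIV"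
  proof -
    have "1 / (1 / 4 + of_int j) ^ w / 4 ^ w = 1 / (of_int (4 * j + 1) :: complex) ^ w" for j
    proof -
      have "of_int (4 * j + 1) = (1 / 4 + of_int j :: complex) * 4" by simp
      thus ?thesis by (simp only: power_mult_distrib) simp
    qed
    thus ?thesis
      using has_sum_divide_const[OF has_sum_int_shift_sum[OF assms(1), of "1 / 4"], of "4 ^ w"] by (simp add: R_def)
  qed
  have 1: "((\<lambda>n::int. if n mod 4 = 1 then 1 / of_int n ^ w else 0) has_sum R / 4 ^ w) UNIV"
  proof (rule has_sum_sparse[of "\<lambda>j. 4 * j + 1"])
    have "(4 * j + 1) mod 4 = 1" for j :: int by presburger
    thus "((\<lambda>j::int. if (4 * j + 1) mod 4 = 1 then 1 / of_int (4 * j + 1) ^ w else 0) has_sum R / 4 ^ w) UNIV"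
      using base by simp
    fix n :: int assume "n \<notin> range (\<lambda>j. 4 * j + 1)"
    moreover have "n mod 4 = 1 \<Longrightarrow> n = 4 * (n div 4) + 1" by presburger
    ultimately show "(if n mod 4 = 1 then 1 / of_int n ^ w else 0 :: complex) = 0" by auto
  qed (auto simp: inj_on_def)
  have 2: "((\<lambda>n::int. if n mod 4 = 3 then - (1 / of_int n ^ w) else 0) has_sum R / 4 ^ w) UNIV"
  proof (rule has_sum_sparse[of "\<lambda>j. - (4 * j + 1)"])
    have "(- (4 * j + 1)) mod 4 = 3" for j :: int by presburger
    moreover have "- (1 / (- x) ^ w) = 1 / x ^ w" for x :: complex using assms(2) by simp
    hence "- (1 / of_int (- (4 * j + 1)) ^ w) = 1 / (of_int (4 * j + 1) :: complex) ^ w" for j :: int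
      unfolding of_int_minus .
    ultimately show "((\<lambda>j::int. if (- (4 * j + 1)) mod 4 = 3 then - (1 / of_int (- (4 * j + 1)) ^ w) else 0) has_sum R / 4 ^ w) UNIV"
      using base by (simp only: if_True refl)
    fix n :: int assume "n \<notin> range (\<lambda>j. - (4 * j + 1))"
    moreover have "n mod 4 = 3 \<Longrightarrow> n = - (4 * ((- n) div 4) + 1)" by presburger
    ultimately show "(if n mod 4 = 3 then - (1 / of_int n ^ w) else 0 :: complex) = 0" by auto
  qed (auto simp: inj_on_def)
  have "(\<lambda>n. chi_m4 n / of_int n ^ w) = (\<lambda>n. (if n mod 4 = 1 then 1 / of_int n ^ w else 0) + (if n mod 4 = 3 then - (1 / of_int n ^ w) else 0))"
    by (auto simp: chi_m4_def)
  with has_sum_add[OF 1 2] show ?thesis by (simp add: R_def)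
qed

lemma lattice_sum_cusp_infinity:
  assumes "w \<ge> 3" "\<epsilon> = 1 \<or> \<epsilon> = - 1"
  shows "(lattice_sum w (eis_weight \<epsilon>) \<longlongrightarrow> 0) at_i_infinity"
  by (rule lattice_sum_tendsto) (use assms norm_eis_weight_le in \<open>auto simp: eis_weight_def chi_m4_even\<close>)

text \<open>The row \<open>m = 0\<close> of the transported weight is the part of the lattice in the
  direction of the cusp, and nothing else survives in the limit.\<close>

lemma slash_lattice_sum_tendsto:
  assumes "a * d - b * c = 1" "w \<ge> 3" "\<And>m n. norm (\<phi> m n) \<le> 1"
    "((\<lambda>n. \<phi> (- n * c) (n * a) / of_int n ^ w) has_sum L) UNIV"
  shows "(slash w a b c d (lattice_sum w \<phi>) \<longlongrightarrow> L) at_i_infinity"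
proof (rule Lim_transform_eventually)
  show "(lattice_sum w (\<lambda>m n. \<phi> (m * d - n * c) (n * a - m * b)) \<longlongrightarrow> L) at_i_infinity"
    by (rule lattice_sum_tendsto) (use assms in auto)
  show "\<forall>\<^sub>F \<tau> in at_i_infinity. lattice_sum w (\<lambda>m n. \<phi> (m * d - n * c) (n * a - m * b)) \<tau> = slash w a b c d (lattice_sum w \<phi>) \<tau>"
    using eventually_upper_half_plane by eventually_elim (simp add: slash_lattice_sum[OF _ assms(1)])
qed

text \<open>For \<open>c = 2\<close> the surviving row is weighted by \<open>chi_m4\<close> at even
  numbers, which is 0.\<close>

lemma lattice_sum_cusp_half:
  assumes "w \<ge> 3" "\<epsilon> = 1 \<or> \<epsilon> = - 1"
  shows "(slash w (- 1) 0 2 (- 1) (lattice_sum w (eis_weight \<epsilon>)) \<longlongrightarrow> 0) at_i_infinity"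
  by (rule slash_lattice_sum_tendsto) (use assms norm_eis_weight_le in \<open>auto simp: eis_weight_def chi_m4_even\<close>)

lemma lattice_sum_cusp_zero:
  assumes "w \<ge> 3" "odd w" "\<epsilon> = 1 \<or> \<epsilon> = - 1"
  shows "(slash w 0 (- 1) 1 0 (lattice_sum w (eis_weight \<epsilon>)) \<longlongrightarrow> - (2 * int_shift_sum w (1 / 4) / 4 ^ w)) at_i_infinity"
proof (rule slash_lattice_sum_tendsto)
  have "((\<lambda>n. - (chi_m4 n / of_int n ^ w)) has_sum - (2 * int_shift_sum w (1 / 4) / 4 ^ w)) UNIV"
    using has_sum_chi_m4_power[of w] assms by (simp add: has_sum_uminus)
  thus "((\<lambda>n. eis_weight \<epsilon> (- n * 1) (n * 0) / of_int n ^ w) has_sum - (2 * int_shift_sum w (1 / 4) / 4 ^ w)) UNIV"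
    by (simp add: eis_weight_def chi_m4_minus parity_sign_def)
qed (use assms norm_eis_weight_le in auto)

lemma twisted_qexp_sum_alternating:
  assumes "Im z > 0"
  shows "twisted_qexp_sum (\<lambda>d. (- 1) ^ d) k z =
           2 ^ Suc k * power_qexp_sum (Suc k) (2 * z) - power_qexp_sum (Suc k) z"
proof -
  define a where "a = (\<lambda>n. of_nat (Suc n) ^ k * qexp (of_nat (Suc n) * z))"
  have A: "(a has_sum power_qexp_sum (Suc k) z) UNIV"
    unfolding a_def by (rule has_sum_power_qexp_sum[OF assms])
  \<comment> \<open>The index \<open>n\<close> stands for the exponent \<open>d = Suc n\<close>, so
    odd \<open>n\<close> are the even \<open>d\<close>.\<close>
  have "((\<lambda>n. if odd n then 2 * a n else 0) has_sum 2 ^ Suc k * power_qexp_sum (Suc k) (2 * z)) UNIV"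
  proof (rule has_sum_sparse[of "\<lambda>j. 2 * j + 1"])
    have Im2: "Im (2 * z) > 0" using assms by simp
    have eq: "2 * a (2 * j + 1) = 2 ^ Suc k * (of_nat (Suc j) ^ k * qexp (of_nat (Suc j) * (2 * z)))" for j
    proof -
      have "of_nat (Suc (2 * j + 1)) = (2 :: complex) * of_nat (Suc j)" by simp
      thus ?thesis unfolding a_def by (simp only: power_mult_distrib power_Suc mult_ac)
    qed
    have "((\<lambda>j. 2 * a (2 * j + 1)) has_sum 2 ^ Suc k * power_qexp_sum (Suc k) (2 * z)) UNIV"
      unfolding eq by (intro has_sum_cmult_right has_sum_power_qexp_sum Im2)
    thus "((\<lambda>j. if odd (2 * j + 1) then 2 * a (2 * j + 1) else 0) has_sum 2 ^ Suc k * power_qexp_sum (Suc k) (2 * z)) UNIV"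
      by simp
  qed (auto simp: inj_on_def image_def elim!: oddE)
  from has_sum_minus[OF this A]
  have "((\<lambda>n. (- 1) ^ Suc n * a n) has_sum (2 ^ Suc k * power_qexp_sum (Suc k) (2 * z) - power_qexp_sum (Suc k) z)) UNIV"
    by (rule has_sum_cong[THEN iffD1, rotated]) auto
  from sums_unique[OF has_sum_imp_sums[OF this]] show ?thesis by (simp add: a_def twisted_qexp_sum_def)
qed

locale eisenstein_weight =
  fixes k :: nat and \<epsilon> :: complex
  assumes k: "k \<ge> 1" and eps: "\<epsilon> = (- 1) ^ (k + 1)"
begin

abbreviation "eis_lattice_sum \<equiv> lattice_sum (2 * k + 1) (eis_weight \<epsilon>)"

definition "lipschitz_const = (- 2 * of_real pi * \<i>) ^ (2 * k + 1) / fact (2 * k)"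

lemma lipschitz_const_nonzero: "lipschitz_const \<noteq> 0"
  by (simp add: lipschitz_const_def)

lemma eps_cases: "\<epsilon> = 1 \<or> \<epsilon> = - 1"
  unfolding eps by (rule minus_one_power_iff[THEN ssubst]) simp

text \<open>Normalised to be the Eisenstein part without \<open>eis_const\<close> and the lattice
  sum without \<open>2 * lipschitz_const\<close>. The argument \<open>z / 2\<close> reflects the
  exponents n/R for modulus R = 2.\<close>

definition q_expansion :: "complex \<Rightarrow> complex" where
  "q_expansion z = (if even k
     then (2 ^ (2 * k) * divisor_series (\<lambda>_. 1) (2 * k) z - divisor_series (\<lambda>d. (- 1) ^ d) (2 * k) (z / 2)) / 2 ^ (2 * k)
     else divisor_series (\<lambda>_. 1) (2 * k) z)"

text \<open>For even \<open>k\<close> and \<open>u = (m + 1) * z\<close>, the signed row is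
  \<open>L (u / 2) / 2 ^ (2 * k) - L u\<close> up to \<open>lipschitz_const\<close>, and the sign
  \<open>(- 1) ^ d\<close> gives \<open>2 ^ (2 * k + 1) * L u - L (u / 2)\<close>. Subtracting the
  latter from \<open>2 ^ (2 * k) * L u\<close> and dividing by \<open>2 ^ (2 * k)\<close> gives the
  former; this explains the combination of two Eisenstein series in that case.\<close>

lemma has_sum_q_expansion:
  assumes z: "Im z > 0"
  shows "((\<lambda>m. chi_m4 (int (Suc m)) * (signed_shift_sum (2 * k + 1) \<epsilon> (of_nat (Suc m) * z) / lipschitz_const)) has_sum q_expansion z) UNIV"
proof -
  define L where "L = power_qexp_sum (2 * k + 1)"
  have lip: "int_shift_sum (2 * k + 1) u = lipschitz_const * L u" if "Im u > 0" for u
    using lipschitz_summation[of "2 * k + 1" u] k that by (simp add: lipschitz_const_def L_def)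
  have Lsum: "twisted_qexp_sum (\<lambda>_. 1) (2 * k) u = L u" for u
    by (simp add: L_def power_qexp_sum_def twisted_qexp_sum_def)
  have p1: "norm (1 :: complex) \<le> 1" "norm ((- 1 :: complex) ^ d) \<le> 1" for d by (simp_all add: norm_power)
  have 1: "((\<lambda>m. chi_m4 (int (Suc m)) * L (of_nat (Suc m) * z)) has_sum divisor_series (\<lambda>_. 1) (2 * k) z) UNIV"
    using has_sum_divisor_series(2)[of z "\<lambda>_. 1" "2 * k", OF z p1(1)] unfolding Lsum .
  show ?thesis
  proof (cases "even k")
    case False
    hence "\<epsilon> = 1" by (simp add: eps)
    have "L (of_nat (Suc m) * z) = signed_shift_sum (2 * k + 1) \<epsilon> (of_nat (Suc m) * z) / lipschitz_const" for m
    proof -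
      have "Im (of_nat (Suc m) * z) > 0" using z by simp
      from lip[OF this] show ?thesis using lipschitz_const_nonzero \<open>\<epsilon> = 1\<close> by (simp add: signed_shift_sum_def del: of_nat_Suc)
    qed
    with 1 False show ?thesis by (simp add: q_expansion_def del: of_nat_Suc)
  next
    case True
    hence \<epsilon>: "\<epsilon> = - 1" by (simp add: eps)
    have "Im (z / 2) > 0" using z by simp
    have alt: "twisted_qexp_sum (\<lambda>d. (- 1) ^ d) (2 * k) (of_nat (Suc m) * (z / 2)) =
            2 ^ (2 * k + 1) * L (of_nat (Suc m) * z) - L (of_nat (Suc m) * z / 2)" for m
    proof -
      have "Im (of_nat (Suc m) * (z / 2)) > 0" using z by simp
      from twisted_qexp_sum_alternating[OF this, of "2 * k"] show ?thesis by (simp add: L_def del: of_nat_Suc)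
    qed
    have 2: "((\<lambda>m. chi_m4 (int (Suc m)) * (2 ^ (2 * k + 1) * L (of_nat (Suc m) * z) - L (of_nat (Suc m) * z / 2))) has_sum
            divisor_series (\<lambda>d. (- 1) ^ d) (2 * k) (z / 2)) UNIV"
      using has_sum_divisor_series(2)[of "z / 2" "\<lambda>d. (- 1) ^ d" "2 * k", OF \<open>Im (z / 2) > 0\<close> p1(2)] unfolding alt .
    have "((\<lambda>m. (2 ^ (2 * k) * (chi_m4 (int (Suc m)) * L (of_nat (Suc m) * z)) -
              chi_m4 (int (Suc m)) * (2 ^ (2 * k + 1) * L (of_nat (Suc m) * z) - L (of_nat (Suc m) * z / 2))) / 2 ^ (2 * k)) has_sum
            q_expansion z) UNIV"
      using has_sum_divide_const[OF has_sum_minus[OF has_sum_cmult_right[OF 1] 2]] True by (simp add: q_expansion_def)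
    moreover have "(2 ^ (2 * k) * (chi_m4 (int (Suc m)) * L (of_nat (Suc m) * z)) -
              chi_m4 (int (Suc m)) * (2 ^ (2 * k + 1) * L (of_nat (Suc m) * z) - L (of_nat (Suc m) * z / 2))) / 2 ^ (2 * k) =
          chi_m4 (int (Suc m)) * (signed_shift_sum (2 * k + 1) \<epsilon> (of_nat (Suc m) * z) / lipschitz_const)" for m
    proof -
      define u where "u = of_nat (Suc m) * z"
      have "Im u > 0" "Im (u / 2) > 0" using z by (simp_all add: u_def)
      hence "signed_shift_sum (2 * k + 1) \<epsilon> u / lipschitz_const = 2 * (L (u / 2) / 2 ^ (2 * k + 1)) - L u"
        using lip lipschitz_const_nonzero by (simp add: signed_shift_sum_def \<epsilon> field_simps)
      also have "\<dots> = L (u / 2) / 2 ^ (2 * k) - L u" by simp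
      finally have Q: "signed_shift_sum (2 * k + 1) \<epsilon> u / lipschitz_const = L (u / 2) / 2 ^ (2 * k) - L u" .
      show ?thesis unfolding u_def[symmetric] Q by (simp add: field_simps)
    qed
    ultimately show ?thesis by (simp only:)
  qed
qed

text \<open>Both \<open>chi_m4\<close> and the row sums of odd weight are odd in \<open>m\<close>,
  so the rows \<open>m\<close> and \<open>- m\<close> agree. This gives the factor 2; the row
  \<open>m = 0\<close> has weight 0.\<close>

lemma lattice_sum_q_expansion:
  assumes z: "Im z > 0"
  shows "eis_lattice_sum z = 2 * lipschitz_const * q_expansion z"
proof -
  define f where "f = (\<lambda>m. chi_m4 m * signed_shift_sum (2 * k + 1) \<epsilon> (of_int m * z))"
  have w: "2 * k + 1 \<ge> 3" "2 * k + 1 \<ge> 2" "odd (2 * k + 1)" using k by auto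
  have "((\<lambda>(m, n). eis_weight \<epsilon> m n / (of_int m * z + of_int n) ^ (2 * k + 1)) has_sum eis_lattice_sum z) (UNIV \<times> UNIV)"
    by (intro has_sum_lattice_sum z w norm_eis_weight_le eps_cases)
  hence 1: "(f has_sum eis_lattice_sum z) UNIV"
  proof (rule has_sum_SigmaD)
    fix m
    show "((\<lambda>n. case (m, n) of (m, n) \<Rightarrow> eis_weight \<epsilon> m n / (of_int m * z + of_int n) ^ (2 * k + 1)) has_sum f m) UNIV"
      using has_sum_cmult_right[OF has_sum_signed_shift_sum[OF w(2) eps_cases, of "of_int m * z"], of "chi_m4 m"]
      by (simp only: prod.case eis_weight_def f_def times_divide_eq_right)
  qed
  have 2: "((\<lambda>m. f (int (Suc m))) has_sum lipschitz_const * q_expansion z) UNIV"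
    using has_sum_cmult_right[OF has_sum_q_expansion[OF z], of lipschitz_const] lipschitz_const_nonzero
    by (simp add: f_def mult_ac del: of_nat_Suc)
  have fm: "f (- m) = f m" for m
    using signed_shift_sum_minus[OF w(2,3), of \<epsilon> "of_int m * z"] by (simp add: f_def chi_m4_minus)
  hence "((\<lambda>m. f (- int (Suc m))) has_sum lipschitz_const * q_expansion z) UNIV" using 2 by (simp only: fm)
  from has_sum_int_zero_split[OF 2 this]
  have "(f has_sum 2 * lipschitz_const * q_expansion z) UNIV" by (simp add: f_def chi_m4_even mult.assoc)
  with 1 show ?thesis by (rule has_sum_unique)
qed

lemma q_expansion_holomorphic: "q_expansion holomorphic_on \<H>"
proof -
  have h1: "divisor_series (\<lambda>_. 1) (2 * k) holomorphic_on \<H>"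
    by (rule divisor_series_holomorphic) simp
  have h2: "divisor_series (\<lambda>d. (- 1) ^ d) (2 * k) holomorphic_on \<H>"
    by (rule divisor_series_holomorphic) (simp add: norm_power)
  have h3: "(divisor_series (\<lambda>d. (- 1) ^ d) (2 * k) \<circ> (\<lambda>z. z / 2)) holomorphic_on \<H>"
    by (rule holomorphic_on_compose_gen[OF _ h2]) (auto intro!: holomorphic_intros)
  show ?thesis
    unfolding q_expansion_def[abs_def] using h1 h3 by (cases "even k") (auto intro!: holomorphic_intros simp: o_def)
qed

text \<open>Unites the opposite signs in the two cases of \<open>eisenstein_part\<close>.\<close>

definition "eis_const = (- 1) ^ k / euler_number (2 * k)"

lemma eisenstein_part_eq: "eisenstein_part k \<tau> = eis_const * q_expansion (2 * \<tau>)"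
  using euler_number_even_nonzero[of k] eisenstein_principal_1[of "2 * k"] eisenstein_principal_2[of "2 * k"]
  by (auto simp: eisenstein_part_def q_expansion_def eis_const_def field_simps)

lemma q_expansion_eq: "Im z > 0 \<Longrightarrow> q_expansion z = eis_lattice_sum z / (2 * lipschitz_const)"
  using lattice_sum_q_expansion[of z] lipschitz_const_nonzero by simp

lemma slash_q_expansion:
  assumes "Im \<tau> > 0" "a * d - b * c = 1"
  shows "slash (2 * k + 1) a b c d q_expansion \<tau> =
    1 / (2 * lipschitz_const) * slash (2 * k + 1) a b c d eis_lattice_sum \<tau>"
proof -
  have "slash (2 * k + 1) a b c d q_expansion \<tau> =
     slash (2 * k + 1) a b c d (\<lambda>z. 1 / (2 * lipschitz_const) * eis_lattice_sum z) \<tau>"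
    by (rule slash_cong) (use assms q_expansion_eq in auto)
  thus ?thesis by (simp only: slash_cmult)
qed

lemma slash_q_expansion_tendsto:
  assumes "(slash (2 * k + 1) a b c d eis_lattice_sum \<longlongrightarrow> L) at_i_infinity" "a * d - b * c = 1"
  shows "(slash (2 * k + 1) a b c d q_expansion \<longlongrightarrow> 1 / (2 * lipschitz_const) * L) at_i_infinity"
proof (rule Lim_transform_eventually)
  show "((\<lambda>\<tau>. 1 / (2 * lipschitz_const) * slash (2 * k + 1) a b c d eis_lattice_sum \<tau>) \<longlongrightarrow>
    1 / (2 * lipschitz_const) * L) at_i_infinity"
    by (intro tendsto_intros assms)
  show "\<forall>\<^sub>F \<tau> in at_i_infinity. 1 / (2 * lipschitz_const) * slash (2 * k + 1) a b c d eis_lattice_sum \<tau> =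
      slash (2 * k + 1) a b c d q_expansion \<tau>"
    using eventually_upper_half_plane by eventually_elim (rule slash_q_expansion[OF _ assms(2), symmetric])
qed

text \<open>The Euler number, the factorial and the even powers of \<open>2 * pi * \<i>\<close>
  cancel. What remains is \<open>pi / (2 * pi * \<i>) = - \<i> / 2\<close> and powers of 2, the
  value of the eta quotient at the cusp 0.\<close>

lemma q_expansion_cusp_zero_const:
  "eis_const * (1 / (2 * lipschitz_const) * - (2 * int_shift_sum (2 * k + 1) (1 / 4) / 4 ^ (2 * k + 1))) =
     (- 1) ^ k * (- \<i>) / 2 ^ (4 * k + 3)"
proof -
  define x where "x = 2 * complex_of_real pi * \<i>"
  have x0: "x \<noteq> 0" by (simp add: x_def)
  have E0: "euler_number (2 * k) \<noteq> 0" by (rule euler_number_even_nonzero)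
  have K: "lipschitz_const = - (x * x ^ (2 * k)) / fact (2 * k)"
    unfolding lipschitz_const_def by (simp add: x_def power_mult_distrib)
  have R: "int_shift_sum (2 * k + 1) (1 / 4) = of_real pi * x ^ (2 * k) * euler_number (2 * k) / fact (2 * k)"
    unfolding x_def by (rule int_shift_sum_quarter)
  have "(4 :: complex) ^ (2 * k + 1) = (2 ^ 2) ^ (2 * k + 1)" by simp
  also have "\<dots> = 2 ^ (2 * (2 * k + 1))" by (rule power_mult[symmetric])
  finally have four: "(4 :: complex) ^ (2 * k + 1) = 2 ^ (4 * k + 2)" by simp
  have "eis_const * (1 / (2 * lipschitz_const) * - (2 * int_shift_sum (2 * k + 1) (1 / 4) / 4 ^ (2 * k + 1))) =
     (- 1) ^ k * (of_real pi / x) / 2 ^ (4 * k + 2)"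
    unfolding eis_const_def K R four using E0 x0 by (simp add: divide_simps)
  also have "of_real pi / x = - \<i> / 2" by (simp add: x_def divide_simps)
  also have "(- 1) ^ k * (- \<i> / 2) / 2 ^ (4 * k + 2) = (- 1) ^ k * (- \<i>) / (2 ^ (4 * k + 3) :: complex)"
    by (simp add: power_add)
  finally show ?thesis .
qed

end

theorem theorem1p1:
  fixes k :: nat
  assumes "k \<ge> 1"
  shows "(\<lambda>\<tau>. eta_quotient k \<tau> - eisenstein_part k \<tau>) \<in> cusp_forms (2 * k + 1) 8 chi_m4"
proof -
  define \<epsilon> :: complex where "\<epsilon> = (- 1) ^ (k + 1)"
  interpret eisenstein_weight k \<epsilon> by unfold_locales (use assms in \<open>auto simp: \<epsilon>_def\<close>)
  define D where "D = (\<lambda>z. eta_form k z - eis_const * q_expansion z)"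
  have w: "2 * k + 1 \<ge> 3" "odd (2 * k + 1)" using assms by auto
  have slash_D: "slash (2 * k + 1) a b c d D \<tau> =
    slash (2 * k + 1) a b c d (eta_form k) \<tau> - eis_const * slash (2 * k + 1) a b c d q_expansion \<tau>" for a b c d \<tau>
    by (simp add: slash_def D_def diff_divide_distrib)
  have id: "slash (2 * k + 1) 1 0 0 1 f = f" for f by (simp add: slash_def fun_eq_iff)
  interpret gamma0_4_cusp_form "2 * k + 1" \<epsilon> D
  proof
    show "odd (2 * k + 1)" by simp
    show "\<epsilon> = 1 \<or> \<epsilon> = - 1" by (rule eps_cases)
    show "D (\<tau> + 1) = \<epsilon> * D \<tau>" if "Im \<tau> > 0" for \<tau>
    proof -
      have "q_expansion (\<tau> + 1) = \<epsilon> * q_expansion \<tau>"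
        using q_expansion_eq[of "\<tau> + 1"] q_expansion_eq[of \<tau>] lattice_sum_translate[OF eps_cases that] that by simp
      thus ?thesis using eta_form_plus_1[OF assms, of \<tau>] by (simp add: D_def \<epsilon>_def algebra_simps)
    qed
    show "slash (2 * k + 1) 1 0 4 1 D \<tau> = D \<tau>" if "Im \<tau> > 0" for \<tau>
    proof -
      have "slash (2 * k + 1) 1 0 4 1 q_expansion \<tau> = q_expansion \<tau>"
        using slash_q_expansion[OF that, of 1 1 0 4] unfolding lattice_sum_unipotent[OF that] q_expansion_eq[OF that] by simp
      thus ?thesis unfolding slash_D eta_form_unipotent[OF assms that] by (simp add: D_def)
    qed
    show "D holomorphic_on \<H>"
      unfolding D_def by (intro holomorphic_intros eta_form_holomorphic q_expansion_holomorphic)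
    have "(q_expansion \<longlongrightarrow> 0) at_i_infinity"
      using slash_q_expansion_tendsto[of 1 0 0 1 0, unfolded id] lattice_sum_cusp_infinity[OF w(1) eps_cases] by simp
    from tendsto_diff[OF eta_form_tendsto_0[OF assms] tendsto_mult_right_zero[OF this]]
    show "(D \<longlongrightarrow> 0) at_i_infinity" by (simp add: D_def[abs_def])
    have "(slash (2 * k + 1) (- 1) 0 2 (- 1) q_expansion \<longlongrightarrow> 0) at_i_infinity"
      using slash_q_expansion_tendsto[OF lattice_sum_cusp_half[OF w(1) eps_cases]] by simp
    from tendsto_diff[OF eta_form_cusp_half[OF assms] tendsto_mult_right_zero[OF this]]
    show "(slash (2 * k + 1) (- 1) 0 2 (- 1) D \<longlongrightarrow> 0) at_i_infinity"
      by (simp only: slash_D[abs_def] diff_self)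
    \<comment> \<open>The only cusp at which the two functions have nonzero limits, so the only
      place where constants must agree.\<close>
    have "((\<lambda>\<tau>. eis_const * slash (2 * k + 1) 0 (- 1) 1 0 q_expansion \<tau>) \<longlongrightarrow> (- 1) ^ k * (- \<i>) / 2 ^ (4 * k + 3)) at_i_infinity"
      unfolding q_expansion_cusp_zero_const[symmetric]
      by (intro tendsto_mult tendsto_const slash_q_expansion_tendsto lattice_sum_cusp_zero w eps_cases) simp
    from tendsto_diff[OF eta_form_cusp_zero[OF assms] this]
    show "(slash (2 * k + 1) 0 (- 1) 1 0 D \<longlongrightarrow> 0) at_i_infinity"
      by (simp only: slash_D[abs_def] diff_self)
  qed
  show ?thesis
    by (rule double_in_cusp_forms) (simp add: D_def eta_quotient_eq eisenstein_part_eq)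
qed

end
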